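(* Let $\mathcal{A}$ be an affine line arrangement in $\mathbb{C}^2$ such that $\chi(\mathcal{A},t)=(t-n)(t-n-r)$ with $n,r\in\mathbb{Z}_{\ge0}$. If $r\ge n-3$, then the freeness of $\mathcal{A}$ depends only on $L(\mathcal{A})$; that is, for every affine line arrangement $\mathcal{A}_1$ in $\mathbb{C}^2$ with $L(\mathcal{A}_1)\cong L(\mathcal{A})$ as posets, $\mathcal{A}_1$ is free if and only if $\mathcal{A}$ is free.
   Context: An affine line arrangement $\mathcal{A}$ in $V=\mathbb{C}^2$ is a finite set of affine lines in $V$. $L(\mathcal{A})$ is the set of all nonempty intersections of subsets of $\mathcal{A}$ (including $V$, the empty intersection), a poset under inclusion. Define $\mu(V)=1$ and $\mu(X)=-\sum_{Y\in L(\mathcal{A}),\,X\subsetneq Y\subset V}\mu(Y)$; the characteristic polynomial is $\chi(\mathcal{A},t)=\sum_{X\in L(\mathcal{A})}\mu(X)t^{\dim X}$. Freeness: let $S=\mathbb{C}[x,y,z]$. The cone $c\mathcal{A}$ is the central arrangement in $\mathbb{C}^3$ consisting of the plane $z=0$ and the planes $cH=\{\alpha_{cH}=0\}$, $H\in\mathcal{A}$, where $\alpha_{cH}$ is the homogenization by $z$ of a degree one polynomial defining $H$. Let $D(c\mathcal{A})=\{\theta\in\mathrm{Der}\,S\mid \theta(\alpha_{cH})\in S\alpha_{cH}\ (\forall H\in\mathcal{A}),\ \theta(z)\in Sz\}$, where $\mathrm{Der}\,S$ is the module of $\mathbb{C}$-derivations of $S$. $\mathcal{A}$ is free if $D(c\mathcal{A})$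 is a free $S$-module (with a homogeneous basis $\theta_E=x\partial_x+y\partial_y+z\partial_z,\theta_1,\theta_2$). *)

theory Defs
  imports
    "HOL-Analysis.Analysis"
    "HOL-Library.Poly_Mapping"
    "HOL-Library.Function_Algebras"
    "HOL-Computational_Algebra.Polynomial"
begin

type_synonym plane = "complex ^ 2"

definition line :: "complex \<Rightarrow> complex \<Rightarrow> complex \<Rightarrow> plane set" where
  "line a b c = {p. a * p $ 1 + b * p $ 2 + c = 0}"

definition affine_line :: "plane set \<Rightarrow> bool" where
  "affine_line H \<longleftrightarrow> (\<exists>a b c. (a, b) \<noteq> (0, 0) \<and> H = line a b c)"

definition affine_line_arrangement :: "plane set set \<Rightarrow> bool" where
  "affine_line_arrangement \<A> \<longleftrightarrow> finite \<A> \<and> (\<forall>H\<in>\<A>. affine_line H)"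

text \<open>Since \<open>\<Inter>{} = UNIV\<close>, the whole plane is always an element.\<close>

definition intersection_poset :: "plane set set \<Rightarrow> plane set set" where
  "intersection_poset \<A> = {X. X \<noteq> {} \<and> (\<exists>\<B>\<subseteq>\<A>. X = \<Inter>\<B>)}"

definition inclusion_isomorphic :: "'a set set \<Rightarrow> 'b set set \<Rightarrow> bool" where
  "inclusion_isomorphic P Q \<longleftrightarrow>
    (\<exists>f. bij_betw f P Q \<and> (\<forall>X\<in>P. \<forall>Y\<in>P. X \<subseteq> Y \<longleftrightarrow> f X \<subseteq> f Y))"

text \<open>The Moebius function of a family \<open>L\<close> of sets containing \<open>UNIV\<close>, ordered by
  inclusion. The value for infinite \<open>L\<close> is a dummy making the recursion total.\<close>

function moebius :: "'a set set \<Rightarrow> 'a set \<Rightarrow> int" where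
  "moebius L X =
    (if infinite L then 0
     else if X = UNIV then 1
     else - (\<Sum>Y\<in>{Y \<in> L. X \<subset> Y}. moebius L Y))"
  by pat_completeness auto
termination
proof (relation "Wellfounded.measure (\<lambda>(L, X). card {Y \<in> L. X \<subset> Y})")
  fix L :: "'a set set" and X Y :: "'a set"
  assume "\<not> infinite L" and "Y \<in> {Y \<in> L. X \<subset> Y}"
  then have "{Z \<in> L. Y \<subset> Z} \<subset> {Z \<in> L. X \<subset> Z}" and "finite {Z \<in> L. X \<subset> Z}"
    by auto
  then have "card {Z \<in> L. Y \<subset> Z} < card {Z \<in> L. X \<subset> Z}"
    by (rule psubset_card_mono[rotated])
  then show "((L, Y), (L, X)) \<in> Wellfounded.measure (\<lambda>(L, X). card {Y \<in> L. X \<subset> Y})"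
    by simp
qed simp

declare moebius.simps [simp del]

text \<open>Complex dimension of a nonempty affine subspace: the dimension of its direction space.\<close>

definition affine_dim :: "plane set \<Rightarrow> nat" where
  "affine_dim X = vec.dim {p - q | p q. p \<in> X \<and> q \<in> X}"

definition characteristic_poly :: "plane set set \<Rightarrow> int poly" where
  "characteristic_poly \<A> =
    (\<Sum>X\<in>intersection_poset \<A>.
       monom (moebius (intersection_poset \<A>) X) (affine_dim X))"

text \<open>Polynomials are finitely supported maps from exponent vectors to coefficients. The
  variables \<open>x\<close>, \<open>y\<close>, \<open>z\<close> have the indices \<open>1\<close>, \<open>2\<close>, \<open>3\<close> of the three-element type \<open>3\<close>.\<close>

type_synonym poly3 = "(3 \<Rightarrow>\<^sub>0 nat) \<Rightarrow>\<^sub>0 complex"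

definition Const :: "complex \<Rightarrow> poly3" where
  "Const c = Poly_Mapping.single 0 c"

definition Var :: "3 \<Rightarrow> poly3" where
  "Var i = Poly_Mapping.single (Poly_Mapping.single i 1) 1"

definition homogeneous :: "nat \<Rightarrow> poly3 \<Rightarrow> bool" where
  "homogeneous d f \<longleftrightarrow>
    (\<forall>m\<in>Poly_Mapping.keys f. (\<Sum>i\<in>UNIV. Poly_Mapping.lookup m i) = d)"

definition Der :: "(poly3 \<Rightarrow> poly3) set" where
  "Der = {\<theta>. (\<forall>f g. \<theta> (f + g) = \<theta> f + \<theta> g) \<and>
              (\<forall>c f. \<theta> (Const c * f) = Const c * \<theta> f) \<and>
              (\<forall>f g. \<theta> (f * g) = f * \<theta> g + g * \<theta> f)}"

text \<open>Addition on \<open>poly3 \<Rightarrow> poly3\<close> is pointwise, so these maps form a module over \<open>poly3\<close>,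
  of which \<open>Der\<close> is a submodule.\<close>

definition der_scale :: "poly3 \<Rightarrow> (poly3 \<Rightarrow> poly3) \<Rightarrow> poly3 \<Rightarrow> poly3" where
  "der_scale f \<theta> = (\<lambda>g. f * \<theta> g)"

interpretation der: module der_scale
  by unfold_locales (simp_all add: der_scale_def fun_eq_iff algebra_simps)

text \<open>\<open>\<theta> = \<Sum>\<^sub>i \<theta>(x\<^sub>i) \<partial>/\<partial>x\<^sub>i\<close> is homogeneous if its coefficients \<open>\<theta>(x\<^sub>i)\<close> are homogeneous of
  one common degree.\<close>

definition homogeneous_derivation :: "(poly3 \<Rightarrow> poly3) \<Rightarrow> bool" where
  "homogeneous_derivation \<theta> \<longleftrightarrow> \<theta> \<in> Der \<and> (\<exists>d. \<forall>i. homogeneous d (\<theta> (Var i)))"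

definition partial :: "3 \<Rightarrow> poly3 \<Rightarrow> poly3" where
  "partial i f = (\<Sum>m\<in>Poly_Mapping.keys f.
     Poly_Mapping.single (m - Poly_Mapping.single i 1)
       (of_nat (Poly_Mapping.lookup m i) * Poly_Mapping.lookup f m))"

definition euler :: "poly3 \<Rightarrow> poly3" where
  "euler = (\<Sum>i\<in>UNIV. der_scale (Var i) (partial i))"

text \<open>The linear forms defining the planes of the cone over \<open>\<A>\<close>: the form \<open>z\<close>, and for each
  line of \<open>\<A>\<close> all (mutually proportional) homogenizations \<open>a x + b y + c z\<close> of its defining
  polynomials \<open>a x + b y + c\<close>.\<close>

definition cone_forms :: "plane set set \<Rightarrow> poly3 set" where
  "cone_forms \<A> = insert (Var 3)
    {Const a * Var 1 + Const b * Var 2 + Const c * Var 3 | a b c.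
       (a, b) \<noteq> (0, 0) \<and> line a b c \<in> \<A>}"

definition log_derivations :: "plane set set \<Rightarrow> (poly3 \<Rightarrow> poly3) set" where
  "log_derivations \<A> = {\<theta> \<in> Der. \<forall>\<alpha>\<in>cone_forms \<A>. \<alpha> dvd \<theta> \<alpha>}"

definition free_arrangement :: "plane set set \<Rightarrow> bool" where
  "free_arrangement \<A> \<longleftrightarrow>
    (\<exists>\<theta>\<^sub>1 \<theta>\<^sub>2. homogeneous_derivation \<theta>\<^sub>1 \<and> homogeneous_derivation \<theta>\<^sub>2 \<and>
       distinct [euler, \<theta>\<^sub>1, \<theta>\<^sub>2] \<and>
       der.independent {euler, \<theta>\<^sub>1, \<theta>\<^sub>2} \<and>
       der.span {euler, \<theta>\<^sub>1, \<theta>\<^sub>2} = log_derivations \<A>)"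

end

theory Submission
  imports Defs
begin

text \<open>Let \<open>H\<^sub>\<infinity>\<close> be the line at infinity and let \<open>D\<^sub>0\<close> be the module of logarithmic derivations of the
  cone that kill \<open>z\<close>; freeness of \<open>D\<^sub>0\<close> is freeness of the arrangement. Adding one line at a time gives upper and
  lower bounds for the growth of \<open>dim D\<^sub>0\<close>, which agree and show that in large degrees
  the Hilbert function of \<open>D\<^sub>0\<close> only depends on \<open>\<chi>\<close>; so a free arrangement has exponents \<open>(n, n + r)\<close>.

  Restriction to \<open>H\<^sub>\<infinity>\<close> maps \<open>D\<^sub>0\<close>, with kernel \<open>z D\<^sub>0\<close>, to the derivations of the multiarrangement cut out on
  \<open>H\<^sub>\<infinity>\<close>, whose points are the \<open>h\<close> parallel classes and whose multiplicities are their sizes. If no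
  such derivation has degree below \<open>n\<close>, then its Hilbert function adds up to at most that of
  exponents \<open>(n, n + r)\<close>; comparison with \<open>dim D\<^sub>0\<close> makes all restrictions surjective, and two lifts form a
  basis by Saito's criterion. A derivation \<open>p \<partial>\<^sub>v + q \<partial>\<^sub>w\<close> of degree \<open>k < n\<close> is excluded when
  \<open>h = n + 1\<close> or \<open>h = n + r + 1\<close> by comparison with the Euler derivation, and when
  \<open>h \<le> n \<le> r + 3\<close> by the Wronskian of \<open>p\<close> and \<open>q\<close>, whose degree is at most \<open>2 k - 2\<close> and which vanishes to order
  \<open>m - 1\<close> at a point of multiplicity \<open>m\<close>, unless some parallel class has more than \<open>n + r\<close> lines.
  Conversely these conditions on \<open>h\<close> and on the sizes of the parallel classes are necessary
  for freeness, and they can be read off the intersection poset.\<close>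

section \<open>Polynomials in three variables\<close>

text \<open>In general the exponents of a multiarrangement on a line depend on the position of its
  points, which the poset does not record; so everything has to be forced by the number and the
  multiplicities of the points alone. The bound on \<open>r\<close> is what the Wronskian needs: for
  a derivation of degree at most \<open>n - 1\<close> its degree is at most \<open>2 n - 4\<close>,
  while it has at least \<open>2 n + r - h\<close> zeros, which is more as soon as
  \<open>h \<le> r + 3\<close>. The values \<open>h = n + 1\<close> and \<open>h = n + r + 1\<close>
  come from the Euler derivation of the line at infinity: its multiples in the multiarrangement
  module start in degree \<open>2 n + r + 1 - h\<close>, which is \<open>n + r\<close> or
  \<open>n\<close>. For every other \<open>h > n + 1\<close> this degree is incompatible with a
  basis of degrees \<open>n\<close> and \<open>n + r\<close>. Splitting off the Euler derivation of
  the cone turns derivations into pairs \<open>(F, G)\<close>, and the determinant of two pairs is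
  that of Saito's criterion. The product \<open>n (n + r)\<close> enters through the Hilbert
  function in large degrees, where the two exact sequences for an added line give the same quadratic
  in \<open>k\<close>.\<close>

abbreviation (input) "lookup \<equiv> Poly_Mapping.lookup"
abbreviation (input) "single \<equiv> Poly_Mapping.single"
abbreviation (input) "keys \<equiv> Poly_Mapping.keys"

lemma prod_UNIV_3: "prod f (UNIV :: 3 set) = f 1 * f 2 * f 3"
  unfolding UNIV_3 by (simp add: ac_simps)

lemma poly3_sum_single: "(F::poly3) = (\<Sum>m\<in>keys F. single m (lookup F m))"
proof (rule poly_mapping_eqI)
  fix k
  show "lookup F k =
      lookup (\<Sum>m\<in>keys F. single m (lookup F m)) k"
    by (simp add: lookup_sum lookup_single "when_def" sum.delta' in_keys_iff)
qed

lemma poly3_single_induct [case_names single add]: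
  fixes F :: poly3
  assumes "\<And>m c. P (single m c)" "\<And>F G. P F \<Longrightarrow> P G \<Longrightarrow> P (F + G)"
  shows "P F"
proof -
  have "P (\<Sum>m\<in>M. single m (lookup F m))" if "finite M" for M
    using that
  proof (induction M rule: finite_induct)
    case empty
    then show ?case using assms(1)[of 0 0] by simp
  qed (simp add: assms)
  from this[of "keys F"] show ?thesis
    using poly3_sum_single[of F] by simp
qed

lemma Const_0 [simp]: "Const 0 = 0" by (simp add: Const_def)
lemma Const_1 [simp]: "Const 1 = 1" by (simp add: Const_def)
lemma Const_add: "Const (a + b) = Const a + Const b" by (simp add: Const_def single_add)
lemma Const_minus: "Const (- a) = - Const a" by (simp add: Const_def single_uminus)
lemma Const_diff: "Const (a - b) = Const a - Const b" by (simp add: Const_def single_diff)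
lemma Const_mult: "Const (a * b) = Const a * Const b" by (simp add: Const_def mult_single)
lemma Const_eq_iff [simp]: "Const a = Const b \<longleftrightarrow> a = b"
  by (metis Const_def inj_single injD)
lemma Const_eq_0_iff [simp]: "Const a = 0 \<longleftrightarrow> a = 0"
  using Const_eq_iff[of a 0] by simp

lemma Const_mult_single: "Const c * single m d = single m (c * d)"
  by (simp add: Const_def mult_single)

lemma Const_inverse_mult:
  assumes "c \<noteq> 0" shows "Const (inverse c) * (Const c * p) = p"
proof -
  have "Const (inverse c) * Const c = 1"
    using assms Const_mult[of "inverse c" c] by simp
  then show ?thesis by (metis mult.assoc mult_1)
qed

lemma Const_dvd_cancel:
  assumes "c \<noteq> 0" shows "Const c * p dvd q \<longleftrightarrow> p dvd q"
proof
  assume "p dvd q"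
  then obtain k where "q = p * k" by (rule dvdE)
  then have "q = (Const c * p) * (Const (inverse c) * k)"
    using Const_inverse_mult[OF assms, of "p * k"] by (simp only: ac_simps)
  then show "Const c * p dvd q" by (rule dvdI)
qed (rule dvd_mult_right)

lemma dvd_Const_cancel: "c \<noteq> 0 \<Longrightarrow> p dvd Const c * q \<longleftrightarrow> p dvd q"
  by (metis Const_inverse_mult dvd_mult)

lemma lookup_Const_mult: "lookup (Const c * F) m = c * lookup F m"
proof (induction F rule: poly3_single_induct)
  case (single k d)
  then show ?case by (simp add: Const_mult_single lookup_single "when_def")
next
  case (add F G)
  then show ?case by (simp add: lookup_add distrib_left)
qed

subsection \<open>Substitution\<close>

text \<open>One construction serves three targets: values at a point (\<open>ev\<close>),
  restriction to a parametrized line (\<open>rs\<close>) and substitution of polynomials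
  (\<open>cp\<close>).\<close>

locale coeff_hom =
  fixes \<phi> :: "complex \<Rightarrow> 'r::comm_ring_1"
  assumes hom_1: "\<phi> 1 = 1"
    and hom_add: "\<phi> (a + b) = \<phi> a + \<phi> b"
    and hom_mult: "\<phi> (a * b) = \<phi> a * \<phi> b"
begin

lemma hom_0: "\<phi> 0 = 0"
  using hom_add[of 0 0] by simp

definition subst :: "(3 \<Rightarrow> 'r) \<Rightarrow> poly3 \<Rightarrow> 'r" where
  "subst x F = (\<Sum>m\<in>keys F. \<phi> (lookup F m) * (\<Prod>i\<in>UNIV. x i ^ lookup m i))"

lemma subst_superset:
  assumes "finite M" "keys F \<subseteq> M"
  shows "subst x F = (\<Sum>m\<in>M. \<phi> (lookup F m) * (\<Prod>i\<in>UNIV. x i ^ lookup m i))"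
  unfolding subst_def using assms by (intro sum.mono_neutral_left) (auto simp: in_keys_iff hom_0)

lemma subst_single: "subst x (single m c) = \<phi> c * (\<Prod>i\<in>UNIV. x i ^ lookup m i)"
  using subst_superset[of "{m}" "single m c" x] by (simp add: hom_0)

lemma subst_add: "subst x (F + G) = subst x F + subst x G"
proof -
  let ?M = "keys F \<union> keys G"
  have "keys (F + G) \<subseteq> ?M" by (rule keys_add)
  then show ?thesis
    by (subst (1 2 3) subst_superset[of ?M]) (auto simp: lookup_add hom_add distrib_right sum.distrib)
qed

lemma subst_0 [simp]: "subst x 0 = 0" by (simp add: subst_def)

lemma subst_minus: "subst x (- F) = - subst x F"
  using subst_add[of x F "- F"] by (simp add: minus_unique)

lemma subst_diff: "subst x (F - G) = subst x F - subst x G"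
  using subst_add[of x F "- G"] by (simp add: subst_minus)

lemma subst_mult: "subst x (F * G) = subst x F * subst x G"
proof (induction F rule: poly3_single_induct)
  case (single m c)
  show ?case
  proof (induction G rule: poly3_single_induct)
    case (single k d)
    then show ?case
      by (simp add: mult_single subst_single hom_mult lookup_add power_add prod.distrib algebra_simps)
  next
    case (add G H)
    then show ?case by (simp add: distrib_left subst_add)
  qed
next
  case (add F H)
  then show ?case by (simp add: distrib_right subst_add)
qed

lemma subst_Const [simp]: "subst x (Const c) = \<phi> c"
  by (simp add: Const_def subst_single hom_0)

lemma subst_1 [simp]: "subst x 1 = 1"
  using subst_Const[of x 1] by (simp add: hom_1)

lemma subst_Var [simp]: "subst x (Var i) = x i"
proof -
  have "(\<Prod>j\<in>UNIV. x j ^ lookup (single i 1) j) = (\<Prod>j\<in>UNIV. if j = i then x j else 1)"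
    by (intro prod.cong) (auto simp: lookup_single "when_def")
  then show ?thesis by (simp add: Var_def subst_single hom_1)
qed

lemma subst_power: "subst x (F ^ n) = subst x F ^ n"
  by (induction n) (simp_all add: subst_mult)

lemma subst_prod: "subst x (\<Prod>a\<in>S. F a) = (\<Prod>a\<in>S. subst x (F a))"
  by (induction S rule: infinite_finite_induct) (simp_all add: subst_mult)

lemma subst_dvd: "F dvd G \<Longrightarrow> subst x F dvd subst x G"
  by (auto simp: dvd_def subst_mult)

lemmas subst_simps = subst_add subst_diff subst_minus subst_mult

text \<open>Universal property of the polynomial ring; it identifies compositions of substitutions
  by comparing them on the variables.\<close>

lemma subst_unique:
  assumes "\<And>F G. h (F + G) = h F + h G" "\<And>F G. h (F * G) = h F * h G" "\<And>c. h (Const c) = \<phi> c"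
  shows "h F = subst (\<lambda>i. h (Var i)) F"
proof (induction F rule: poly3_single_induct)
  case (single m c)
  have pw: "h (p ^ n) = h p ^ n" for p n
    by (induction n) (use assms(2) assms(3)[of 1] in \<open>simp_all add: hom_1\<close>)
  have m: "single m c = Const c * (\<Prod>i\<in>UNIV. Var i ^ lookup m i)"
  proof -
    have vp: "Var i ^ n = single (single i n) 1" for i n
      by (induction n) (simp_all add: Var_def mult_single flip: single_add)
    have ps: "(\<Prod>i\<in>S. single (f i) 1) = (single (\<Sum>i\<in>S. f i) 1 :: poly3)"
      if "finite S" for S :: "3 set" and f :: "3 \<Rightarrow> (3 \<Rightarrow>\<^sub>0 nat)"
      using that by (induction S rule: finite_induct) (simp_all add: mult_single)
    have "(\<Sum>i\<in>UNIV. single i (lookup m i)) = m"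
      by (rule poly_mapping_eqI) (simp add: lookup_sum lookup_single "when_def" sum.delta')
    moreover have "(\<Prod>i\<in>UNIV. Var i ^ lookup m i) =
       (single (\<Sum>i\<in>UNIV. single i (lookup m i)) 1 :: poly3)"
      unfolding vp by (rule ps) simp
    ultimately show ?thesis by (simp add: Const_mult_single)
  qed
  have hp: "h (\<Prod>i\<in>S. g i) = (\<Prod>i\<in>S. h (g i))" if "finite S" for S :: "3 set" and g
    using that by (induction S rule: finite_induct) (use assms(2) assms(3)[of 1] in \<open>simp_all add: hom_1\<close>)
  show ?case
    by (simp add: m subst_simps assms hp pw subst_prod subst_power)
next
  case (add F G)
  then show ?case by (simp add: subst_add assms(1))
qed

end

interpretation ev: coeff_hom "\<lambda>c::complex. c" by unfold_locales auto
interpretation rs: coeff_hom "\<lambda>c::complex. [:c:]" by unfold_locales auto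
interpretation cp: coeff_hom Const by unfold_locales (auto simp: Const_add Const_mult)

lemma cp_subst_Var [simp]: "cp.subst Var F = F"
  using cp.subst_unique[of "\<lambda>F. F" F] by simp

lemma subst_comp_ev: "ev.subst x (cp.subst y F) = ev.subst (\<lambda>i. ev.subst x (y i)) F"
  using ev.subst_unique[of "\<lambda>F. ev.subst x (cp.subst y F)" F]
  by (simp add: ev.subst_simps cp.subst_simps)

lemma subst_comp_rs: "poly (rs.subst x F) u = ev.subst (\<lambda>i. poly (x i) u) F"
  using ev.subst_unique[of "\<lambda>F. poly (rs.subst x F) u" F]
  by (simp add: ev.subst_simps rs.subst_simps)

text \<open>Kronecker substitution \<open>x \<mapsto> t, y \<mapsto> t^K, z \<mapsto> t^(K\<^sup>2)\<close> with \<open>K\<close> above all exponents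
  separates the monomials.\<close>

lemma ev_eq_0_imp_eq_0:
  fixes F :: poly3
  assumes "\<And>x. ev.subst x F = 0"
  shows "F = 0"
proof (rule ccontr)
  assume "F \<noteq> 0"
  define M where "M = keys F"
  have fin: "finite M" and ne: "M \<noteq> {}" using \<open>F \<noteq> 0\<close> by (auto simp: M_def)
  define K where "K = Suc (Max ((\<lambda>(m, i). lookup m i) ` (M \<times> (UNIV :: 3 set))))"
  have K: "lookup m i < K" if "m \<in> M" for m i
  proof -
    have "lookup m i \<le> Max ((\<lambda>(m, i). lookup m i) ` (M \<times> (UNIV :: 3 set)))"
      using that fin by (intro Max_ge) (auto intro!: image_eqI[of _ _ "(m, i)"])
    then show ?thesis by (simp add: K_def)
  qed
  define e where "e m = lookup m 1 + K * (lookup m 2 + K * lookup m 3)" for m :: "3 \<Rightarrow>\<^sub>0 nat"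
  have inj: "inj_on e M"
  proof (rule inj_onI)
    fix m m' assume m: "m \<in> M" "m' \<in> M" and eq: "e m = e m'"
    have lt: "lookup m i < K" "lookup m' i < K" for i using K m by auto
    have "e m mod K = e m' mod K" "e m div K mod K = e m' div K mod K"
      "e m div K div K = e m' div K div K" using eq by simp_all
    then have "lookup m 1 = lookup m' 1"
      "lookup m 2 = lookup m' 2"
      "lookup m 3 = lookup m' 3"
      using lt[of 1] lt[of 2] by (simp_all add: e_def)
    then show "m = m'"
      by (intro poly_mapping_eqI) (metis exhaust_3)
  qed
  define p where "p = rs.subst (\<lambda>i. if i = 1 then monom 1 1 else if i = 2 then monom 1 K else monom 1 (K * K)) F"
  have p: "p = (\<Sum>m\<in>M. monom (lookup F m) (e m))"
    unfolding p_def rs.subst_def M_def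
  proof (intro sum.cong refl)
    fix m
    have "(\<Prod>i::3\<in>UNIV. (if i = 1 then monom (1::complex) 1 else if i = 2 then monom 1 K else monom 1 (K * K)) ^ lookup m i) = monom 1 (e m)"
      unfolding prod_UNIV_3 by (simp add: monom_power mult_monom e_def algebra_simps)
    then show "[:lookup F m:] * (\<Prod>i::3\<in>UNIV. (if i = 1 then monom 1 1 else if i = 2 then monom 1 K else monom 1 (K * K)) ^ lookup m i) = monom (lookup F m) (e m)"
      by (simp add: smult_monom)
  qed
  obtain m0 where m0: "m0 \<in> M" using ne by auto
  have "coeff p (e m0) = (\<Sum>m\<in>M. if m = m0 then lookup F m else 0)"
    unfolding p coeff_sum using inj m0 by (intro sum.cong) (auto simp: inj_on_eq_iff)
  also have "\<dots> = lookup F m0" using fin m0 by simp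
  also have "\<dots> \<noteq> 0" using m0 by (simp add: M_def in_keys_iff)
  finally have "p \<noteq> 0" by auto
  moreover have "poly p u = 0" for u unfolding p_def subst_comp_rs using assms by simp
  then have "p = 0" using poly_all_0_iff_0 by blast
  ultimately show False by simp
qed

subsection \<open>Homogeneous components\<close>

definition total_deg :: "(3 \<Rightarrow>\<^sub>0 nat) \<Rightarrow> nat" where
  "total_deg m = (\<Sum>i\<in>UNIV. lookup m i)"

lemma homogeneous_iff: "homogeneous d F \<longleftrightarrow> (\<forall>m. lookup F m \<noteq> 0 \<longrightarrow> total_deg m = d)"
  by (auto simp: homogeneous_def total_deg_def in_keys_iff)

lemma homogeneous_0 [simp]: "homogeneous d 0" by (simp add: homogeneous_iff)

lemma homogeneous_add: "homogeneous d F \<Longrightarrow> homogeneous d G \<Longrightarrow> homogeneous d (F + G)"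
  unfolding homogeneous_iff lookup_add by (metis add.right_neutral)

lemma homogeneous_minus: "homogeneous d F \<Longrightarrow> homogeneous d (- F)"
  unfolding homogeneous_iff by simp

lemma homogeneous_diff: "homogeneous d F \<Longrightarrow> homogeneous d G \<Longrightarrow> homogeneous d (F - G)"
  using homogeneous_add[of d F "- G"] homogeneous_minus by simp

lemma homogeneous_Const: "homogeneous 0 (Const c)"
  by (auto simp: homogeneous_iff Const_def lookup_single "when_def" total_deg_def)

lemma homogeneous_Var: "homogeneous 1 (Var i)"
  by (auto simp: homogeneous_iff Var_def lookup_single "when_def" total_deg_def)

lemma homogeneous_mult:
  assumes "homogeneous d F" "homogeneous e G"
  shows "homogeneous (d + e) (F * G)"
  unfolding homogeneous_def
proof
  fix m assume "m \<in> keys (F * G)"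
  then obtain a b where "m = a + b" "a \<in> keys F" "b \<in> keys G"
    using keys_mult[of F G] by blast
  then show "(\<Sum>i\<in>UNIV. lookup m i) = d + e"
    using assms by (simp add: homogeneous_def lookup_add sum.distrib)
qed

lemma homogeneous_Const_mult: "homogeneous d F \<Longrightarrow> homogeneous d (Const c * F)"
  using homogeneous_mult[OF homogeneous_Const] by simp

lemma homogeneous_prod:
  assumes "finite S" "\<And>a. a \<in> S \<Longrightarrow> homogeneous (d a) (F a)"
  shows "homogeneous (\<Sum>a\<in>S. d a) (\<Prod>a\<in>S. F a)"
  using assms by (induction S rule: finite_induct) (use homogeneous_Const[of 1] in \<open>auto intro: homogeneous_mult\<close>)

definition hcomp :: "nat \<Rightarrow> poly3 \<Rightarrow> poly3" where
  "hcomp d F = Poly_Mapping.mapp (\<lambda>m c. if total_deg m = d then c else 0) F"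

lemma lookup_hcomp: "lookup (hcomp d F) m = (if total_deg m = d then lookup F m else 0)"
  by (simp add: hcomp_def lookup_mapp "when_def" in_keys_iff)

lemma homogeneous_hcomp: "homogeneous d (hcomp d F)"
  by (auto simp: homogeneous_iff lookup_hcomp)

lemma hcomp_homogeneous: "homogeneous d F \<Longrightarrow> hcomp e F = (if e = d then F else 0)"
  by (intro poly_mapping_eqI) (auto simp: lookup_hcomp homogeneous_iff)

lemma hcomp_add: "hcomp d (F + G) = hcomp d F + hcomp d G"
  by (intro poly_mapping_eqI) (auto simp: lookup_hcomp lookup_add)

lemma hcomp_single: "hcomp d (single m c) = (if total_deg m = d then single m c else 0)"
  by (intro poly_mapping_eqI) (auto simp: lookup_hcomp lookup_single "when_def")

lemma hcomp_mult_homogeneous: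
  assumes "homogeneous e G"
  shows "hcomp d (G * F) = (if e \<le> d then G * hcomp (d - e) F else 0)"
proof (induction F rule: poly3_single_induct)
  case (single m c)
  have "homogeneous (e + total_deg m) (G * single m c)"
    using assms by (intro homogeneous_mult) (auto simp: homogeneous_iff lookup_single "when_def")
  then show ?case
    by (auto simp: hcomp_homogeneous hcomp_single)
next
  case (add F H)
  then show ?case by (auto simp: distrib_left hcomp_add)
qed

text \<open>Taking the component of degree \<open>d\<close> of \<open>G * F\<close> multiplies
  \<open>G\<close> with a single component of \<open>F\<close>; then \<open>G\<close> is
  cancelled.\<close>

lemma homogeneous_factor:
  assumes "homogeneous e G" "G \<noteq> 0" "homogeneous d (G * F)" "e \<le> d"
  shows "homogeneous (d - e) F"
proof -
  have "G * hcomp (d - e) F = G * F"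
    using hcomp_mult_homogeneous[OF assms(1), of d F] assms(3,4) hcomp_homogeneous[of d "G * F" d] by argo
  then have "hcomp (d - e) F = F" using assms(2) by (metis mult_left_cancel)
  then show ?thesis by (metis homogeneous_hcomp)
qed

lemma homogeneous_factor_less:
  assumes "homogeneous e G" "homogeneous d (G * F)" "d < e"
  shows "G * F = 0"
  using hcomp_mult_homogeneous[OF assms(1), of d F] assms(3) hcomp_homogeneous[OF assms(2), of d] by simp

lemma ev_homogeneous:
  assumes "homogeneous d F"
  shows "ev.subst (\<lambda>i. t * x i) F = t ^ d * ev.subst x F"
  unfolding ev.subst_def sum_distrib_left
proof (intro sum.cong refl)
  fix m assume "m \<in> keys F"
  then have "d = (\<Sum>i\<in>UNIV. lookup m i)" using assms by (simp add: homogeneous_def)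
  then show "lookup F m * (\<Prod>i\<in>UNIV. (t * x i) ^ lookup m i) =
     t ^ d * (lookup F m * (\<Prod>i\<in>UNIV. x i ^ lookup m i))"
    by (simp add: power_mult_distrib prod.distrib power_sum)
qed

section \<open>Dimension estimates\<close>

context vector_space
begin

text \<open>Pairs of polynomials form an infinite-dimensional space, where \<open>dim\<close> has
  the default value 0; hence every estimate below carries a finite set \<open>W\<close> whose span
  contains the sets in question.\<close>

lemma finite_basis_exists:
  assumes "finite W" "S \<subseteq> span W"
  obtains B where "B \<subseteq> S" "independent B" "finite B" "S \<subseteq> span B" "card B = dim S"
proof -
  obtain B where B: "B \<subseteq> S" "independent B" "S \<subseteq> span B" "card B = dim S"
    using basis_exists by blast
  moreover have "finite B" using independent_span_bound[OF assms(1) B(2)] B(1) assms(2) by auto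
  ultimately show ?thesis using that by blast
qed

lemma dim_mono_finite:
  assumes "finite W" "T \<subseteq> span W" "S \<subseteq> T"
  shows "dim S \<le> dim T"
proof -
  obtain B where "finite B" "T \<subseteq> span B" "card B = dim T"
    using finite_basis_exists[OF assms(1,2)] by metis
  then show ?thesis using dim_le_card[of S B] assms(3) by auto
qed

lemma dim_le_kernel_functional:
  assumes W: "finite W" "S \<subseteq> span W" and S: "subspace S"
    and l: "\<And>x y. x \<in> S \<Longrightarrow> y \<in> S \<Longrightarrow> l (x + y) = l x + l y" "\<And>c x. x \<in> S \<Longrightarrow> l (scale c x) = c * l x"
  shows "dim S \<le> dim {x \<in> S. l x = 0} + 1"
proof (cases "\<forall>x\<in>S. l x = 0")
  case True
  then have "{x \<in> S. l x = 0} = S" by auto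
  then show ?thesis by simp
next
  case False
  then obtain x0 where x0: "x0 \<in> S" "l x0 \<noteq> 0" by auto
  let ?T = "{x \<in> S. l x = 0}"
  obtain B where B: "B \<subseteq> ?T" "finite B" "?T \<subseteq> span B" "card B = dim ?T"
    using finite_basis_exists[of W ?T] W by (metis (no_types, lifting) mem_Collect_eq subset_iff)
  have "S \<subseteq> span (insert x0 B)"
  proof
    fix x assume x: "x \<in> S"
    \<comment> \<open>Subtracting \<open>c\<close> times \<open>x0\<close> moves \<open>x\<close>
      into the kernel of \<open>l\<close>.\<close>
    define c where "c = l x / l x0"
    have "scale (- c) x0 \<in> S" using S x0 subspace_scale by blast
    then have "x + (scale (- c) x0) \<in> S" "l (x + (scale (- c) x0)) = l x + (- c) * l x0"
      using x S l(1)[OF x, of "scale (- c) x0"] l(2)[OF x0(1), of "- c"] subspace_add by metis+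
    then have "x + (scale (- c) x0) \<in> ?T" using x0 by (auto simp: c_def)
    then have "x - scale c x0 \<in> span B" using B(3) by auto
    then show "x \<in> span (insert x0 B)" using in_span_insert span_breakdown_eq by blast
  qed
  then have "dim S \<le> card (insert x0 B)" using B(2) by (intro dim_le_card) auto
  also have "\<dots> \<le> dim ?T + 1" using B(2,4) by (metis Suc_eq_plus1 card_insert_le_m1 card_insert_if le_SucI order_refl)
  finally show ?thesis .
qed

lemma dim_le_kernel_functionals:
  assumes W: "finite W" "S \<subseteq> span W" and S: "subspace S"
    and l: "\<And>i x y. x \<in> S \<Longrightarrow> y \<in> S \<Longrightarrow> l i (x + y) = l i x + l i y" "\<And>i c x. x \<in> S \<Longrightarrow> l i (scale c x) = c * l i x"
  shows "dim S \<le> dim {x \<in> S. \<forall>i<m. l i x = 0} + m"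
proof (induction m)
  case (Suc m)
  let ?T = "\<lambda>m. {x \<in> S. \<forall>i<m. l i x = 0}"
  have z: "l i 0 = 0" for i using l(2)[of 0 i 0] S by (simp add: subspace_0)
  have "subspace (?T m)"
    using S z by (auto simp: subspace_def l)
  moreover have "{x \<in> ?T m. l m x = 0} = ?T (Suc m)" by (auto simp: less_Suc_eq)
  ultimately have "dim (?T m) \<le> dim (?T (Suc m)) + 1"
    using dim_le_kernel_functional[of W "?T m" "l m"] W l order.trans[of "?T m" S "span W"] by auto
  then show ?case using Suc by linarith
qed simp

lemma dim_image_le_on:
  assumes W: "finite W" "S \<subseteq> span W" and S: "subspace S"
    and f: "\<And>x y. x \<in> S \<Longrightarrow> y \<in> S \<Longrightarrow> f (x + y) = f x + f y" "\<And>c x. x \<in> S \<Longrightarrow> f (scale c x) = scale c (f x)"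
  shows "dim (f ` S) \<le> dim S"
proof -
  obtain B where B: "B \<subseteq> S" "finite B" "S \<subseteq> span B" "card B = dim S"
    using finite_basis_exists[OF W] by metis
  have "x \<in> S \<and> f x \<in> span (f ` B)" if "x \<in> span B" for x
    using that
  proof (induction rule: span_induct_alt)
    case base
    then show ?case using f(2)[of 0 0] S by (simp add: subspace_0 span_zero)
  next
    case (step c x y)
    then have x: "x \<in> S" using B by auto
    then have cx: "scale c x \<in> S" using S subspace_scale by blast
    have "f (scale c x + y) = scale c (f x) + f y" using f(1)[OF cx] f(2)[OF x] step by simp
    moreover have "f x \<in> span (f ` B)" using step by (auto intro: span_base)
    ultimately show ?case using step S cx subspace_add[OF S cx] span_add span_scale by metis
  qed
  then have "f ` S \<subseteq> span (f ` B)" using B(3) by auto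
  then have "dim (f ` S) \<le> card (f ` B)" using B(2) by (intro dim_le_card) auto
  also have "\<dots> \<le> dim S" using B(2,4) card_image_le by metis
  finally show ?thesis .
qed

text \<open>The subspace \<open>S\<close> is filtered by the degree of the pair \<open>(P x, Q x)\<close>; the \<open>j\<close>-th step of the
  filtration is detected by leading coefficients in a space of dimension \<open>c j\<close>.\<close>

lemma dim_le_leading_coeffs:
  fixes P Q :: "'b \<Rightarrow> 'a poly" and c :: "nat \<Rightarrow> nat"
  assumes W: "finite W" "S \<subseteq> span W" and S: "subspace S"
    and P: "\<And>x y. P (x + y) = P x + P y" "\<And>a x. P (scale a x) = smult a (P x)"
    and Q: "\<And>x y. Q (x + y) = Q x + Q y" "\<And>a x. Q (scale a x) = smult a (Q x)"
    and deg: "\<And>x. x \<in> S \<Longrightarrow> degree (P x) \<le> k \<and> degree (Q x) \<le> k"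
    and ker: "\<And>x. x \<in> S \<Longrightarrow> P x = 0 \<Longrightarrow> Q x = 0 \<Longrightarrow> x \<in> T" and T: "T \<subseteq> span W"
    and c0: "\<And>j x. j \<le> k \<Longrightarrow> c j = 0 \<Longrightarrow> x \<in> S \<Longrightarrow> degree (P x) \<le> j \<Longrightarrow> degree (Q x) \<le> j \<Longrightarrow>
       coeff (P x) j = 0 \<and> coeff (Q x) j = 0"
    and c1: "\<And>j x y. j \<le> k \<Longrightarrow> c j = 1 \<Longrightarrow> x \<in> S \<Longrightarrow> degree (P x) \<le> j \<Longrightarrow> degree (Q x) \<le> j \<Longrightarrow>
       y \<in> S \<Longrightarrow> degree (P y) \<le> j \<Longrightarrow> degree (Q y) \<le> j \<Longrightarrow>
       coeff (P x) j * coeff (Q y) j = coeff (P y) j * coeff (Q x) j"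
  shows "dim S \<le> dim T + (\<Sum>j\<le>k. c j)"
proof -
  \<comment> \<open>\<open>R j\<close> collects the elements whose two polynomials have degree below
    \<open>j\<close>, so \<open>R (Suc j)\<close> modulo \<open>R j\<close> is seen by the two
    coefficients at \<open>j\<close>.\<close>
  define R where "R j = {x \<in> S. \<forall>i\<ge>j. coeff (P x) i = 0 \<and> coeff (Q x) i = 0}" for j
  have subR: "subspace (R j)" for j
    using S P(2)[of 0 0] Q(2)[of 0 0] by (auto simp: R_def subspace_def P Q)
  have RW: "R j \<subseteq> span W" for j using W by (auto simp: R_def)
  have R0: "R 0 \<subseteq> T"
    using ker by (auto simp: R_def poly_eq_iff)
  have Rk: "R (Suc k) = S"
    using deg by (fastforce simp: R_def coeff_eq_0)
  have degR: "degree (P x) \<le> j" "degree (Q x) \<le> j" "x \<in> S" if "x \<in> R (Suc j)" for x j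
    using that by (auto simp: R_def intro!: degree_le)
  have R_eq: "{x \<in> R (Suc j). coeff (P x) j = 0 \<and> coeff (Q x) j = 0} = R j" for j
    unfolding R_def by (auto simp: Suc_le_eq) (metis le_neq_implies_less)+
  have step: "dim (R (Suc j)) \<le> dim (R j) + c j" if j: "j \<le> k" for j
  proof -
    consider "c j = 0" | "c j = 1" | "c j \<ge> 2" by linarith
    then show ?thesis
    proof cases
      case 1
      then have "R (Suc j) = R j" using c0[OF j 1] degR[of _ j] R_eq[of j] by auto
      then show ?thesis by simp
    next
      case 2
      have par: "coeff (P x) j * coeff (Q y) j = coeff (P y) j * coeff (Q x) j"
        if "x \<in> R (Suc j)" "y \<in> R (Suc j)" for x y
        using c1[OF j 2] degR[OF that(1)] degR[OF that(2)] by blast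
      \<comment> \<open>By proportionality one coefficient functional suffices: if the first is not
        identically zero, its vanishing forces that of the second.\<close>
      consider x0 where "x0 \<in> R (Suc j)" "coeff (P x0) j \<noteq> 0" | "\<forall>x\<in>R (Suc j). coeff (P x) j = 0" by auto
      then show ?thesis
      proof cases
        case 1
        have "coeff (Q x) j = 0" if "x \<in> R (Suc j)" "coeff (P x) j = 0" for x
          using par[OF 1(1) that(1)] 1(2) that(2) by simp
        then have "{x \<in> R (Suc j). coeff (P x) j = 0} = R j"
          unfolding R_eq[of j, symmetric] by blast
        then show ?thesis
          using dim_le_kernel_functional[OF W(1) RW subR, of "Suc j" "\<lambda>x. coeff (P x) j"] 2 by (simp add: P)
      next
        case 2
        then have "{x \<in> R (Suc j). coeff (Q x) j = 0} = R j"
          unfolding R_eq[of j, symmetric] by auto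
        then show ?thesis
          using dim_le_kernel_functional[OF W(1) RW subR, of "Suc j" "\<lambda>x. coeff (Q x) j"] \<open>c j = 1\<close> by (simp add: Q)
      qed
    next
      case 3
      let ?l = "\<lambda>i x. if i = 0 then coeff (P x) j else coeff (Q x) j"
      have eq: "{x \<in> R (Suc j). \<forall>i<(2::nat). ?l i x = 0} = R j"
        unfolding R_eq[of j, symmetric] by (auto simp: less_2_cases_iff)
      moreover have "dim (R (Suc j)) \<le> dim {x \<in> R (Suc j). \<forall>i<(2::nat). ?l i x = 0} + 2"
        by (rule dim_le_kernel_functionals[OF W(1) RW subR]) (auto simp: P Q)
      ultimately show ?thesis using 3 unfolding eq by linarith
    qed
  qed
  have "dim (R (Suc j)) \<le> dim (R 0) + (\<Sum>i\<le>j. c i)" if "j \<le> k" for j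
    using that
  proof (induction j)
    case 0
    then show ?case using step[of 0] by simp
  next
    case (Suc j)
    then show ?case using step[of "Suc j"] by simp
  qed
  from this[of k] have "dim S \<le> dim (R 0) + (\<Sum>i\<le>k. c i)" by (simp add: Rk)
  also have "dim (R 0) \<le> dim T" by (rule dim_mono_finite[OF W(1) T R0])
  finally show ?thesis by simp
qed

end

section \<open>Derivations of multiarrangements on the line\<close>

lemma linear_power_dvd_cancel:
  fixes g :: "complex poly"
  assumes "[:-a, 1:] ^ m dvd P * g" "poly P a \<noteq> 0"
  shows "[:-a, 1:] ^ m dvd g"
proof (cases "g = 0")
  case False
  have "P \<noteq> 0" using assms(2) by auto
  then have "order a (P * g) = order a g" using False assms(2) by (simp add: order_mult order_0I)
  then show ?thesis using assms(1) False \<open>P \<noteq> 0\<close> by (simp add: order_divides)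
qed simp

lemma prod_linear_powers_dvd:
  fixes f :: "complex poly"
  assumes "finite I" "inj_on u I" "\<And>i. i \<in> I \<Longrightarrow> [:-u i, 1:] ^ m i dvd f"
  shows "(\<Prod>i\<in>I. [:-u i, 1:] ^ m i) dvd f"
  using assms
proof (induction I rule: finite_induct)
  case (insert i I)
  then obtain g where g: "f = (\<Prod>i\<in>I. [:-u i, 1:] ^ m i) * g" by (auto simp: dvd_def)
  have "poly (\<Prod>i\<in>I. [:-u i, 1:] ^ m i) (u i) \<noteq> 0"
    using insert by (auto simp: poly_prod inj_on_def)
  then have "[:-u i, 1:] ^ m i dvd g"
    using insert.prems(2)[of i] g by (auto intro: linear_power_dvd_cancel)
  then show ?case using insert.hyps g by (simp add: mult.commute mult_dvd_mono)
qed simp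

lemma degree_prod_linear_powers: "degree (\<Prod>i\<in>I. [:-u i, 1:] ^ m i :: complex poly) = (\<Sum>i\<in>I. m i)"
proof (cases "finite I")
  case True
  then show ?thesis by (subst degree_prod_eq_sum_degree) (auto simp: degree_power_eq degree_linear_power)
qed simp

text \<open>With \<open>p v + q w\<close> restricted to the line spanned by \<open>v, w\<close>, the factor \<open>x - u\<^sub>i\<close> is the form
  vanishing at \<open>u\<^sub>i v + w\<close>, and \<open>p - u\<^sub>i q\<close> is the value of the derivation on it.\<close>

definition mder :: "'i set \<Rightarrow> ('i \<Rightarrow> complex) \<Rightarrow> ('i \<Rightarrow> nat) \<Rightarrow> (complex poly \<times> complex poly) set" where
  "mder I u m = {(p, q). \<forall>i\<in>I. [:-u i, 1:] ^ m i dvd p - smult (u i) q}"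

text \<open>The determinant does not change when \<open>u i\<close> times the second component is
  subtracted from the first, and then the power at \<open>u i\<close> can be factored out.\<close>

lemma mder_det_dvd:
  assumes "finite I" "inj_on u I" "(p, q) \<in> mder I u m" "(p', q') \<in> mder I u m"
  shows "(\<Prod>i\<in>I. [:-u i, 1:] ^ m i) dvd p * q' - p' * q"
proof (rule prod_linear_powers_dvd[OF assms(1,2)])
  fix i assume "i \<in> I"
  then have "[:-u i, 1:] ^ m i dvd (p - smult (u i) q) * q' - (p' - smult (u i) q') * q"
    using assms(3,4) by (intro dvd_diff) (auto simp: mder_def)
  moreover have "(p - smult (u i) q) * q' - (p' - smult (u i) q') * q = p * q' - p' * q"
    by (simp add: algebra_simps)
  ultimately show "[:-u i, 1:] ^ m i dvd p * q' - p' * q" by simp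
qed

lemma sum_minus_1:
  assumes "\<And>i. i \<in> I \<Longrightarrow> 1 \<le> m i"
  shows "(\<Sum>i\<in>I. m i) = (\<Sum>i\<in>I. m i - 1) + card I"
proof -
  have "(\<Sum>i\<in>I. m i) = (\<Sum>i\<in>I. (m i - 1) + 1)"
    using assms by (intro sum.cong) (use le_add_diff_inverse2 in \<open>metis+\<close>)
  then show ?thesis by (simp only: sum.distrib) simp
qed

text \<open>In the coordinate \<open>x\<close> the Euler derivation is the pair
  \<open>(x, 1)\<close>, and \<open>p - x q\<close> is the determinant with it. This determinant
  vanishes at all points but has degree at most \<open>k + 1\<close>, below their number, so it is 0
  and the derivation is \<open>q\<close> times Euler. The Euler derivation accounts for one zero at
  each point, which leaves \<open>m i - 1\<close> zeros for \<open>q\<close>; the second conclusion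
  counts them.\<close>

lemma mder_euler:
  assumes I: "finite I" "inj_on u I" and m: "\<And>i. i \<in> I \<Longrightarrow> m i \<ge> 1" and pq: "(p, q) \<in> mder I u m"
    and deg: "degree p \<le> k" "degree q \<le> k" and k: "k + 1 < card I"
  shows "p = [:0, 1:] * q" "q = 0 \<or> (\<Sum>i\<in>I. m i) + 1 \<le> k + card I"
proof -
  have "(\<Prod>i\<in>I. [:-u i, 1:] ^ 1) dvd p - [:0, 1:] * q"
  proof (rule prod_linear_powers_dvd[OF I])
    fix i assume i: "i \<in> I"
    have "[:-u i, 1:] dvd p - smult (u i) q"
      using pq i m[OF i] by (auto simp: mder_def dest!: bspec[OF _ i] intro: dvd_trans[rotated] dvd_power)
    moreover have "[:-u i, 1:] dvd [:-u i, 1:] * q" by (rule dvd_triv_left)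
    ultimately have "[:-u i, 1:] dvd p - smult (u i) q - [:-u i, 1:] * q" by (rule dvd_diff)
    also have "p - smult (u i) q - [:-u i, 1:] * q = p - [:0, 1:] * q" by simp
    finally show "[:-u i, 1:] ^ 1 dvd p - [:0, 1:] * q" by simp
  qed
  moreover have "degree (p - [:0, 1:] * q) \<le> k + 1"
    using deg by (intro degree_diff_le order.trans[OF degree_mult_le]) auto
  ultimately have "p - [:0, 1:] * q = 0"
    using k dvd_imp_degree_le degree_prod_linear_powers[of u "\<lambda>_. 1" I] by fastforce
  then show p: "p = [:0, 1:] * q" by simp
  have q: "(\<Prod>i\<in>I. [:-u i, 1:] ^ (m i - 1)) dvd q"
  proof (rule prod_linear_powers_dvd[OF I])
    fix i assume i: "i \<in> I"
    have "[:-u i, 1:] ^ m i dvd p - smult (u i) q" using pq i by (auto simp: mder_def)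
    also have "p - smult (u i) q = [:-u i, 1:] * q" by (simp add: p[simplified])
    also have "m i = Suc (m i - 1)" using m[OF i] by simp
    finally show "[:-u i, 1:] ^ (m i - 1) dvd q" unfolding power_Suc by (subst (asm) dvd_mult_cancel_left) auto
  qed
  show "q = 0 \<or> (\<Sum>i\<in>I. m i) + 1 \<le> k + card I"
  proof (cases "q = 0")
    case False
    then have "q \<noteq> 0" .
    then have "p \<noteq> 0" "degree p = Suc (degree q)" using p by (auto simp: degree_mult_eq)
    moreover have "(\<Sum>i\<in>I. m i - 1) \<le> degree q"
      using dvd_imp_degree_le[OF q \<open>q \<noteq> 0\<close>] by (simp add: degree_prod_linear_powers)
    moreover have "(\<Sum>i\<in>I. m i) = (\<Sum>i\<in>I. m i - 1) + card I" using m by (rule sum_minus_1)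
    ultimately show ?thesis using deg by linarith
  qed simp
qed

section \<open>Wronskians and the exclusion of derivations of low degree\<close>

lemma coeff_mult_top:
  fixes f g :: "'a::comm_semiring_0 poly"
  assumes "degree f \<le> a" "degree g \<le> b"
  shows "coeff (f * g) (a + b) = coeff f a * coeff g b"
proof (cases "degree f = a \<and> degree g = b")
  case True
  then show ?thesis using coeff_mult_degree_sum[of f g] by auto
next
  case False
  then have "degree f < a \<or> degree g < b" using assms by auto
  moreover from this have "degree (f * g) < a + b" using assms degree_mult_le[of f g] by linarith
  ultimately show ?thesis by (auto simp: coeff_eq_0)
qed

text \<open>The naive bound is \<open>2 k - 1\<close>; the coefficient there cancels, since both
  products contribute \<open>k\<close> times the product of the coefficients of \<open>p\<close> and
  \<open>q\<close> at \<open>k\<close>.\<close>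

lemma degree_wronskian_le:
  fixes p q :: "complex poly"
  assumes "degree p \<le> k" "degree q \<le> k" "pderiv p * q - p * pderiv q \<noteq> 0"
  shows "degree (pderiv p * q - p * pderiv q) + 2 \<le> 2 * k"
proof -
  let ?w = "pderiv p * q - p * pderiv q"
  have "k \<noteq> 0"
  proof
    assume "k = 0"
    then have "pderiv p = 0" "pderiv q = 0" using assms by (auto simp: pderiv_eq_0_iff)
    then show False using assms(3) by simp
  qed
  then obtain l where k: "k = Suc l" by (cases k) auto
  have d: "degree (pderiv p) \<le> l" "degree (pderiv q) \<le> l"
    using assms k by (auto simp: degree_pderiv)
  have "coeff (pderiv p * q) (l + k) = coeff (pderiv p) l * coeff q k"
    "coeff (p * pderiv q) (k + l) = coeff p k * coeff (pderiv q) l"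
    using assms d by (auto intro!: coeff_mult_top)
  then have "coeff ?w (k + l) = 0" by (simp add: coeff_pderiv k add.commute)
  moreover have "degree ?w \<le> k + l"
    using assms(1,2) d by (intro degree_diff_le order.trans[OF degree_mult_le]) auto
  ultimately have "degree ?w < k + l" using assms(3)
    by (metis leading_coeff_0_iff order_le_less)
  then show ?thesis using k by simp
qed

text \<open>The derivative of \<open>p / q\<close> is 0. Without quotients: comparing leading
  coefficients forces equal degrees (in characteristic 0), and subtracting a multiple of
  \<open>q\<close> lowers the degree of \<open>p\<close> while keeping the equation.\<close>

lemma wronskian_0_imp_proportional:
  fixes p q :: "complex poly"
  assumes "pderiv p * q = p * pderiv q" "q \<noteq> 0"
  obtains c where "p = smult c q"
proof -
  have "\<exists>c. p = smult c q" if "degree p \<le> n" "pderiv p * q = p * pderiv q" for n p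
    using that
  proof (induction n arbitrary: p rule: less_induct)
    case (less n)
    show ?case
    proof (cases "p = 0")
      case False
      have "degree p = degree q"
      proof -
        have lc: "coeff (pderiv f * g) (degree f + degree g - 1) = of_nat (degree f) * lead_coeff f * lead_coeff g"
          if "f \<noteq> 0" "g \<noteq> 0" for f g :: "complex poly"
        proof (cases "degree f")
          case 0
          then have "pderiv f = 0" by (simp add: pderiv_eq_0_iff)
          then show ?thesis using 0 by simp
        next
          case (Suc l)
          then have "degree (pderiv f) \<le> l" by (simp add: degree_pderiv)
          then have "coeff (pderiv f * g) (l + degree g) = coeff (pderiv f) l * lead_coeff g"
            by (rule coeff_mult_top) simp
          then show ?thesis by (simp add: coeff_pderiv Suc)
        qed
        have "of_nat (degree p) * lead_coeff p * lead_coeff q = of_nat (degree q) * lead_coeff q * lead_coeff p"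
          using lc[of p q] lc[of q p] less.prems(2) False assms(2) by (simp add: add.commute mult.commute)
        then show ?thesis using False assms(2) by simp
      qed
      define c where "c = lead_coeff p / lead_coeff q"
      define d where "d = p - smult c q"
      have Wd: "pderiv d * q = d * pderiv q"
        using less.prems(2) by (simp add: d_def pderiv_diff pderiv_smult algebra_simps)
      have "coeff d (degree q) = 0" using assms(2) \<open>degree p = degree q\<close> by (simp add: d_def c_def)
      moreover have "degree d \<le> degree q" using \<open>degree p = degree q\<close> by (simp add: d_def degree_diff_le)
      ultimately have "d = 0 \<or> degree d < degree q"
        by (metis leading_coeff_0_iff order_le_less)
      then show ?thesis
      proof
        assume "d = 0"
        then show ?thesis by (auto simp: d_def)
      next
        assume "degree d < degree q"
        then obtain e where e: "d = smult e q" using less.IH[of "degree d" d] Wd less.prems(1) \<open>degree p = degree q\<close> by auto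
        then have "p = smult (c + e) q" by (simp add: d_def smult_add_left algebra_simps)
        then show ?thesis by blast
      qed
    qed (auto intro: exI[of _ 0])
  qed
  then show ?thesis using assms(1) that by blast
qed


text \<open>The only place where the inequality between \<open>n\<close> and \<open>r\<close> is
  turned into mathematics. It gives the lower bound \<open>n\<close> for the degrees of the
  multiarrangement, whatever the position of the points.\<close>

lemma mder_eq_0:
  assumes I: "finite I" "inj_on u I" and m: "\<And>i. i \<in> I \<Longrightarrow> 1 \<le> m i \<and> m i \<le> n + r"
    and sum: "(\<Sum>i\<in>I. m i) = 2 * n + r"
    and card: "card I \<le> n \<and> n \<le> r + 3 \<or> card I = n + 1 \<or> card I = n + r + 1"
    and pq: "(p, q) \<in> mder I u m" and deg: "degree p < n" "degree q < n"
  shows "p = 0 \<and> q = 0"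
proof -
  define k where "k = max (degree p) (degree q)"
  have k: "degree p \<le> k" "degree q \<le> k" "k < n" using deg by (auto simp: k_def)
  show ?thesis
  proof (cases "card I \<le> n")
    case False
    then have "k + 1 < card I" using k by linarith
    \<comment> \<open>A nonzero multiple of Euler would need
      \<open>k \<ge> 2 n + r + 1 - card I\<close>, which is \<open>n + r\<close> or \<open>n\<close>
      for the two values of \<open>card I\<close>.\<close>
    from mder_euler[OF I _ pq k(1,2) this] m have e: "p = [:0, 1:] * q" "q = 0 \<or> 2 * n + r + 1 \<le> k + card I"
      using sum by auto
    then show ?thesis using card False k by auto
  next
    case True
    then have h: "card I \<le> r + 3" using card by auto
    have ms: "(\<Sum>i\<in>I. m i) = (\<Sum>i\<in>I. m i - 1) + card I" using m by (intro sum_minus_1) blast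
    let ?w = "pderiv p * q - p * pderiv q"
    have "(\<Prod>i\<in>I. [:-u i, 1:] ^ (m i - 1)) dvd ?w"
    proof (rule prod_linear_powers_dvd[OF I])
      fix i assume i: "i \<in> I"
      define f where "f = p - smult (u i) q"
      have "[:-u i, 1:] ^ Suc (m i - 1) dvd f" using pq i m[OF i] by (auto simp: mder_def f_def)
      then obtain g where g: "f = [:-u i, 1:] ^ Suc (m i - 1) * g" by (auto simp: dvd_def)
      have "pderiv f = [:-u i, 1:] ^ (m i - 1) * (smult (of_nat (Suc (m i - 1))) g + [:-u i, 1:] * pderiv g)"
        unfolding g pderiv_mult pderiv_power_Suc by (simp add: pderiv_pCons algebra_simps)
      then have "[:-u i, 1:] ^ (m i - 1) dvd pderiv f" by (metis dvd_triv_left)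
      moreover have "[:-u i, 1:] ^ (m i - 1) dvd f" unfolding g power_Suc2 mult.assoc by (rule dvd_triv_left)
      ultimately have "[:-u i, 1:] ^ (m i - 1) dvd pderiv f * q - f * pderiv q"
        by (intro dvd_diff dvd_mult2)
      also have "pderiv f * q - f * pderiv q = ?w"
        by (simp add: f_def pderiv_diff pderiv_smult algebra_simps)
      finally show "[:-u i, 1:] ^ (m i - 1) dvd ?w" .
    qed
    \<comment> \<open>At least \<open>2 n + r - (r + 3) = 2 n - 3\<close> zeros stand against a
      degree of at most \<open>2 (n - 1) - 2\<close>.\<close>
    then have "?w = 0"
      using dvd_imp_degree_le[of "\<Prod>i\<in>I. [:-u i, 1:] ^ (m i - 1)" ?w] degree_wronskian_le[OF k(1,2)] k(3) sum h ms
      by (fastforce simp: degree_prod_linear_powers)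
    show ?thesis
    proof (cases "q = 0")
      case True
      then have "(\<Prod>i\<in>I. [:-u i, 1:] ^ m i) dvd p"
        using pq by (intro prod_linear_powers_dvd[OF I]) (auto simp: mder_def)
      then have "p = 0"
        using dvd_imp_degree_le[of "\<Prod>i\<in>I. [:-u i, 1:] ^ m i" p] deg sum by (fastforce simp: degree_prod_linear_powers)
      then show ?thesis using True by simp
    next
      case False
      obtain c where c: "p = smult c q"
        using wronskian_0_imp_proportional[of p q] \<open>?w = 0\<close> False by auto
      \<comment> \<open>Now the derivation is \<open>q\<close> times a constant direction, which
        kills the form of at most one point. At all other points \<open>q\<close> carries the full
        multiplicity; since no multiplicity exceeds \<open>n + r\<close>, that makes at least
        \<open>n\<close> zeros, more than the degree of \<open>q\<close> allows.\<close>
      define J where "J = {i \<in> I. u i \<noteq> c}"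
      have "(\<Prod>i\<in>J. [:-u i, 1:] ^ m i) dvd q"
      proof (rule prod_linear_powers_dvd)
        fix i assume i: "i \<in> J"
        then have "[:-u i, 1:] ^ m i dvd p - smult (u i) q" using pq by (auto simp: mder_def J_def)
        also have "p - smult (u i) q = smult (c - u i) q" by (simp add: c smult_diff_left)
        finally show "[:-u i, 1:] ^ m i dvd q"
          using i dvd_smult_cancel[of _ "c - u i" q] by (auto simp: J_def)
      qed (use I in \<open>auto simp: J_def inj_on_def\<close>)
      then have 1: "(\<Sum>i\<in>J. m i) < n"
        using dvd_imp_degree_le[of "\<Prod>i\<in>J. [:-u i, 1:] ^ m i" q] False deg by (simp add: degree_prod_linear_powers)
      have "(\<Sum>i\<in>I - J. m i) \<le> n + r"
      proof (cases "I - J = {}")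
        case False
        then obtain i where "i \<in> I" "u i = c" by (auto simp: J_def)
        then have "I - J = {i}" using I(2) by (auto simp: J_def inj_on_def)
        then show ?thesis using m \<open>i \<in> I\<close> by simp
      qed (simp only: sum.empty)
      moreover have "(\<Sum>i\<in>I. m i) = (\<Sum>i\<in>J. m i) + (\<Sum>i\<in>I - J. m i)"
        using I by (subst sum.subset_diff[of J I]) (auto simp: J_def)
      ultimately show ?thesis using 1 sum by linarith
    qed
  qed
qed

lemma sum_threshold: "(\<Sum>j\<le>k. if e \<le> j then 1 else 0) = k + 1 - (e::nat)"
  by (induction k) auto

lemma parallel_trans:
  fixes a b c d x y :: "'a::idom"
  assumes "a * y = x * b" "c * y = x * d" "x \<noteq> 0 \<or> y \<noteq> 0"
  shows "a * d = c * b"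
proof (cases "y = 0")
  case True
  then show ?thesis using assms by auto
next
  case False
  have "y * (a * d) = y * (c * b)" using assms(1,2) by algebra
  then show ?thesis using False by simp
qed

text \<open>With \<open>e\<close> the least degree occurring in the image, the first and second basis elements
  contribute from degree \<open>e\<close> and from degree \<open>max e (2 n + r - e)\<close> on.\<close>

lemma dim_le_mder:
  fixes scale :: "complex \<Rightarrow> 'b::ab_group_add \<Rightarrow> 'b" and P Q :: "'b \<Rightarrow> complex poly"
  assumes "vector_space scale"
    and W: "finite W" "S \<subseteq> module.span scale W" and S: "module.subspace scale S"
    and P: "\<And>x y. P (x + y) = P x + P y" "\<And>a x. P (scale a x) = smult a (P x)"
    and Q: "\<And>x y. Q (x + y) = Q x + Q y" "\<And>a x. Q (scale a x) = smult a (Q x)"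
    and deg: "\<And>x. x \<in> S \<Longrightarrow> degree (P x) \<le> k \<and> degree (Q x) \<le> k"
    and ker: "\<And>x. x \<in> S \<Longrightarrow> P x = 0 \<Longrightarrow> Q x = 0 \<Longrightarrow> x \<in> T" and T: "T \<subseteq> module.span scale W"
    and I: "finite I" "inj_on u I" and sum: "(\<Sum>i\<in>I. m i) = 2 * n + r"
    and mder: "\<And>x. x \<in> S \<Longrightarrow> (P x, Q x) \<in> mder I u m"
    and low: "\<And>x. x \<in> S \<Longrightarrow> degree (P x) < n \<Longrightarrow> degree (Q x) < n \<Longrightarrow> P x = 0 \<and> Q x = 0"
  shows "vector_space.dim scale S \<le> vector_space.dim scale T + ((k + 1 - n) + (k + 1 - (n + r)))"
proof -
  interpret vector_space scale by fact
  show ?thesis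
  proof (cases "\<forall>x\<in>S. P x = 0 \<and> Q x = 0")
    case True
    then have "S \<subseteq> T" using ker by auto
    then show ?thesis using dim_mono_finite[OF W(1) T] by (simp add: trans_le_add1)
  next
    case False
    define good where "good j \<longleftrightarrow> (\<exists>x\<in>S. (P x \<noteq> 0 \<or> Q x \<noteq> 0) \<and> degree (P x) \<le> j \<and> degree (Q x) \<le> j)" for j
    have "good k" using False deg by (auto simp: good_def)
    define e where "e = (LEAST j. good j)"
    have "good e" unfolding e_def by (rule LeastI) fact
    then obtain x0 where x0: "x0 \<in> S" "P x0 \<noteq> 0 \<or> Q x0 \<noteq> 0" "degree (P x0) \<le> e" "degree (Q x0) \<le> e"
      by (auto simp: good_def)
    have min: "P x = 0 \<and> Q x = 0" if "x \<in> S" "degree (P x) \<le> j" "degree (Q x) \<le> j" "j < e" for x j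
      using not_less_Least[of j good] that by (auto simp: good_def e_def)
    have "n \<le> e" using low[OF x0(1)] x0 by force
    define c :: "nat \<Rightarrow> nat" where "c j = (if e \<le> j then 1 else 0) + (if max e (2 * n + r - e) \<le> j then 1 else 0)" for j
    have "dim S \<le> dim T + (\<Sum>j\<le>k. c j)"
    proof (rule dim_le_leading_coeffs[OF W S P Q deg ker T])
      fix j x assume "c j = 0" "x \<in> S" "degree (P x) \<le> j" "degree (Q x) \<le> j"
      then show "coeff (P x) j = 0 \<and> coeff (Q x) j = 0"
        using min[of x j] by (auto simp: c_def split: if_splits)
    next
      fix j x y assume c: "c j = 1" and x: "x \<in> S" "degree (P x) \<le> j" "degree (Q x) \<le> j"
        and y: "y \<in> S" "degree (P y) \<le> j" "degree (Q y) \<le> j"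
      \<comment> \<open>\<open>c j = 1\<close> means that \<open>j\<close> has passed the first
        threshold \<open>e\<close> but not the second, so the determinant with \<open>x0\<close> has
        degree below that of the product dividing it.\<close>
      have j: "j + e < 2 * n + r" using c by (auto simp: c_def split: if_splits)
      have par: "P z * Q x0 = P x0 * Q z" if z: "z \<in> S" "degree (P z) \<le> j" "degree (Q z) \<le> j" for z
      proof -
        have "(\<Prod>i\<in>I. [:-u i, 1:] ^ m i) dvd P z * Q x0 - P x0 * Q z"
          using mder_det_dvd[OF I mder[OF z(1)] mder[OF x0(1)]] .
        moreover have "degree (P z * Q x0 - P x0 * Q z) \<le> j + e"
          using z x0 by (intro degree_diff_le order.trans[OF degree_mult_le]) auto
        ultimately show ?thesis
          using dvd_imp_degree_le[of "\<Prod>i\<in>I. [:-u i, 1:] ^ m i" "P z * Q x0 - P x0 * Q z"] j sum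
          by (fastforce simp: degree_prod_linear_powers)
      qed
      have "P x * Q y = P y * Q x"
        using parallel_trans[OF par[OF x] par[OF y] x0(2)] .
      then have "coeff (P x * Q y) (j + j) = coeff (P y * Q x) (j + j)" by simp
      then show "coeff (P x) j * coeff (Q y) j = coeff (P y) j * coeff (Q x) j"
        using x y by (simp add: coeff_mult_top)
    qed
    also have "(\<Sum>j\<le>k. c j) = (k + 1 - e) + (k + 1 - max e (2 * n + r - e))"
      unfolding c_def sum.distrib by (simp only: sum_threshold)
    \<comment> \<open>Convexity of truncated subtraction: for \<open>e \<ge> n\<close> the two
      thresholds lie closer together than \<open>n\<close> and \<open>n + r\<close>, or both exceed
      their mean.\<close>
    also have "\<dots> \<le> (k + 1 - n) + (k + 1 - (n + r))"
      using \<open>n \<le> e\<close> by linarith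
    finally show ?thesis by simp
  qed
qed

text \<open>An image of rank one contributes at most one dimension per degree. This is weaker than
  the sharp increment in degree \<open>n + r\<close>, which yields the second basis element by
  contradiction.\<close>

lemma dim_le_parallel:
  fixes scale :: "complex \<Rightarrow> 'b::ab_group_add \<Rightarrow> 'b" and P Q :: "'b \<Rightarrow> complex poly"
  assumes "vector_space scale"
    and W: "finite W" "S \<subseteq> module.span scale W" and S: "module.subspace scale S"
    and P: "\<And>x y. P (x + y) = P x + P y" "\<And>a x. P (scale a x) = smult a (P x)"
    and Q: "\<And>x y. Q (x + y) = Q x + Q y" "\<And>a x. Q (scale a x) = smult a (Q x)"
    and deg: "\<And>x. x \<in> S \<Longrightarrow> degree (P x) \<le> k \<and> degree (Q x) \<le> k"
    and ker: "\<And>x. x \<in> S \<Longrightarrow> P x = 0 \<Longrightarrow> Q x = 0 \<Longrightarrow> x \<in> T" and T: "T \<subseteq> module.span scale W"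
    and low: "\<And>x. x \<in> S \<Longrightarrow> degree (P x) < n \<Longrightarrow> degree (Q x) < n \<Longrightarrow> P x = 0 \<and> Q x = 0"
    and par: "\<And>x y. x \<in> S \<Longrightarrow> y \<in> S \<Longrightarrow> P x * Q y = P y * Q x"
  shows "vector_space.dim scale S \<le> vector_space.dim scale T + (k + 1 - n)"
proof -
  interpret vector_space scale by fact
  have "dim S \<le> dim T + (\<Sum>j\<le>k. if n \<le> j then 1 else 0)"
  proof (rule dim_le_leading_coeffs[OF W S P Q deg ker T])
    fix j x assume "(if n \<le> j then 1 else 0::nat) = 0" "x \<in> S" "degree (P x) \<le> j" "degree (Q x) \<le> j"
    then show "coeff (P x) j = 0 \<and> coeff (Q x) j = 0"
      using low[of x] by (auto split: if_splits)
  next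
    fix j x y assume x: "x \<in> S" "degree (P x) \<le> j" "degree (Q x) \<le> j"
      and y: "y \<in> S" "degree (P y) \<le> j" "degree (Q y) \<le> j"
    then have "coeff (P x * Q y) (j + j) = coeff (P y * Q x) (j + j)" using par by simp
    then show "coeff (P x) j * coeff (Q y) j = coeff (P y) j * coeff (Q x) j"
      using x y by (simp add: coeff_mult_top)
  qed
  then show ?thesis by (simp only: sum_threshold)
qed

section \<open>Linear forms\<close>

lemma poly3_single_eq: "single m c = Const c * (\<Prod>i\<in>UNIV. Var i ^ lookup m i)"
proof -
  have "cp.subst Var (single m c) = Const c * (\<Prod>i\<in>UNIV. Var i ^ lookup m i)"
    by (simp only: cp.subst_single)
  then show ?thesis by simp
qed

lemma poly3_induct [case_names Const Var add mult]:
  fixes F :: poly3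
  assumes C: "\<And>c. P (Const c)" and V: "\<And>i. P (Var i)"
    and add: "\<And>F G. P F \<Longrightarrow> P G \<Longrightarrow> P (F + G)" and mult: "\<And>F G. P F \<Longrightarrow> P G \<Longrightarrow> P (F * G)"
  shows "P F"
proof (induction F rule: poly3_single_induct)
  case (single m c)
  have 1: "P 1" using C[of 1] by simp
  have pow: "P (Var i ^ n)" for i n by (induction n) (auto intro: 1 V mult)
  have "P (\<Prod>i\<in>S. Var i ^ lookup m i)" if "finite S" for S
    using that by (induction S rule: finite_induct) (auto intro: 1 mult pow)
  then show ?case unfolding poly3_single_eq by (auto intro: C mult)
qed (rule add)

definition lform :: "complex \<Rightarrow> complex \<Rightarrow> complex \<Rightarrow> poly3" where
  "lform a b c = Const a * Var 1 + Const b * Var 2 + Const c * Var 3"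

lemma ev_lform [simp]: "ev.subst x (lform a b c) = a * x 1 + b * x 2 + c * x 3"
  by (simp add: lform_def ev.subst_simps)

lemma homogeneous_lform: "homogeneous 1 (lform a b c)"
  unfolding lform_def by (intro homogeneous_add homogeneous_Const_mult homogeneous_Var)

lemma lform_scale: "Const s * lform a b c = lform (s * a) (s * b) (s * c)"
  by (simp add: lform_def Const_mult algebra_simps)

text \<open>The kernel of the projection along \<open>e\<close> onto the plane is the ideal of the plane.\<close>

lemma lform_projection:
  assumes "(a, b, c) \<noteq> (0, 0, 0)"
  obtains y where "\<And>F. lform a b c dvd F \<longleftrightarrow> cp.subst y F = 0"
    "\<And>F. lform a b c dvd F \<longleftrightarrow> (\<forall>x. a * x 1 + b * x 2 + c * x 3 = 0 \<longrightarrow> ev.subst x F = 0)"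
proof -
  have "\<exists>e :: 3 \<Rightarrow> complex. a * e 1 + b * e 2 + c * e 3 = 1"
  proof -
    consider "a \<noteq> 0" | "b \<noteq> 0" | "c \<noteq> 0" using assms by auto
    then show ?thesis
    proof cases
      case 1
      then show ?thesis by (intro exI[of _ "\<lambda>i. if i = 1 then inverse a else 0"]) simp
    next
      case 2
      then show ?thesis by (intro exI[of _ "\<lambda>i. if i = 2 then inverse b else 0"]) simp
    next
      case 3
      then show ?thesis by (intro exI[of _ "\<lambda>i. if i = 3 then inverse c else 0"]) simp
    qed
  qed
  then obtain e :: "3 \<Rightarrow> complex" where e: "a * e 1 + b * e 2 + c * e 3 = 1" by blast
  let ?\<alpha> = "lform a b c"
  define y where "y i = Var i - Const (e i) * ?\<alpha>" for i
  have dvd: "?\<alpha> dvd F - cp.subst y F" for F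
  proof (induction F rule: poly3_induct)
    case (Var i)
    then show ?case by (simp add: y_def)
  next
    case (add F G)
    have "F + G - cp.subst y (F + G) = (F - cp.subst y F) + (G - cp.subst y G)"
      by (simp add: cp.subst_add)
    then show ?case using dvd_add[OF add] by (simp only:)
  next
    case (mult F G)
    have "F * G - cp.subst y (F * G) = (F - cp.subst y F) * G + cp.subst y F * (G - cp.subst y G)"
      by (simp add: cp.subst_mult algebra_simps)
    then show ?case using dvd_add[OF dvd_mult2[OF mult(1)] dvd_mult[OF mult(2)]] by (simp only:)
  qed simp
  have ev_y: "ev.subst x (cp.subst y F) = ev.subst (\<lambda>i. x i - e i * (a * x 1 + b * x 2 + c * x 3)) F" for x F
    by (simp add: subst_comp_ev y_def ev.subst_simps)
  have 1: "cp.subst y F = 0" if "\<forall>x. a * x 1 + b * x 2 + c * x 3 = 0 \<longrightarrow> ev.subst x F = 0" for F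
  proof (rule ev_eq_0_imp_eq_0)
    fix x :: "3 \<Rightarrow> complex"
    let ?s = "a * x 1 + b * x 2 + c * x 3"
    have "a * (x 1 - e 1 * ?s) + b * (x 2 - e 2 * ?s) + c * (x 3 - e 3 * ?s) = ?s - ?s * (a * e 1 + b * e 2 + c * e 3)"
      by (simp add: algebra_simps)
    also have "\<dots> = 0" by (simp add: e)
    finally show "ev.subst x (cp.subst y F) = 0" unfolding ev_y using that[rule_format, of "\<lambda>i. x i - e i * ?s"] by blast
  qed
  have 2: "?\<alpha> dvd F" if "cp.subst y F = 0" for F using dvd[of F] that by simp
  have 3: "ev.subst x F = 0" if "?\<alpha> dvd F" "a * x 1 + b * x 2 + c * x 3 = 0" for F x
    using ev.subst_dvd[OF that(1), of x] that(2) by simp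
  show ?thesis
    by (rule that[of y]) (use 1 2 3 in blast)+
qed

lemma lform_dvd_iff:
  assumes "(a, b, c) \<noteq> (0, 0, 0)"
  shows "lform a b c dvd F \<longleftrightarrow> (\<forall>x. a * x 1 + b * x 2 + c * x 3 = 0 \<longrightarrow> ev.subst x F = 0)"
  using lform_projection[OF assms] by metis

text \<open>The multiples of the form are the kernel of a ring homomorphism into an integral
  domain.\<close>

lemma lform_prime:
  assumes "(a, b, c) \<noteq> (0, 0, 0)" "lform a b c dvd F * G"
  shows "lform a b c dvd F \<or> lform a b c dvd G"
  using lform_projection[OF assms(1)] assms(2) by (metis cp.subst_mult mult_eq_0_iff)

lemma lform_nz: "(a, b, c) \<noteq> (0, 0, 0) \<Longrightarrow> lform a b c \<noteq> 0"
proof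
  assume 1: "(a, b, c) \<noteq> (0, 0, 0)" and 2: "lform a b c = 0"
  have "a * x 1 + b * x 2 + c * x 3 = 0" for x :: "3 \<Rightarrow> complex"
    using ev_lform[of x a b c] 2 by simp
  from this[of "\<lambda>i. if i = 1 then 1 else 0"] this[of "\<lambda>i. if i = 2 then 1 else 0"] this[of "\<lambda>i. if i = 3 then 1 else 0"]
  show False using 1 by simp
qed

subsection \<open>Lines of the arrangement\<close>

text \<open>The empty set stands for the line at infinity \<open>z = 0\<close>.\<close>

definition coeffs3 :: "plane set \<Rightarrow> complex \<times> complex \<times> complex" where
  "coeffs3 H = (if H = {} then (0, 0, 1) else SOME (a, b, c). (a, b) \<noteq> (0, 0) \<and> H = line a b c)"

definition ca :: "plane set \<Rightarrow> complex" where "ca H = fst (coeffs3 H)"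
definition cb :: "plane set \<Rightarrow> complex" where "cb H = fst (snd (coeffs3 H))"
definition cc :: "plane set \<Rightarrow> complex" where "cc H = snd (snd (coeffs3 H))"

lemma coeffs_empty [simp]: "ca {} = 0" "cb {} = 0" "cc {} = 1"
  by (simp_all add: ca_def cb_def cc_def coeffs3_def)

lemma line_nonempty:
  assumes "(a, b) \<noteq> (0, 0)"
  shows "line a b c \<noteq> {}"
proof -
  have "vector [- c / a, 0] \<in> line a b c" if "a \<noteq> 0" using that by (simp add: line_def)
  moreover have "vector [0, - c / b] \<in> line a b c" if "b \<noteq> 0" using that by (simp add: line_def)
  ultimately show ?thesis using assms by auto
qed

lemma affine_line_nonempty: "affine_line H \<Longrightarrow> H \<noteq> {}"
  using line_nonempty by (auto simp: affine_line_def)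

lemma affine_line_coeffs:
  assumes "affine_line H"
  shows "(ca H, cb H) \<noteq> (0, 0)" "H = line (ca H) (cb H) (cc H)"
proof -
  have "\<exists>t. case t of (a, b, c) \<Rightarrow> (a, b) \<noteq> (0, 0) \<and> H = line a b c"
    using assms by (auto simp: affine_line_def)
  from someI_ex[OF this] have "case coeffs3 H of (a, b, c) \<Rightarrow> (a, b) \<noteq> (0, 0) \<and> H = line a b c"
    using affine_line_nonempty[OF assms] by (simp add: coeffs3_def)
  then show "(ca H, cb H) \<noteq> (0, 0)" "H = line (ca H) (cb H) (cc H)"
    by (auto simp: ca_def cb_def cc_def split: prod.splits)
qed

lemma mem_affine_line: "affine_line H \<Longrightarrow> p \<in> H \<longleftrightarrow> ca H * p $ 1 + cb H * p $ 2 + cc H = 0"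
  using affine_line_coeffs(2)[of H] unfolding line_def by blast

lemma proportional_pair:
  assumes "(a, b) \<noteq> (0, 0)" "x * b = y * (a :: complex)"
  shows "\<exists>s. x = s * a \<and> y = s * b"
proof (cases "a = 0")
  case True
  then show ?thesis using assms by (intro exI[of _ "y / b"]) simp
next
  case False
  then show ?thesis using assms by (intro exI[of _ "x / a"]) (simp add: field_simps)
qed

lemma affine_line_direction:
  assumes "affine_line H" "p \<in> H"
  shows "q \<in> H \<longleftrightarrow> (\<exists>s. q $ 1 = p $ 1 + s * cb H \<and> q $ 2 = p $ 2 - s * ca H)"
proof
  assume q: "q \<in> H"
  have eq: "ca H * (q $ 1 - p $ 1) = - cb H * (q $ 2 - p $ 2)"
    using q assms unfolding mem_affine_line[OF assms(1)] by (simp add: algebra_simps add_eq_0_iff)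
  have "\<exists>s. q $ 1 - p $ 1 = s * cb H \<and> q $ 2 - p $ 2 = s * (- ca H)"
    using affine_line_coeffs(1)[OF assms(1)] eq by (intro proportional_pair) (auto simp: mult.commute)
  then show "\<exists>s. q $ 1 = p $ 1 + s * cb H \<and> q $ 2 = p $ 2 - s * ca H" by (auto simp: algebra_simps)
next
  assume "\<exists>s. q $ 1 = p $ 1 + s * cb H \<and> q $ 2 = p $ 2 - s * ca H"
  then obtain s where s: "q $ 1 = p $ 1 + s * cb H" "q $ 2 = p $ 2 - s * ca H" by blast
  have "ca H * q $ 1 + cb H * q $ 2 + cc H = ca H * p $ 1 + cb H * p $ 2 + cc H"
    unfolding s by (simp add: algebra_simps)
  then show "q \<in> H" using assms by (simp add: mem_affine_line)
qed

lemma affine_line_eqI: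
  assumes "affine_line H" "affine_line K" "p \<in> H" "p \<in> K" "ca H * cb K = ca K * cb H"
  shows "H = K"
proof -
  have "H \<subseteq> K" if *: "affine_line H" "affine_line K" "p \<in> H" "p \<in> K" "ca H * cb K = ca K * cb H" for H K
  proof
    fix q assume "q \<in> H"
    then obtain s where s: "q $ 1 = p $ 1 + s * cb H" "q $ 2 = p $ 2 - s * ca H"
      using affine_line_direction[OF *(1,3)] by auto
    have "ca K * q $ 1 + cb K * q $ 2 + cc K = (ca K * p $ 1 + cb K * p $ 2 + cc K) + s * (ca K * cb H - ca H * cb K)"
      unfolding s by (simp add: algebra_simps)
    then show "q \<in> K" using * by (simp add: mem_affine_line)
  qed
  from this[of H K] this[of K H] show ?thesis using assms by auto
qed

lemma affine_lines_meet:
  assumes "affine_line H" "affine_line K" "p \<in> H" "q \<in> H" "p \<in> K" "q \<in> K" "p \<noteq> q"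
  shows "H = K"
proof (rule affine_line_eqI[OF assms(1,2,3,5)])
  obtain s where s: "q $ 1 = p $ 1 + s * cb H" "q $ 2 = p $ 2 - s * ca H"
    using affine_line_direction[OF assms(1,3)] assms(4) by auto
  have "s \<noteq> 0" using s assms(7) by (auto simp: vec_eq_iff forall_2)
  have "ca K * q $ 1 + cb K * q $ 2 + cc K = (ca K * p $ 1 + cb K * p $ 2 + cc K) + s * (ca K * cb H - ca H * cb K)"
    unfolding s by (simp add: algebra_simps)
  then have "(ca K * p $ 1 + cb K * p $ 2 + cc K) + s * (ca K * cb H - ca H * cb K) = 0"
    using assms(6) unfolding mem_affine_line[OF assms(2)] by argo
  then show "ca H * cb K = ca K * cb H" using assms(5) \<open>s \<noteq> 0\<close> by (simp add: mem_affine_line[OF assms(2)])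
qed

lemma not_parallel_meet:
  assumes "affine_line H" "affine_line K" "ca H * cb K \<noteq> ca K * cb H"
  shows "H \<inter> K \<noteq> {}"
proof -
  define d where "d = ca H * cb K - ca K * cb H"
  have d: "d \<noteq> 0" using assms by (simp add: d_def)
  let ?x = "cb H * cc K - cb K * cc H" and ?y = "ca K * cc H - ca H * cc K"
  let ?p = "vector [?x / d, ?y / d] :: plane"
  have "ca H * ?x + cb H * ?y + cc H * d = 0" "ca K * ?x + cb K * ?y + cc K * d = 0"
    by (simp_all add: d_def algebra_simps)
  moreover have "a * (?x / d) + b * (?y / d) + c = (a * ?x + b * ?y + c * d) / d" for a b c
    using d by (simp add: add_divide_distrib)
  ultimately have "?p \<in> H" "?p \<in> K"
    unfolding mem_affine_line[OF assms(1)] mem_affine_line[OF assms(2)] by simp_all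
  then show ?thesis by auto
qed

lemma parallel_iff:
  assumes "affine_line H" "affine_line K"
  shows "ca H * cb K = ca K * cb H \<longleftrightarrow> H = K \<or> H \<inter> K = {}"
  using affine_line_eqI[OF assms] not_parallel_meet[OF assms] by (auto simp: mult.commute)

definition al :: "plane set \<Rightarrow> poly3" where
  "al H = lform (ca H) (cb H) (cc H)"

lemma coeffs_nz: "affine_line H \<or> H = {} \<Longrightarrow> (ca H, cb H, cc H) \<noteq> (0, 0, 0)"
  using affine_line_coeffs(1)[of H] by auto

lemma al_nz: "affine_line H \<or> H = {} \<Longrightarrow> al H \<noteq> 0"
  unfolding al_def by (rule lform_nz[OF coeffs_nz])

lemma al_prime: "affine_line H \<or> H = {} \<Longrightarrow> al H dvd F * G \<Longrightarrow> al H dvd F \<or> al H dvd G"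
  unfolding al_def by (rule lform_prime[OF coeffs_nz])

lemma homogeneous_al: "homogeneous 1 (al H)"
  unfolding al_def by (rule homogeneous_lform)

definition pt3 :: "complex \<Rightarrow> complex \<Rightarrow> complex \<Rightarrow> 3 \<Rightarrow> complex" where
  "pt3 a b c i = (if i = 1 then a else if i = 2 then b else c)"

lemma pt3_simps [simp]: "pt3 a b c 1 = a" "pt3 a b c 2 = b" "pt3 a b c 3 = c"
  by (simp_all add: pt3_def)

lemma al_dvd_iff: "affine_line H \<or> H = {} \<Longrightarrow>
    al H dvd F \<longleftrightarrow> (\<forall>x. ca H * x 1 + cb H * x 2 + cc H * x 3 = 0 \<longrightarrow> ev.subst x F = 0)"
  unfolding al_def by (rule lform_dvd_iff[OF coeffs_nz])

lemma ev_al [simp]: "ev.subst x (al H) = ca H * x 1 + cb H * x 2 + cc H * x 3"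
  by (simp add: al_def)

lemma al_dvd_al:
  assumes H: "affine_line H \<or> H = {}" and K: "affine_line K \<or> K = {}" and "al H dvd al K"
  shows "H = K"
proof -
  have *: "ca K * x 1 + cb K * x 2 + cc K * x 3 = 0" if "ca H * x 1 + cb H * x 2 + cc H * x 3 = 0" for x :: "3 \<Rightarrow> complex"
    using assms(3) that unfolding al_dvd_iff[OF H] ev_al by blast
  show ?thesis
  proof (cases "H = {}")
    case True
    then have "ca K = 0" "cb K = 0" using *[of "pt3 1 0 0"] *[of "pt3 0 1 0"] by auto
    then show ?thesis using True K affine_line_coeffs(1)[of K] by auto
  next
    case False
    then have H: "affine_line H" using H by auto
    have sub: "affine_line K \<Longrightarrow> H \<subseteq> K"
      using *[of "pt3 (p $ 1) (p $ 2) 1" for p] by (auto simp: mem_affine_line[OF H] mem_affine_line)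
    obtain p where p: "p \<in> H" using False by auto
    have "affine_line K"
      using K *[of "pt3 (p $ 1) (p $ 2) 1"] p by (auto simp: mem_affine_line[OF H])
    \<comment> \<open>The point at infinity of \<open>H\<close> also lies on the plane of
      \<open>K\<close>, so the directions agree.\<close>
    moreover have "ca H * cb K = ca K * cb H" using *[of "pt3 (cb H) (- ca H) 0"] by (auto simp: algebra_simps)
    ultimately show ?thesis using affine_line_eqI[OF H _ p] sub p by blast
  qed
qed

lemma al_dvd_prod_al:
  assumes "finite S" and H: "affine_line H \<or> H = {}" and "\<And>K. K \<in> S \<Longrightarrow> affine_line K \<or> K = {}"
    and "al H dvd (\<Prod>K\<in>S. al K)"
  shows "H \<in> S"
  using assms(1,3,4)
proof (induction S rule: finite_induct)
  case empty
  then obtain Q where Q: "al H * Q = 1" by (auto simp: dvd_def)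
  \<comment> \<open>A multiple of a form of degree 1 that is homogeneous of degree 0 must vanish, so
    \<open>al H\<close> is not a unit.\<close>
  have "homogeneous 0 (al H * Q)" using Q homogeneous_Const[of 1] by simp
  then show ?case using homogeneous_factor_less[OF homogeneous_al, of 0 H Q] Q by simp
next
  case (insert K S)
  from insert.prems(2) have "al H dvd al K * (\<Prod>L\<in>S. al L)" using insert.hyps by simp
  then consider "al H dvd al K" | "al H dvd (\<Prod>L\<in>S. al L)" using al_prime[OF H] by blast
  then show ?case
  proof cases
    case 1
    then show ?thesis using al_dvd_al[OF H _ 1] insert.prems(1)[of K] by simp
  next
    case 2
    then show ?thesis using insert.IH insert.prems(1) by simp
  qed
qed

lemma prod_al_dvd:
  assumes "finite S" "\<And>H. H \<in> S \<Longrightarrow> affine_line H \<or> H = {}" "\<And>H. H \<in> S \<Longrightarrow> al H dvd F"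
  shows "(\<Prod>H\<in>S. al H) dvd F"
  using assms
proof (induction S rule: finite_induct)
  case (insert H S)
  have "(\<Prod>H\<in>S. al H) dvd F" using insert.IH insert.prems by simp
  then obtain G where G: "F = (\<Prod>H\<in>S. al H) * G" by (rule dvdE)
  have "al H dvd (\<Prod>H\<in>S. al H) \<or> al H dvd G"
    using al_prime[of H "\<Prod>H\<in>S. al H" G] insert.prems(1)[of H] insert.prems(2)[of H] G by simp
  moreover have "\<not> al H dvd (\<Prod>H\<in>S. al H)"
    using al_dvd_prod_al[of S H] insert.hyps insert.prems(1) by blast
  ultimately have "al H dvd G" by simp
  then show ?case using insert.hyps G by (simp add: mult.commute mult_dvd_mono)
qed simp

subsection \<open>Restriction to a plane\<close>

text \<open>Restriction to the plane spanned by \<open>v\<close> and \<open>w\<close>, dehomogenized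
  at \<open>u v + w\<close>. The direction \<open>v\<close> sits at \<open>u = \<infinity>\<close>,
  so degree bounds take the place of homogeneity.\<close>

definition rho :: "(3 \<Rightarrow> complex) \<Rightarrow> (3 \<Rightarrow> complex) \<Rightarrow> poly3 \<Rightarrow> complex poly" where
  "rho v w = rs.subst (\<lambda>i. [:w i, v i:])"

lemma rho_add: "rho v w (F + G) = rho v w F + rho v w G"
  and rho_diff: "rho v w (F - G) = rho v w F - rho v w G"
  and rho_mult: "rho v w (F * G) = rho v w F * rho v w G"
  and rho_Const: "rho v w (Const c) = [:c:]"
  and rho_0 [simp]: "rho v w 0 = 0"
  and rho_dvd: "F dvd G \<Longrightarrow> rho v w F dvd rho v w G"
  and rho_prod: "rho v w (\<Prod>a\<in>S. f a) = (\<Prod>a\<in>S. rho v w (f a))"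
  by (simp_all add: rho_def rs.subst_simps rs.subst_prod rs.subst_dvd)

lemma rho_Const_mult: "rho v w (Const c * F) = smult c (rho v w F)"
  by (simp add: rho_mult rho_Const)

lemma poly_rho: "poly (rho v w F) u = ev.subst (\<lambda>i. u * v i + w i) F"
  by (simp add: rho_def subst_comp_rs add.commute)

lemma rho_lform: "rho v w (lform a b c) = [:a * w 1 + b * w 2 + c * w 3, a * v 1 + b * v 2 + c * v 3:]"
  by (simp add: rho_def lform_def rs.subst_simps)

lemma rho_al: "rho v w (al H) = [:ca H * w 1 + cb H * w 2 + cc H * w 3, ca H * v 1 + cb H * v 2 + cc H * v 3:]"
  by (simp add: al_def rho_lform)

lemma degree_rho:
  assumes "homogeneous k F"
  shows "degree (rho v w F) \<le> k"
  unfolding rho_def rs.subst_def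
proof (rule degree_sum_le)
  fix m assume "m \<in> keys F"
  then have m: "(\<Sum>i\<in>UNIV. lookup m i) = k" using assms by (simp add: homogeneous_def)
  have "degree ([:w i, v i:] ^ n) \<le> n" for i n
    using degree_power_le[of "[:w i, v i:]" n] by (auto intro: order.trans)
  then have "degree (\<Prod>i\<in>UNIV. [:w i, v i:] ^ lookup m i) \<le> k"
    unfolding m[symmetric] by (intro order.trans[OF degree_prod_sum_le] sum_mono) auto
  then show "degree ([:lookup F m:] * (\<Prod>i\<in>UNIV. [:w i, v i:] ^ lookup m i)) \<le> k"
    by (simp add: order.trans[OF degree_smult_le])
qed simp

text \<open>By homogeneity the values \<open>u v + w\<close> determine those at
  \<open>s v + t w\<close> with \<open>t \<noteq> 0\<close>; the direction lost by dehomogenizing is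
  recovered because a polynomial in \<open>t\<close> that vanishes off 0 is zero.\<close>

lemma rho_eq_0_imp_ev:
  assumes "homogeneous k F" "rho v w F = 0"
  shows "ev.subst (\<lambda>i. s * v i + t * w i) F = 0"
proof -
  have 1: "ev.subst (\<lambda>i. s * v i + t * w i) F = 0" if "t \<noteq> 0" for t
  proof -
    have "ev.subst (\<lambda>i. t * ((s / t) * v i + w i)) F = t ^ k * poly (rho v w F) (s / t)"
      by (simp only: ev_homogeneous[OF assms(1)] poly_rho)
    moreover have "(\<lambda>i. t * ((s / t) * v i + w i)) = (\<lambda>i. s * v i + t * w i)"
      using that by (auto simp: field_simps)
    ultimately show ?thesis by (simp add: assms(2))
  qed
  define p where "p = rho w (\<lambda>i. s * v i) F"
  have p: "poly p t = ev.subst (\<lambda>i. s * v i + t * w i) F" for t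
    by (simp add: p_def poly_rho add.commute)
  have "{t. poly p t = 0} \<supseteq> UNIV - {0}" using 1 p by auto
  moreover have "infinite (UNIV - {0 :: complex})" using infinite_UNIV_char_0 by simp
  ultimately have "p = 0" using poly_roots_finite finite_subset by metis
  then show ?thesis using p[of t] by simp
qed

section \<open>Graded pieces of the module of logarithmic derivations\<close>

definition sc :: "complex \<Rightarrow> poly3 \<times> poly3 \<Rightarrow> poly3 \<times> poly3" where
  "sc c \<theta> = (Const c * fst \<theta>, Const c * snd \<theta>)"

lemma fst_sc [simp]: "fst (sc c \<theta>) = Const c * fst \<theta>" and snd_sc [simp]: "snd (sc c \<theta>) = Const c * snd \<theta>"
  by (simp_all add: sc_def)

interpretation vs: vector_space sc
  by unfold_locales (auto simp: sc_def Const_add Const_mult distrib_left distrib_right mult.assoc)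

subsection \<open>Pairs of homogeneous polynomials\<close>

definition mons :: "nat \<Rightarrow> (3 \<Rightarrow>\<^sub>0 nat) set" where
  "mons k = {m. total_deg m = k}"

lemma mons_bij: "bij_betw (\<lambda>(i, j). single 1 i + single 2 j + single 3 (k - i - j))
   (SIGMA i:{..k}. {..k - i}) (mons k)"
proof (rule bij_betwI[where g = "\<lambda>m. (lookup m 1, lookup m 2)"])
  fix m assume "m \<in> mons k"
  then have sum: "lookup m 1 + lookup m 2 + lookup m 3 = k"
    by (simp add: mons_def total_deg_def sum_3)
  show "(case (lookup m 1, lookup m 2) of (i, j) \<Rightarrow>
      single 1 i + single 2 j + single 3 (k - i - j)) = m"
  proof (intro poly_mapping_eqI)
    fix i :: 3
    have "i = 1 \<or> i = 2 \<or> i = 3" by (rule exhaust_3)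
    then show "lookup (case (lookup m 1, lookup m 2) of (i, j) \<Rightarrow>
      single 1 i + single 2 j + single 3 (k - i - j)) i = lookup m i"
      using sum by (elim disjE) (simp_all add: lookup_add lookup_single "when_def")
  qed
next
  show "(\<lambda>(i, j). single 1 i + single 2 j + single 3 (k - i - j))
     \<in> (SIGMA i:{..k}. {..k - i}) \<rightarrow> mons k"
    by (auto simp: mons_def total_deg_def sum_3 lookup_add lookup_single "when_def")
next
  show "(\<lambda>m. (lookup m 1, lookup m 2)) \<in> mons k \<rightarrow> (SIGMA i:{..k}. {..k - i})"
    by (auto simp: mons_def total_deg_def sum_3)
qed (auto simp: lookup_add lookup_single "when_def")

lemma finite_mons: "finite (mons k)"
  using bij_betw_finite[OF mons_bij[of k]] by simp

lemma card_mons: "2 * card (mons k) = (k + 1) * (k + 2)"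
proof -
  have "card (mons k) = card (SIGMA i:{..k}. {..k - i})" using bij_betw_same_card[OF mons_bij[of k]] by simp
  also have "\<dots> = (\<Sum>i\<le>k. k - i + 1)" by simp
  also have "\<dots> = (\<Sum>i\<le>k. i + 1)" using sum.nat_diff_reindex[of "\<lambda>i. i + 1" "Suc k"] by (simp add: lessThan_Suc_atMost)
  finally have "card (mons k) = (\<Sum>i\<le>k. i + 1)" .
  moreover have "2 * (\<Sum>i\<le>k. i + 1) = (k + 1) * (k + 2)" by (induction k) auto
  ultimately show ?thesis by simp
qed

definition hpairs :: "nat \<Rightarrow> nat \<Rightarrow> (poly3 \<times> poly3) set" where
  "hpairs i j = {(F, G). homogeneous i F \<and> homogeneous j G}"

lemma subspace_hpairs: "vs.subspace (hpairs i j)"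
  by (auto simp: vs.subspace_def hpairs_def sc_def zero_prod_def
      intro: homogeneous_add homogeneous_Const_mult)

definition unit_pair :: "(3 \<Rightarrow>\<^sub>0 nat) + (3 \<Rightarrow>\<^sub>0 nat) \<Rightarrow> poly3 \<times> poly3" where
  "unit_pair s = (case s of Inl m \<Rightarrow> (single m 1, 0) | Inr m \<Rightarrow> (0, single m 1))"

definition pair_coeff :: "(3 \<Rightarrow>\<^sub>0 nat) + (3 \<Rightarrow>\<^sub>0 nat) \<Rightarrow> poly3 \<times> poly3 \<Rightarrow> complex" where
  "pair_coeff s \<theta> = (case s of Inl m \<Rightarrow> lookup (fst \<theta>) m | Inr m \<Rightarrow> lookup (snd \<theta>) m)"

lemma pair_coeff_unit: "pair_coeff s (unit_pair t) = (if s = t then 1 else 0)"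
  by (auto simp: pair_coeff_def unit_pair_def lookup_single "when_def" split: sum.splits)

lemma independent_unit_pairs:
  assumes "finite M"
  shows "vs.independent (unit_pair ` M)"
  using assms
proof (induction M rule: finite_induct)
  case (insert s M)
  have "vs.subspace {\<theta>. pair_coeff s \<theta> = 0}"
    by (auto simp: vs.subspace_def pair_coeff_def lookup_add lookup_Const_mult split: sum.splits)
  then have "vs.span (unit_pair ` M) \<subseteq> {\<theta>. pair_coeff s \<theta> = 0}"
    using insert.hyps by (intro vs.span_minimal) (auto simp: pair_coeff_unit)
  then have "unit_pair s \<notin> vs.span (unit_pair ` M)" by (auto simp: pair_coeff_unit)
  then show ?case using insert.IH by (simp add: vs.independent_insertI)
qed (simp add: vs.independent_empty)

lemma inj_unit_pair: "inj unit_pair"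
proof (rule injI)
  fix s t assume "unit_pair s = unit_pair t"
  then show "s = t" using pair_coeff_unit[of s s] pair_coeff_unit[of s t] by (auto split: if_splits)
qed

definition hbasis :: "nat \<Rightarrow> nat \<Rightarrow> (poly3 \<times> poly3) set" where
  "hbasis i j = unit_pair ` (mons i <+> mons j)"

lemma finite_hbasis: "finite (hbasis i j)"
  by (simp add: hbasis_def finite_mons)

lemma hpairs_subset_span: "hpairs i j \<subseteq> vs.span (hbasis i j)"
proof
  fix \<theta> assume "\<theta> \<in> hpairs i j"
  then obtain F G where \<theta>: "\<theta> = (F, G)" "homogeneous i F" "homogeneous j G" by (auto simp: hpairs_def)
  have 1: "(F, G) = (\<Sum>m\<in>keys F. sc (lookup F m) (unit_pair (Inl m)))
     + (\<Sum>m\<in>keys G. sc (lookup G m) (unit_pair (Inr m)))"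
    using poly3_sum_single[of F] poly3_sum_single[of G]
    by (auto simp: prod_eq_iff fst_sum snd_sum unit_pair_def Const_mult_single)
  show "\<theta> \<in> vs.span (hbasis i j)"
    unfolding \<theta>(1) 1 using \<theta>(2,3)
    by (intro vs.span_add vs.span_sum vs.span_scale vs.span_base)
       (auto simp: hbasis_def homogeneous_def mons_def total_deg_def)
qed

lemma dim_hpairs: "vs.dim (hpairs i j) = card (mons i) + card (mons j)"
proof (rule vs.dim_unique)
  show "hbasis i j \<subseteq> hpairs i j"
    by (auto simp: hbasis_def hpairs_def unit_pair_def homogeneous_def mons_def total_deg_def)
  show "hpairs i j \<subseteq> vs.span (hbasis i j)" by (rule hpairs_subset_span)
  show "vs.independent (hbasis i j)" unfolding hbasis_def by (rule independent_unit_pairs) (simp add: finite_mons)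
  show "card (hbasis i j) = card (mons i) + card (mons j)"
    unfolding hbasis_def using inj_unit_pair
    by (subst card_image) (auto simp: inj_on_def card_Plus finite_mons)
qed

subsection \<open>Logarithmic derivations killing \<open>z\<close>\<close>

text \<open>The pair \<open>(F, G)\<close> stands for the derivation \<open>F \<partial>/\<partial>x + G \<partial>/\<partial>y\<close>, which kills \<open>z\<close>.\<close>

definition dval :: "plane set \<Rightarrow> poly3 \<times> poly3 \<Rightarrow> poly3" where
  "dval H \<theta> = Const (ca H) * fst \<theta> + Const (cb H) * snd \<theta>"

lemma dval_add: "dval H (\<theta> + \<eta>) = dval H \<theta> + dval H \<eta>"
  and dval_sc: "dval H (sc c \<theta>) = Const c * dval H \<theta>"
  and dval_0 [simp]: "dval H 0 = 0"
  and dval_empty [simp]: "dval {} \<theta> = 0"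
  by (simp_all add: dval_def algebra_simps)

definition mulp :: "poly3 \<Rightarrow> poly3 \<times> poly3 \<Rightarrow> poly3 \<times> poly3" where
  "mulp p \<theta> = (p * fst \<theta>, p * snd \<theta>)"

lemma dval_mulp: "dval H (mulp p \<theta>) = p * dval H \<theta>"
  by (simp add: dval_def mulp_def algebra_simps)

text \<open>The homogeneous part of degree \<open>k\<close> of the module \<open>D\<^sub>0\<close>
  of the overview.\<close>

definition ldp :: "nat \<Rightarrow> plane set set \<Rightarrow> (poly3 \<times> poly3) set" where
  "ldp k A = {\<theta> \<in> hpairs k k. \<forall>H\<in>A. al H dvd dval H \<theta>}"

lemma subspace_ldp: "vs.subspace (ldp k A)"
  using subspace_hpairs[of k k]
  by (auto simp: vs.subspace_def ldp_def dval_add dval_sc)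

lemma ldp_subset_span: "ldp k A \<subseteq> vs.span (hbasis k k)"
  using hpairs_subset_span by (auto simp: ldp_def)

lemma homogeneous_dval: "\<theta> \<in> hpairs k k \<Longrightarrow> homogeneous k (dval H \<theta>)"
  by (auto simp: dval_def hpairs_def intro!: homogeneous_add homogeneous_Const_mult)

lemma infinite_affine_line:
  assumes "affine_line L"
  shows "infinite L"
proof -
  obtain p where p: "p \<in> L" using affine_line_nonempty[OF assms] by auto
  define f where "f s = (vector [p $ 1 + s * cb L, p $ 2 - s * ca L] :: plane)" for s
  have "inj f" using affine_line_coeffs(1)[OF assms] by (auto simp: inj_def f_def vec_eq_iff forall_2)
  moreover have "range f \<subseteq> L" unfolding f_def using affine_line_direction[OF assms p] by auto
  ultimately show ?thesis using infinite_UNIV_char_0 finite_subset finite_imageD by (metis (no_types))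
qed

lemma affine_lines_finite_meet:
  assumes "affine_line L" "affine_line K" "L \<noteq> K"
  shows "finite (L \<inter> K)"
proof (cases "L \<inter> K = {}")
  case False
  then obtain p where "p \<in> L \<inter> K" by auto
  then have "L \<inter> K \<subseteq> {p}" using affine_lines_meet[OF assms(1,2), of p] assms(3) by auto
  then show ?thesis by (rule finite_subset) simp
qed (simp only: finite.emptyI)

text \<open>The line \<open>L\<close> is parametrized by \<open>u v + w\<close> with \<open>u = 0\<close> at infinity and \<open>u = \<infinity>\<close> at a point on no
  other line.\<close>

definition line_param :: "plane set set \<Rightarrow> plane set \<Rightarrow> (3 \<Rightarrow> complex) \<Rightarrow> (3 \<Rightarrow> complex) \<Rightarrow>
    (plane set \<Rightarrow> complex) \<Rightarrow> (plane set \<Rightarrow> complex) \<Rightarrow> bool" where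
  "line_param A L v w \<alpha> u \<longleftrightarrow>
    (\<forall>K. rho v w (al K) = [:ca K * cb L - cb K * ca L, \<alpha> K:]) \<and>
    (\<forall>K\<in>insert {} A. \<alpha> K \<noteq> 0 \<and> rho v w (al K) = smult (\<alpha> K) [:- u K, 1:]) \<and>
    \<alpha> L = 0 \<and> u {} = 0 \<and> card (u ` insert {} A) = card (L \<inter> \<Union>A) + 1 \<and>
    (\<forall>k F. homogeneous k F \<longrightarrow> rho v w F = 0 \<longrightarrow> al L dvd F) \<and>
    (\<forall>K\<in>insert {} A. \<forall>K'\<in>insert {} A. u K = u K' \<longrightarrow> (\<exists>s t. s \<noteq> 0 \<and>
       ca K = s * ca K' + t * ca L \<and> cb K = s * cb K' + t * cb L \<and> cc K = s * cc K' + t * cc L))"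

text \<open>Take \<open>v\<close> to be a point \<open>p\<close> of \<open>L\<close> on no other
  line and \<open>w\<close> the direction of \<open>L\<close>. Then every other plane of the cone
  has a finite parameter \<open>u K\<close>, lines parallel to \<open>L\<close> share the parameter
  0 with the plane at infinity, and the nonzero parameters correspond to the affine intersection
  points.\<close>

lemma line_param_exists:
  assumes A: "finite A" "\<And>H. H \<in> A \<Longrightarrow> affine_line H" and L: "affine_line L" "L \<notin> A"
  shows "\<exists>v w \<alpha> u. line_param A L v w \<alpha> u"
proof -
  have "finite (\<Union>K\<in>A. L \<inter> K)" using A L by (intro finite_UN_I affine_lines_finite_meet) auto
  then obtain p where p: "p \<in> L" "\<And>K. K \<in> A \<Longrightarrow> p \<notin> K"
    using infinite_affine_line[OF L(1)] finite_subset[of L "\<Union>K\<in>A. L \<inter> K"] by blast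
  define v where "v = pt3 (p $ 1) (p $ 2) 1"
  define w where "w = pt3 (cb L) (- ca L) 0"
  define \<alpha> where "\<alpha> K = ca K * p $ 1 + cb K * p $ 2 + cc K" for K
  define \<beta> where "\<beta> K = ca K * cb L - cb K * ca L" for K
  define u where "u K = - \<beta> K / \<alpha> K" for K
  have 1: "rho v w (al K) = [:\<beta> K, \<alpha> K:]" for K
    by (simp add: rho_al v_def w_def \<alpha>_def \<beta>_def)
  have 2: "\<alpha> K \<noteq> 0" if "K \<in> insert {} A" for K
    using that p(2)[of K] A(2)[of K] mem_affine_line[of K p] by (auto simp: \<alpha>_def)
  have 3: "rho v w (al K) = smult (\<alpha> K) [:- u K, 1:]" if "K \<in> insert {} A" for K
    using 2[OF that] by (simp add: 1 u_def)
  have 4: "\<alpha> L = 0" using p(1) mem_affine_line[OF L(1)] by (simp add: \<alpha>_def)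
  have 5: "u {} = 0" by (simp add: u_def \<beta>_def)
  \<comment> \<open>The affine point with parameter \<open>q \<noteq> 0\<close>:
    \<open>q v + w\<close> divided by its last coordinate \<open>q\<close>.\<close>
  define f where "f q = (vector [p $ 1 + (1 / q) * cb L, p $ 2 - (1 / q) * ca L] :: plane)" for q
  have f: "f (u K) \<in> L \<inter> K" if "K \<in> A" "u K \<noteq> 0" for K
  proof
    show "f (u K) \<in> L" unfolding affine_line_direction[OF L(1) p(1)] f_def by (intro exI[of _ "1 / u K"]) simp
    have "ca K * f (u K) $ 1 + cb K * f (u K) $ 2 + cc K = \<alpha> K + (1 / u K) * \<beta> K"
      by (simp add: f_def \<alpha>_def \<beta>_def algebra_simps)
    also have "\<dots> = 0" using that by (simp add: u_def)
    finally show "f (u K) \<in> K" using mem_affine_line[OF A(2)[OF that(1)]] by simp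
  qed
  have "L \<inter> \<Union>A \<subseteq> f ` (u ` A - {0})"
  proof
    fix q assume "q \<in> L \<inter> \<Union>A"
    then obtain K where K: "K \<in> A" "q \<in> K" "q \<in> L" by auto
    obtain s where s: "q $ 1 = p $ 1 + s * cb L" "q $ 2 = p $ 2 - s * ca L"
      using affine_line_direction[OF L(1) p(1)] K(3) by auto
    have "s \<noteq> 0"
    proof
      assume "s = 0"
      then have "q = p" using s by (simp add: vec_eq_iff forall_2)
      then show False using p K by auto
    qed
    have "ca K * q $ 1 + cb K * q $ 2 + cc K = \<alpha> K + s * \<beta> K"
      unfolding s by (simp add: \<alpha>_def \<beta>_def algebra_simps)
    then have "\<alpha> K = - s * \<beta> K"
      using mem_affine_line[OF A(2)[OF K(1)], of q] K by (simp add: add_eq_0_iff2)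
    then have "u K = 1 / s" using 2[of K] K \<open>s \<noteq> 0\<close> by (simp add: u_def)
    then have "u K \<noteq> 0" "f (u K) = q" using \<open>s \<noteq> 0\<close> s by (auto simp: f_def vec_eq_iff forall_2)
    then show "q \<in> f ` (u ` A - {0})" using K by force
  qed
  moreover have "f ` (u ` A - {0}) \<subseteq> L \<inter> \<Union>A" using f by blast
  moreover have "inj_on f (u ` A - {0})"
    using affine_line_coeffs(1)[OF L(1)] by (auto simp: inj_on_def f_def vec_eq_iff forall_2)
  ultimately have "card (u ` A - {0}) = card (L \<inter> \<Union>A)" by (metis card_image subset_antisym)
  moreover have "u ` insert {} A = insert 0 (u ` A - {0})" by (auto simp: 5)
  moreover have "finite (u ` A - {0})" using A(1) by simp
  ultimately have 6: "card (u ` insert {} A) = card (L \<inter> \<Union>A) + 1" by (metis Diff_iff Suc_eq_plus1 card_insert_disjoint singletonI)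
  have 7: "al L dvd F" if "homogeneous k F" "rho v w F = 0" for k F
    unfolding al_dvd_iff[OF disjI1[OF L(1)]]
  proof (intro allI impI)
    fix x :: "3 \<Rightarrow> complex" assume x: "ca L * x 1 + cb L * x 2 + cc L * x 3 = 0"
    define y where "y i = x i - x 3 * v i" for i
    have "y 3 = 0" by (simp add: y_def v_def)
    have "ca L * y 1 + cb L * y 2 = (ca L * x 1 + cb L * x 2 + cc L * x 3) - x 3 * \<alpha> L"
      by (simp add: y_def v_def \<alpha>_def algebra_simps)
    then have "y 1 * (- ca L) = y 2 * cb L" using x 4 by (simp add: algebra_simps add_eq_0_iff)
    then have "\<exists>t. y 1 = t * cb L \<and> y 2 = t * (- ca L)"
      using affine_line_coeffs(1)[OF L(1)] by (intro proportional_pair) auto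
    then obtain t where t: "y 1 = t * cb L" "y 2 = t * (- ca L)" by blast
    have "x i = x 3 * v i + t * w i" for i
    proof -
      have "y i = t * w i" using exhaust_3[of i] t \<open>y 3 = 0\<close> by (auto simp: w_def)
      then show ?thesis by (simp add: y_def algebra_simps)
    qed
    then have "x = (\<lambda>i. x 3 * v i + t * w i)" by blast
    then show "ev.subst x F = 0" using rho_eq_0_imp_ev[OF that, of "x 3" t] by simp
  qed
  \<comment> \<open>After scaling to equal values at \<open>p\<close>, the difference of the two
    forms vanishes at \<open>p\<close> and at the point at infinity of \<open>L\<close>, hence is a
    multiple of the form of \<open>L\<close>.\<close>
  have 8: "\<exists>s t. s \<noteq> 0 \<and> ca K = s * ca K' + t * ca L \<and> cb K = s * cb K' + t * cb L \<and> cc K = s * cc K' + t * cc L"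
    if K: "K \<in> insert {} A" "K' \<in> insert {} A" "u K = u K'" for K K'
  proof -
    define s where "s = \<alpha> K / \<alpha> K'"
    have s: "s \<noteq> 0" "\<alpha> K = s * \<alpha> K'" using 2[OF K(1)] 2[OF K(2)] by (auto simp: s_def)
    have "\<beta> K = s * \<beta> K'" using K(3) 2[OF K(1)] 2[OF K(2)] by (simp add: u_def s_def field_simps)
    then have d: "(ca K - s * ca K') * cb L = (cb K - s * cb K') * ca L" by (simp add: \<beta>_def algebra_simps)
    have "\<exists>t. ca K - s * ca K' = t * ca L \<and> cb K - s * cb K' = t * cb L"
      by (rule proportional_pair[OF affine_line_coeffs(1)[OF L(1)] d])
    then obtain t where t: "ca K = s * ca K' + t * ca L" "cb K = s * cb K' + t * cb L"
      by (auto simp: algebra_simps)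
    have "cc K - s * cc K' - t * cc L = (\<alpha> K - s * \<alpha> K' - t * \<alpha> L)
        - (ca K - s * ca K' - t * ca L) * p $ 1 - (cb K - s * cb K' - t * cb L) * p $ 2"
      by (simp add: \<alpha>_def algebra_simps)
    also have "\<dots> = 0" using s(2) 4 t by simp
    finally have "cc K = s * cc K' + t * cc L" by (simp add: algebra_simps)
    then show ?thesis using s t by blast
  qed
  have "line_param A L v w \<alpha> u"
    unfolding line_param_def
  proof (intro conjI ballI allI impI)
    show "\<alpha> K \<noteq> 0" "rho v w (al K) = smult (\<alpha> K) [:- u K, 1:]" if "K \<in> insert {} A" for K
      using 2 3 that by blast+
  qed (use 1 4 5 6 7 8 in \<open>auto simp: \<beta>_def\<close>)
  then show ?thesis by blast
qed


lemma line_paramD: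
  assumes "line_param A L v w \<alpha> u"
  shows "rho v w (al K) = [:ca K * cb L - cb K * ca L, \<alpha> K:]"
    "K \<in> insert {} A \<Longrightarrow> \<alpha> K \<noteq> 0 \<and> rho v w (al K) = smult (\<alpha> K) [:- u K, 1:]"
    "\<alpha> L = 0" "u {} = 0" "card (u ` insert {} A) = card (L \<inter> \<Union>A) + 1"
    "homogeneous k F \<Longrightarrow> rho v w F = 0 \<Longrightarrow> al L dvd F"
    "K \<in> insert {} A \<Longrightarrow> K' \<in> insert {} A \<Longrightarrow> u K = u K' \<Longrightarrow> \<exists>s t. s \<noteq> 0 \<and>
       ca K = s * ca K' + t * ca L \<and> cb K = s * cb K' + t * cb L \<and> cc K = s * cc K' + t * cc L"
  using assms unfolding line_param_def by blast+

section \<open>Adding one line: two exact sequences\<close>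

lemma al_diff_decomposition:
  assumes "ca K = s * ca K' + t * ca L" "cb K = s * cb K' + t * cb L" "cc K = s * cc K' + t * cc L"
  shows "al K = Const s * al K' + Const t * al L" "dval K \<theta> = Const s * dval K' \<theta> + Const t * dval L \<theta>"
  by (simp_all add: al_def lform_def dval_def assms Const_add Const_mult algebra_simps)

lemma coeff_div_linear:
  fixes B :: "complex poly"
  shows "coeff ((p + q) div B) j = coeff (p div B) j + coeff (q div B) j"
    "coeff (smult c p div B) j = c * coeff (p div B) j"
  by (simp_all add: poly_div_add_left div_smult_left)

text \<open>The coefficients of the quotient by \<open>B\<close> serve as
  \<open>k + 1 - degree B\<close> functionals that separate the multiples of \<open>B\<close> of
  degree at most \<open>k\<close>.\<close>

lemma eq_0_if_coeff_div_0:
  fixes B p :: "complex poly"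
  assumes "B dvd p" "B \<noteq> 0" "degree p \<le> k" "\<And>j. j < k + 1 - degree B \<Longrightarrow> coeff (p div B) j = 0"
  shows "p = 0"
proof (rule ccontr)
  assume "p \<noteq> 0"
  obtain Y where Y: "p = B * Y" using assms(1) by (auto simp: dvd_def)
  then have "Y \<noteq> 0" using \<open>p \<noteq> 0\<close> by auto
  then have "degree B + degree Y \<le> k" using assms(2,3) by (simp add: Y degree_mult_eq)
  then have "coeff Y (degree Y) = 0" using assms(4)[of "degree Y"] assms(2) by (simp add: Y)
  then show False using \<open>Y \<noteq> 0\<close> by simp
qed

text \<open>The smaller module is the kernel of the map that sends a derivation to its value on the
  form of \<open>L\<close>, restricted to the plane of \<open>L\<close>. All such values are
  divisible by one polynomial \<open>B\<close> of degree
  \<open>card A - card (L \<inter> \<Union>A)\<close>, which bounds the dimension of the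
  image.\<close>

lemma dim_ldp_insert_ge:
  assumes A: "finite A" "\<And>H. H \<in> A \<Longrightarrow> affine_line H" and L: "affine_line L" "L \<notin> A"
  shows "vs.dim (ldp k A) \<le> vs.dim (ldp k (insert L A)) + (k + 1 - (card A - card (L \<inter> \<Union>A)))"
proof -
  obtain v w \<alpha> u where "line_param A L v w \<alpha> u"
    using line_param_exists[OF A L] by blast
  note par = line_paramD[OF this]
  define A0 where "A0 = insert {} A"
  have fin0: "finite A0" using A by (simp add: A0_def)
  have lin0: "affine_line K \<or> K = {}" if "K \<in> A0" for K using that A by (auto simp: A0_def)
  define C where "C q = {K \<in> A0. u K = q}" for q
  have finC: "finite (C q)" for q using fin0 by (simp add: C_def)
  have rhoL: "rho v w (al L) = 0" by (simp add: par(1,3))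
  have local: "[:- q, 1:] ^ (card (C q) - 1) dvd rho v w (dval L \<theta>)" if \<theta>: "\<theta> \<in> ldp k A" and q: "q \<in> u ` A0" for \<theta> q
  proof -
    obtain K' where K': "K' \<in> C q" using q by (auto simp: C_def)
    \<comment> \<open>The alternating expression for \<open>K\<close> and \<open>L\<close> changes
      only by the factor \<open>s\<close> when \<open>K\<close> runs through a pencil
      \<open>C q\<close>, so \<open>T\<close> is divisible by every form of the pencil. On the plane
      of \<open>L\<close> its second term disappears, and cancelling \<open>K'\<close> costs one
      factor.\<close>
    define T where "T = al K' * dval L \<theta> - al L * dval K' \<theta>"
    have "al K dvd T" if K: "K \<in> C q" for K
    proof -
      have "K \<in> insert {} A" "K' \<in> insert {} A" "u K = u K'" using K K' by (auto simp: C_def A0_def)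
      from par(7)[OF this] obtain s t where s: "s \<noteq> 0"
        and c: "ca K = s * ca K' + t * ca L" "cb K = s * cb K' + t * cb L" "cc K = s * cc K' + t * cc L"
        by blast
      have "al K dvd dval K \<theta>" using \<theta> K by (auto simp: ldp_def C_def A0_def)
      then have "al K dvd al K * dval L \<theta> - al L * dval K \<theta>" by simp
      also have "al K * dval L \<theta> - al L * dval K \<theta> = Const s * T"
        by (simp add: al_diff_decomposition[OF c] T_def algebra_simps)
      finally show ?thesis using dvd_Const_cancel[OF s] by blast
    qed
    then have "(\<Prod>K\<in>C q. al K) dvd T"
      using finC lin0 by (intro prod_al_dvd) (auto simp: C_def)
    then have "(\<Prod>K\<in>C q. rho v w (al K)) dvd rho v w T" unfolding rho_prod[symmetric] by (rule rho_dvd)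
    also have "rho v w T = rho v w (al K') * rho v w (dval L \<theta>)"
      by (simp add: T_def rho_diff rho_mult rhoL)
    also have "(\<Prod>K\<in>C q. rho v w (al K)) = rho v w (al K') * (\<Prod>K\<in>C q - {K'}. rho v w (al K))"
      using finC K' by (simp add: prod.remove)
    finally have d1: "(\<Prod>K\<in>C q - {K'}. rho v w (al K)) dvd rho v w (dval L \<theta>)"
      using par(2)[of K'] K' by (subst (asm) dvd_mult_cancel_left) (auto simp: C_def A0_def)
    have d2: "(\<Prod>K\<in>C q - {K'}. [:- q, 1:]) dvd (\<Prod>K\<in>C q - {K'}. rho v w (al K))"
    proof (rule prod_dvd_prod)
      fix K assume "K \<in> C q - {K'}"
      then have "K \<in> insert {} A" "u K = q" by (auto simp: C_def A0_def)
      then have "rho v w (al K) = smult (\<alpha> K) [:- q, 1:]" using par(2)[of K] by simp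
      then show "[:- q, 1:] dvd rho v w (al K)" by (metis dvd_refl dvd_smult)
    qed
    have e: "(\<Prod>K\<in>C q - {K'}. [:- q, 1:]) = [:- q, 1:] ^ (card (C q) - 1)"
      using K' finC by simp
    show ?thesis using dvd_trans[OF d2 d1] unfolding e .
  qed
  define B where "B = (\<Prod>q\<in>u ` A0. [:- q, 1:] ^ (card (C q) - 1))"
  have B_dvd: "B dvd rho v w (dval L \<theta>)" if "\<theta> \<in> ldp k A" for \<theta>
    unfolding B_def using fin0 local[OF that] by (intro prod_linear_powers_dvd[of "u ` A0" "\<lambda>q. q"]) auto
  \<comment> \<open>The plane at infinity adds one both to the number of planes and to the number of
    points on \<open>L\<close>, so it cancels in the degree of \<open>B\<close>.\<close>
  have "card A0 = card A + 1"
    using A affine_line_nonempty by (auto simp: A0_def card_insert_if)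
  moreover have "card A0 = (\<Sum>q\<in>u ` A0. card (C q))"
    using fin0 unfolding C_def by (subst card_eq_sum, subst sum.image_gen[of _ _ u]) auto
  moreover have "(\<Sum>q\<in>u ` A0. card (C q)) = (\<Sum>q\<in>u ` A0. card (C q) - 1) + card (u ` A0)"
  proof (rule sum_minus_1)
    fix q assume "q \<in> u ` A0"
    then have "C q \<noteq> {}" by (auto simp: C_def)
    then show "1 \<le> card (C q)" using finC[of q] by (simp add: Suc_le_eq card_gt_0_iff)
  qed
  ultimately have degB: "degree B = card A - card (L \<inter> \<Union>A)"
    using degree_prod_linear_powers[of "\<lambda>q. q" "\<lambda>q. card (C q) - 1" "u ` A0"] par(5) by (simp add: B_def A0_def)
  have B_nz: "B \<noteq> 0" using fin0 by (auto simp: B_def)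
  have lin: "rho v w (dval L (\<theta> + \<eta>)) = rho v w (dval L \<theta>) + rho v w (dval L \<eta>)"
    "rho v w (dval L (sc c \<theta>)) = smult c (rho v w (dval L \<theta>))" for \<theta> \<eta> c
    by (simp_all add: dval_add rho_add dval_sc rho_Const_mult)
  let ?m = "k + 1 - (card A - card (L \<inter> \<Union>A))"
  have "vs.dim (ldp k A) \<le> vs.dim {\<theta> \<in> ldp k A. \<forall>j<?m. coeff (rho v w (dval L \<theta>) div B) j = 0} + ?m"
    by (rule vs.dim_le_kernel_functionals[OF finite_hbasis ldp_subset_span subspace_ldp])
       (simp_all add: lin coeff_div_linear)
  also have "vs.dim {\<theta> \<in> ldp k A. \<forall>j<?m. coeff (rho v w (dval L \<theta>) div B) j = 0} \<le> vs.dim (ldp k (insert L A))"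
  proof (rule vs.dim_mono_finite[OF finite_hbasis ldp_subset_span], safe)
    fix \<theta> assume \<theta>: "\<theta> \<in> ldp k A" and 0: "\<forall>j<?m. coeff (rho v w (dval L \<theta>) div B) j = 0"
    have hom: "homogeneous k (dval L \<theta>)" using \<theta> homogeneous_dval by (auto simp: ldp_def)
    then have "rho v w (dval L \<theta>) = 0"
      using eq_0_if_coeff_div_0[OF B_dvd[OF \<theta>] B_nz degree_rho[OF hom]] 0 degB by simp
    then have "al L dvd dval L \<theta>" using par(6) hom by blast
    then show "\<theta> \<in> ldp k (insert L A)" using \<theta> by (simp add: ldp_def)
  qed
  finally show ?thesis by simp
qed

lemma homogeneous_al_factor:
  assumes "affine_line L \<or> L = {}" "homogeneous k (al L * F)" "k \<noteq> 0"
  shows "homogeneous (k - 1) F"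
  using homogeneous_factor[OF homogeneous_al al_nz[OF assms(1)] assms(2)] assms(3) by simp

lemma dim_mulp_image_le: "vs.dim (mulp p ` ldp k A) \<le> vs.dim (ldp k A)"
  by (rule vs.dim_image_le_on[OF finite_hbasis ldp_subset_span subspace_ldp])
     (simp_all add: mulp_def prod_eq_iff algebra_simps)

lemma mulp_al_in_ldp:
  assumes "affine_line L \<or> L = {}" "\<theta> \<in> ldp k A"
  shows "mulp (al L) \<theta> \<in> ldp (Suc k) (insert L A)"
proof -
  have "homogeneous k (fst \<theta>)" "homogeneous k (snd \<theta>)" using assms(2) by (auto simp: ldp_def hpairs_def)
  then have "homogeneous (1 + k) (al L * fst \<theta>)" "homogeneous (1 + k) (al L * snd \<theta>)"
    using homogeneous_mult[OF homogeneous_al] by blast+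
  then show ?thesis using assms(2) by (auto simp: ldp_def hpairs_def dval_mulp) (auto simp: mulp_def)
qed

lemma ldp_al_factor:
  assumes A: "\<And>H. H \<in> A \<Longrightarrow> affine_line H" and L: "affine_line L \<or> L = {}" "L \<notin> A"
    and \<theta>: "\<theta> \<in> ldp k A" and dvd: "al L dvd fst \<theta>" "al L dvd snd \<theta>" and k: "k \<noteq> 0"
  shows "\<theta> \<in> mulp (al L) ` ldp (k - 1) A"
proof -
  obtain F G where FG: "fst \<theta> = al L * F" "snd \<theta> = al L * G" using dvd by (auto simp: dvd_def)
  then have eq: "\<theta> = mulp (al L) (F, G)" by (simp add: mulp_def prod_eq_iff)
  have "homogeneous (k - 1) F" "homogeneous (k - 1) G"
    using \<theta> FG homogeneous_al_factor[OF L(1) _ k, of F] homogeneous_al_factor[OF L(1) _ k, of G]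
    by (auto simp: ldp_def hpairs_def)
  moreover have "al H dvd dval H (F, G)" if H: "H \<in> A" for H
  proof -
    have "al H dvd al L * dval H (F, G)" using \<theta> H unfolding eq by (auto simp: ldp_def dval_mulp)
    moreover have "\<not> al H dvd al L" using al_dvd_al[of H L] A[OF H] L H by auto
    ultimately show ?thesis using al_prime A[OF H] by blast
  qed
  ultimately have "(F, G) \<in> ldp (k - 1) A" by (simp add: ldp_def hpairs_def)
  then show ?thesis using eq by blast
qed

text \<open>A derivation tangent to \<open>L\<close> restricts to a multiple of the direction of
  \<open>L\<close>. The factor vanishes at each intersection point of \<open>L\<close> with the
  other lines, and the kernel consists of multiples of the form of \<open>L\<close>, one degree
  lower.\<close>

lemma dim_ldp_insert_le:
  assumes A: "finite A" "\<And>H. H \<in> A \<Longrightarrow> affine_line H" and L: "affine_line L" "L \<notin> A" and k: "k \<noteq> 0"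
  shows "vs.dim (ldp k (insert L A)) \<le> vs.dim (ldp (k - 1) A) + (k + 1 - card (L \<inter> \<Union>A))"
proof -
  obtain v w \<alpha> u where "line_param A L v w \<alpha> u"
    using line_param_exists[OF A L] by blast
  note par = line_paramD[OF this]
  have "\<exists>c1 c2. c1 * cb L - c2 * ca L = 1"
  proof (cases "ca L = 0")
    case True
    then have "cb L \<noteq> 0" using affine_line_coeffs[OF L(1)] by auto
    then show ?thesis by (intro exI[of _ "1 / cb L"] exI[of _ 0]) simp
  next
    case False
    then show ?thesis by (intro exI[of _ 0] exI[of _ "- 1 / ca L"]) simp
  qed
  then obtain c1 c2 where c: "c1 * cb L - c2 * ca L = 1" by blast
  \<comment> \<open>The tangential coordinate: \<open>c1\<close> and \<open>c2\<close> are chosen so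
    that the direction \<open>(cb L, - ca L)\<close> has coordinate 1.\<close>
  define \<tau> where "\<tau> \<theta> = rho v w (Const c1 * fst \<theta> + Const c2 * snd \<theta>)" for \<theta>
  have \<tau>_lin: "\<tau> (\<theta> + \<eta>) = \<tau> \<theta> + \<tau> \<eta>" "\<tau> (sc s \<theta>) = smult s (\<tau> \<theta>)" for \<theta> \<eta> s
    by (simp_all add: \<tau>_def rho_add rho_Const_mult smult_add_right algebra_simps)
  have rhoL: "rho v w (al L) = 0" by (simp add: par(1,3))
  have \<tau>: "rho v w (fst \<theta>) = smult (cb L) (\<tau> \<theta>)" "rho v w (snd \<theta>) = smult (- ca L) (\<tau> \<theta>)"
    if "\<theta> \<in> ldp k (insert L A)" for \<theta>
  proof -
    have "rho v w (al L) dvd rho v w (dval L \<theta>)" using that by (intro rho_dvd) (auto simp: ldp_def)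
    then have 0: "smult (ca L) (rho v w (fst \<theta>)) + smult (cb L) (rho v w (snd \<theta>)) = 0"
      by (simp add: rhoL dval_def rho_add rho_Const_mult)
    have "smult (cb L) (\<tau> \<theta>) = smult (c1 * cb L - c2 * ca L) (rho v w (fst \<theta>)) +
        smult c2 (smult (ca L) (rho v w (fst \<theta>)) + smult (cb L) (rho v w (snd \<theta>)))"
      unfolding \<tau>_def rho_add rho_Const_mult by (rule poly_eqI) (simp add: algebra_simps)
    then show "rho v w (fst \<theta>) = smult (cb L) (\<tau> \<theta>)" by (simp add: c 0)
    have "smult (- ca L) (\<tau> \<theta>) = smult (c1 * cb L - c2 * ca L) (rho v w (snd \<theta>)) -
        smult c1 (smult (ca L) (rho v w (fst \<theta>)) + smult (cb L) (rho v w (snd \<theta>)))"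
      unfolding \<tau>_def rho_add rho_Const_mult by (rule poly_eqI) (simp add: algebra_simps)
    then show "rho v w (snd \<theta>) = smult (- ca L) (\<tau> \<theta>)" by (simp add: c 0)
  qed
  \<comment> \<open>A line parallel to \<open>L\<close> has parameter 0 and kills the direction of
    \<open>L\<close>, so it forces no zero of \<open>\<tau>\<close>; only the affine intersection
    points count.\<close>
  define Z where "Z = u ` A - {0}"
  have Z: "finite Z" using A by (simp add: Z_def)
  have "u ` insert {} A = insert 0 Z" "0 \<notin> Z" by (auto simp: Z_def par(4))
  then have cardZ: "card Z = card (L \<inter> \<Union>A)" using par(5) Z by simp
  define B where "B = (\<Prod>q\<in>Z. [:- q, 1:] ^ 1)"
  have degB: "degree B = card (L \<inter> \<Union>A)"
    using degree_prod_linear_powers[of "\<lambda>q. q" "\<lambda>q. 1" Z] cardZ by (simp add: B_def)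
  have B_nz: "B \<noteq> 0" using Z by (auto simp: B_def)
  have B_dvd: "B dvd \<tau> \<theta>" if \<theta>: "\<theta> \<in> ldp k (insert L A)" for \<theta>
    unfolding B_def
  proof (rule prod_linear_powers_dvd[of Z "\<lambda>q. q" "\<lambda>q. 1"])
    fix q assume "q \<in> Z"
    then obtain K where K: "K \<in> A" "u K = q" "q \<noteq> 0" by (auto simp: Z_def)
    have aK: "\<alpha> K \<noteq> 0" "rho v w (al K) = smult (\<alpha> K) [:- q, 1:]" using par(2)[of K] K by auto
    have "rho v w (al K) dvd rho v w (dval K \<theta>)" using \<theta> K by (intro rho_dvd) (auto simp: ldp_def)
    also have "rho v w (dval K \<theta>) = smult (ca K * cb L - cb K * ca L) (\<tau> \<theta>)"
      unfolding dval_def rho_add rho_Const_mult \<tau>[OF \<theta>]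
      by (rule poly_eqI) (simp add: algebra_simps)
    finally have 1: "rho v w (al K) dvd smult (ca K * cb L - cb K * ca L) (\<tau> \<theta>)" .
    have "ca K * cb L - cb K * ca L = - \<alpha> K * q" using par(1)[of K] aK by simp
    then have "ca K * cb L - cb K * ca L \<noteq> 0" using aK K by simp
    then have "rho v w (al K) dvd \<tau> \<theta>" using 1 dvd_smult_cancel by blast
    moreover have "[:- q, 1:] dvd rho v w (al K)" unfolding aK(2) by (metis dvd_refl dvd_smult)
    ultimately show "[:- q, 1:] ^ 1 dvd \<tau> \<theta>" unfolding power_one_right by (rule dvd_trans[rotated])
  qed (use Z in auto)
  let ?m = "k + 1 - card (L \<inter> \<Union>A)"
  let ?S = "{\<theta> \<in> ldp k (insert L A). \<forall>j<?m. coeff (\<tau> \<theta> div B) j = 0}"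
  have "vs.dim (ldp k (insert L A)) \<le> vs.dim ?S + ?m"
    by (rule vs.dim_le_kernel_functionals[OF finite_hbasis ldp_subset_span subspace_ldp])
       (simp_all add: \<tau>_lin coeff_div_linear)
  also have "vs.dim ?S \<le> vs.dim (mulp (al L) ` ldp (k - 1) A)"
  proof (rule vs.dim_mono_finite[OF finite_hbasis])
    have "mulp (al L) ` ldp (k - 1) A \<subseteq> ldp k (insert L A)" using mulp_al_in_ldp[of L _ "k - 1" A] L k by auto
    then show "mulp (al L) ` ldp (k - 1) A \<subseteq> vs.span (hbasis k k)" using ldp_subset_span by blast
    show "?S \<subseteq> mulp (al L) ` ldp (k - 1) A"
    proof
      fix \<theta> assume S: "\<theta> \<in> ?S"
      then have \<theta>: "\<theta> \<in> ldp k (insert L A)" by simp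
      then have hom: "homogeneous k (fst \<theta>)" "homogeneous k (snd \<theta>)" by (auto simp: ldp_def hpairs_def)
      have "degree (\<tau> \<theta>) \<le> k"
        unfolding \<tau>_def using hom by (intro degree_rho homogeneous_add homogeneous_Const_mult)
      then have "\<tau> \<theta> = 0"
        using eq_0_if_coeff_div_0[OF B_dvd[OF \<theta>] B_nz] S degB by auto
      then have "al L dvd fst \<theta>" "al L dvd snd \<theta>" using \<tau>[OF \<theta>] hom par(6) by auto
      then show "\<theta> \<in> mulp (al L) ` ldp (k - 1) A"
        using ldp_al_factor[of A L \<theta> k] A L k \<theta> by (auto simp: ldp_def)
    qed
  qed
  also note dim_mulp_image_le
  finally show ?thesis by simp
qed

subsection \<open>The Hilbert function in large degrees\<close>

definition mult :: "plane set set \<Rightarrow> plane \<Rightarrow> nat" where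
  "mult A p = card {H \<in> A. p \<in> H}"

definition mult_points :: "plane set set \<Rightarrow> plane set" where
  "mult_points A = {p. 2 \<le> mult A p}"

text \<open>The sum of the Moebius values of the points, hence the constant term of the
  characteristic polynomial.\<close>

definition b2 :: "plane set set \<Rightarrow> nat" where
  "b2 A = (\<Sum>p\<in>mult_points A. mult A p - 1)"

lemma mult_pointsE:
  assumes "p \<in> mult_points A"
  obtains H K where "H \<in> A" "K \<in> A" "H \<noteq> K" "p \<in> H" "p \<in> K"
proof -
  have "\<not> card {H \<in> A. p \<in> H} \<le> Suc 0" using assms by (simp add: mult_points_def mult_def)
  moreover have "finite {H \<in> A. p \<in> H}"
    using assms card.infinite[of "{H \<in> A. p \<in> H}"] by (fastforce simp: mult_points_def mult_def)
  ultimately show ?thesis using that by (auto simp: card_le_Suc0_iff_eq)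
qed

lemma finite_mult_points:
  assumes "finite A" "\<And>H. H \<in> A \<Longrightarrow> affine_line H"
  shows "finite (mult_points A)"
proof (rule finite_subset)
  show "mult_points A \<subseteq> (\<Union>(H, K)\<in>{(H, K). H \<in> A \<and> K \<in> A \<and> H \<noteq> K}. H \<inter> K)"
  proof
    fix p assume "p \<in> mult_points A"
    then obtain H K where "H \<in> A" "K \<in> A" "H \<noteq> K" "p \<in> H" "p \<in> K" by (rule mult_pointsE)
    then show "p \<in> (\<Union>(H, K)\<in>{(H, K). H \<in> A \<and> K \<in> A \<and> H \<noteq> K}. H \<inter> K)" by blast
  qed
  have "finite {(H, K). H \<in> A \<and> K \<in> A \<and> H \<noteq> K}"
    by (rule finite_subset[of _ "A \<times> A"]) (use assms in auto)
  then show "finite (\<Union>(H, K)\<in>{(H, K). H \<in> A \<and> K \<in> A \<and> H \<noteq> K}. H \<inter> K)"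
    using assms by (auto intro!: affine_lines_finite_meet)
qed

lemma finite_line_meet:
  assumes "finite A" "\<And>H. H \<in> A \<Longrightarrow> affine_line H" "affine_line L" "L \<notin> A"
  shows "finite (L \<inter> \<Union>A)" "card (L \<inter> \<Union>A) \<le> card A"
proof -
  have eq: "L \<inter> \<Union>A = (\<Union>K\<in>A. L \<inter> K)" by auto
  have fin: "finite (L \<inter> K)" if "K \<in> A" for K using affine_lines_finite_meet[of L K] assms that by auto
  then show "finite (L \<inter> \<Union>A)" unfolding eq using assms(1) by blast
  have "card (L \<inter> K) \<le> 1" if "K \<in> A" for K
    using fin[OF that] affine_lines_meet[of L K] assms that by (subst One_nat_def, subst card_le_Suc0_iff_eq) auto
  then have "(\<Sum>K\<in>A. card (L \<inter> K)) \<le> (\<Sum>K\<in>A. 1)" by (intro sum_mono) auto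
  then show "card (L \<inter> \<Union>A) \<le> card A" unfolding eq using card_UN_le[OF assms(1), of "\<lambda>K. L \<inter> K"] by simp
qed

text \<open>Each point of \<open>L\<close> on another line gains one: an old multiple point by its
  increased multiplicity, a simple point by becoming a double point.\<close>

lemma b2_insert:
  assumes A: "finite A" "\<And>H. H \<in> A \<Longrightarrow> affine_line H" and L: "affine_line L" "L \<notin> A"
  shows "b2 (insert L A) = b2 A + card (L \<inter> \<Union>A)"
proof -
  have m: "mult (insert L A) p = mult A p + (if p \<in> L then 1 else 0)" for p
  proof -
    have "{H \<in> insert L A. p \<in> H} = (if p \<in> L then insert L {H \<in> A. p \<in> H} else {H \<in> A. p \<in> H})" by auto
    then show ?thesis using A L by (simp add: mult_def)
  qed
  have pos: "mult A p \<ge> 1 \<longleftrightarrow> p \<in> \<Union>A" for p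
    using A by (auto simp: mult_def Suc_le_eq card_gt_0_iff)
  define D where "D = mult_points A \<union> (L \<inter> \<Union>A)"
  have fin: "finite D" unfolding D_def using finite_mult_points[of A] finite_line_meet[of A L] A L by auto
  have D: "mult_points (insert L A) = D"
  proof (rule set_eqI)
    fix p
    show "p \<in> mult_points (insert L A) \<longleftrightarrow> p \<in> D"
      using pos[of p] m[of p] by (auto simp: mult_points_def D_def split: if_splits)
  qed
  have "b2 (insert L A) = (\<Sum>p\<in>D. (mult A p - 1) + (if p \<in> L \<inter> \<Union>A then 1 else 0))"
    unfolding b2_def D
  proof (intro sum.cong refl)
    fix p assume "p \<in> D"
    then have "p \<in> \<Union>A" by (auto simp: D_def elim: mult_pointsE)
    then show "mult (insert L A) p - 1 = mult A p - 1 + (if p \<in> L \<inter> \<Union>A then 1 else 0)"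
      using pos[of p] m[of p] by auto
  qed
  also have "\<dots> = (\<Sum>p\<in>D. mult A p - 1) + (\<Sum>p\<in>D. if p \<in> L \<inter> \<Union>A then 1 else 0)"
    by (rule sum.distrib)
  also have "(\<Sum>p\<in>D. mult A p - 1) = b2 A"
    unfolding b2_def using fin by (intro sum.mono_neutral_right) (auto simp: D_def mult_points_def)
  also have "(\<Sum>p\<in>D. if p \<in> L \<inter> \<Union>A then 1 else 0) = card (L \<inter> \<Union>A)"
    using fin by (simp only: sum.inter_restrict[symmetric] sum_constant) (simp add: D_def Int_absorb1)
  finally show ?thesis .
qed

lemma b2_empty [simp]: "b2 {} = 0"
  by (simp add: b2_def mult_points_def mult_def)

lemma dim_ldp_empty: "vs.dim (ldp k {}) = (k + 1) * (k + 2)"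
  using dim_hpairs[of k k] card_mons[of k] by (simp add: ldp_def)

text \<open>Twice the Hilbert polynomial of \<open>D\<^sub>0\<close>; the factor 2 avoids division.
  If \<open>N = d1 + d2\<close> and \<open>b = d1 d2\<close>, it is
  \<open>(k - d1 + 1) (k - d1 + 2) + (k - d2 + 1) (k - d2 + 2)\<close>.\<close>

definition hilb :: "int \<Rightarrow> int \<Rightarrow> int \<Rightarrow> int" where
  "hilb N b k = 2 * (k + 1) * (k + 2) - 2 * N * (k + 1) + N * (N - 1) - 2 * b"

text \<open>The decrement of \<open>dim_ldp_insert_ge\<close> is half the decrement of
  \<open>hilb\<close>; \<open>card A \<le> k\<close> makes the truncated subtraction exact.\<close>

lemma dim_ldp_ge:
  assumes "finite A" "\<And>H. H \<in> A \<Longrightarrow> affine_line H" "card A \<le> k"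
  shows "hilb (card A) (b2 A) k \<le> 2 * int (vs.dim (ldp k A))"
  using assms
proof (induction A rule: finite_induct)
  case empty
  then show ?case by (simp add: hilb_def dim_ldp_empty algebra_simps)
next
  case (insert L A)
  have lines: "\<And>H. H \<in> A \<Longrightarrow> affine_line H" "affine_line L" using insert.prems by auto
  have nu: "card (L \<inter> \<Union>A) \<le> card A" using finite_line_meet[OF insert.hyps(1) lines insert.hyps(2)] by simp
  have 1: "int (vs.dim (ldp k A)) \<le> int (vs.dim (ldp k (insert L A))) + (int k + 1 - (int (card A) - int (card (L \<inter> \<Union>A))))"
    using dim_ldp_insert_ge[OF insert.hyps(1) lines insert.hyps(2), of k] nu insert by simp
  have 2: "hilb (card A) (b2 A) k \<le> 2 * int (vs.dim (ldp k A))"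
    using insert lines by auto
  have 3: "hilb (card (insert L A)) (b2 (insert L A)) k =
     hilb (card A) (b2 A) k - 2 * (int k + 1 - (int (card A) - int (card (L \<inter> \<Union>A))))"
    using insert.hyps b2_insert[OF insert.hyps(1) lines insert.hyps(2)]
    by (simp add: hilb_def algebra_simps)
  have "x \<le> y + z \<Longrightarrow> h \<le> 2 * x \<Longrightarrow> h' = h - 2 * z \<Longrightarrow> h' \<le> 2 * y" for x y z h h' :: int by linarith
  from this[OF 1 2 3] show ?case .
qed

text \<open>The other exact sequence compares degree \<open>k\<close> with degree
  \<open>k - 1\<close>, so \<open>k\<close> is generalized; \<open>card A \<le> k\<close> survives
  since a line is removed at the same time. The quadratic \<open>hilb\<close> satisfies this
  recursion as well, so both bounds meet without any freeness assumption.\<close>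

lemma dim_ldp_le:
  assumes "finite A" "\<And>H. H \<in> A \<Longrightarrow> affine_line H" "card A \<le> k"
  shows "2 * int (vs.dim (ldp k A)) \<le> hilb (card A) (b2 A) k"
  using assms
proof (induction A arbitrary: k rule: finite_induct)
  case empty
  then show ?case by (simp add: hilb_def dim_ldp_empty algebra_simps)
next
  case (insert L A)
  have lines: "\<And>H. H \<in> A \<Longrightarrow> affine_line H" "affine_line L" using insert.prems by auto
  have nu: "card (L \<inter> \<Union>A) \<le> card A" using finite_line_meet[OF insert.hyps(1) lines insert.hyps(2)] by simp
  have k: "card A + 1 \<le> k" using insert by simp
  then have "vs.dim (ldp k (insert L A)) \<le> vs.dim (ldp (k - 1) A) + (k + 1 - card (L \<inter> \<Union>A))"
    by (intro dim_ldp_insert_le insert.hyps lines) auto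
  then have 1: "int (vs.dim (ldp k (insert L A))) \<le> int (vs.dim (ldp (k - 1) A)) + (int k + 1 - int (card (L \<inter> \<Union>A)))"
    using nu k by simp
  have 2: "2 * int (vs.dim (ldp (k - 1) A)) \<le> hilb (card A) (b2 A) (k - 1)"
    using insert.IH[of "k - 1"] lines k by auto
  have 3: "hilb (card (insert L A)) (b2 (insert L A)) k =
     hilb (card A) (b2 A) (int (k - 1)) + 2 * (int k + 1 - int (card (L \<inter> \<Union>A)))"
    using insert.hyps b2_insert[OF insert.hyps(1) lines insert.hyps(2)] k
    by (simp add: hilb_def algebra_simps of_nat_diff)
  have "x \<le> y + z \<Longrightarrow> 2 * y \<le> h \<Longrightarrow> h' = h + 2 * z \<Longrightarrow> 2 * x \<le> h'" for x y z h h' :: int by linarith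
  from this[OF 1 2 3] show ?case .
qed

lemma dim_ldp_eq:
  assumes "finite A" "\<And>H. H \<in> A \<Longrightarrow> affine_line H" "card A \<le> k"
  shows "2 * int (vs.dim (ldp k A)) = hilb (card A) (b2 A) k"
  using dim_ldp_le[of A k] dim_ldp_ge[of A k] assms by force

subsection \<open>Restriction to the line at infinity\<close>

abbreviation rho_inf :: "complex \<Rightarrow> poly3 \<Rightarrow> complex poly" where
  "rho_inf t \<equiv> rho (pt3 1 t 0) (pt3 0 1 0)"

text \<open>On the line at infinity the derivation is written in the basis
  \<open>v = (1, t)\<close>, \<open>w = (0, 1)\<close>: from \<open>F = P\<close> and
  \<open>G = t P + Q\<close> come the two coordinates \<open>topP\<close> and
  \<open>topQ\<close>.\<close>

definition topP :: "complex \<Rightarrow> poly3 \<times> poly3 \<Rightarrow> complex poly" where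
  "topP t \<theta> = rho_inf t (fst \<theta>)"
definition topQ :: "complex \<Rightarrow> poly3 \<times> poly3 \<Rightarrow> complex poly" where
  "topQ t \<theta> = rho_inf t (snd \<theta>) - smult t (topP t \<theta>)"

lemma top_add: "topP t (\<theta> + \<eta>) = topP t \<theta> + topP t \<eta>" "topQ t (\<theta> + \<eta>) = topQ t \<theta> + topQ t \<eta>"
  and top_sc: "topP t (sc c \<theta>) = smult c (topP t \<theta>)" "topQ t (sc c \<theta>) = smult c (topQ t \<theta>)"
  by (simp_all add: topP_def topQ_def rho_add rho_Const_mult smult_add_right smult_diff_right mult.commute)

lemma degree_top:
  assumes "\<theta> \<in> hpairs k k"
  shows "degree (topP t \<theta>) \<le> k" "degree (topQ t \<theta>) \<le> k"
  using assms
  by (auto simp: topP_def topQ_def hpairs_def intro!: degree_rho degree_diff_le order.trans[OF degree_smult_le])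

lemma top_eq_0:
  assumes "\<theta> \<in> hpairs k k" "topP t \<theta> = 0" "topQ t \<theta> = 0"
  shows "al {} dvd fst \<theta>" "al {} dvd snd \<theta>"
proof -
  have *: "al {} dvd F" if F: "homogeneous k F" "rho_inf t F = 0" for F
    unfolding al_dvd_iff[OF disjI2[OF refl]]
  proof (intro allI impI)
    fix x :: "3 \<Rightarrow> complex" assume "ca {} * x 1 + cb {} * x 2 + cc {} * x 3 = 0"
    then have x3: "x 3 = 0" by simp
    have "x = (\<lambda>i. x 1 * pt3 1 t 0 i + (x 2 - t * x 1) * pt3 0 1 0 i)"
    proof
      fix i :: 3
      show "x i = x 1 * pt3 1 t 0 i + (x 2 - t * x 1) * pt3 0 1 0 i"
        using exhaust_3[of i] x3 by auto
    qed
    then show "ev.subst x F = 0" using rho_eq_0_imp_ev[OF F, of "x 1" "x 2 - t * x 1"] by simp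
  qed
  have "rho_inf t (fst \<theta>) = 0" "rho_inf t (snd \<theta>) = 0"
    using assms(2,3) by (simp_all add: topP_def topQ_def)
  then show "al {} dvd fst \<theta>" "al {} dvd snd \<theta>" using * assms(1) by (auto simp: hpairs_def)
qed

text \<open>The degree \<open>k\<close> part of \<open>z D\<^sub>0\<close>; degree 0 is treated
  apart because \<open>k - 1\<close> would truncate.\<close>

definition prev_ldp :: "nat \<Rightarrow> plane set set \<Rightarrow> (poly3 \<times> poly3) set" where
  "prev_ldp k A = (if k = 0 then {0} else mulp (al {}) ` ldp (k - 1) A)"

definition par :: "plane set set \<Rightarrow> plane set \<Rightarrow> plane set set" where
  "par A H = {K \<in> A. K = H \<or> K \<inter> H = {}}"

text \<open>The parameter of the point at infinity of \<open>K\<close>: on \<open>u v + w\<close>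
  the form of \<open>K\<close> is \<open>(ca K + t * cb K) u + cb K\<close>.\<close>

definition slope :: "complex \<Rightarrow> plane set \<Rightarrow> complex" where
  "slope t K = - cb K / (ca K + t * cb K)"

locale lines =
  fixes A :: "plane set set"
  assumes fin: "finite A" and line: "\<And>H. H \<in> A \<Longrightarrow> affine_line H"
begin

lemma empty_notin: "{} \<notin> A" using line affine_line_nonempty by blast

lemma dim_prev: "vs.dim (prev_ldp k A) \<le> (if k = 0 then 0 else vs.dim (ldp (k - 1) A))"
  using vs.dim_le_card[of "{0}" "{}"] by (simp add: prev_ldp_def dim_mulp_image_le)

lemma prev_subset: "prev_ldp k A \<subseteq> ldp k A"
proof (cases "k = 0")
  case True
  then show ?thesis using vs.subspace_0[OF subspace_ldp[of 0 A]] by (simp add: prev_ldp_def)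
next
  case False
  have "mulp (al {}) \<theta> \<in> ldp k A" if "\<theta> \<in> ldp (k - 1) A" for \<theta>
    using mulp_al_in_ldp[of "{}" \<theta> "k - 1" A] that False by (auto simp: ldp_def)
  then show ?thesis using False by (auto simp: prev_ldp_def)
qed

lemma prev_subset_span: "prev_ldp k A \<subseteq> vs.span (hbasis k k)"
  using prev_subset ldp_subset_span by blast

lemma top_kernel:
  assumes "\<theta> \<in> ldp k A" "topP t \<theta> = 0" "topQ t \<theta> = 0"
  shows "\<theta> \<in> prev_ldp k A"
proof -
  have \<theta>: "\<theta> \<in> hpairs k k" using assms by (simp add: ldp_def)
  note dvd = top_eq_0[OF \<theta> assms(2,3)]
  show ?thesis
  proof (cases "k = 0")
    case True
    have "F = 0" if "al {} dvd F" "homogeneous 0 F" for F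
      using that homogeneous_factor_less[OF homogeneous_al, of 0 "{}"] by (auto simp: dvd_def)
    then have "fst \<theta> = 0" "snd \<theta> = 0" using dvd \<theta> True by (auto simp: hpairs_def)
    then show ?thesis using True by (simp add: prev_ldp_def prod_eq_iff)
  next
    case False
    then show ?thesis using ldp_al_factor[of A "{}" \<theta> k] line empty_notin assms(1) dvd by (simp add: prev_ldp_def)
  qed
qed

text \<open>Keeps the point at parameter infinity off all lines, so that every parallel class has a
  finite slope.\<close>

lemma generic_slope: "\<exists>t. \<forall>K\<in>A. ca K + t * cb K \<noteq> 0"
proof -
  have "finite ((\<lambda>K. - ca K / cb K) ` A)" using fin by simp
  then obtain t where t: "t \<notin> (\<lambda>K. - ca K / cb K) ` A"
    using infinite_UNIV_char_0[where 'a = complex] by (metis ex_new_if_finite)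
  have "ca K + t * cb K \<noteq> 0" if "K \<in> A" for K
  proof
    assume 0: "ca K + t * cb K = 0"
    then have "cb K \<noteq> 0" using affine_line_coeffs(1)[OF line[OF that]] by auto
    then have "t = - ca K / cb K" using 0 by (simp add: field_simps add_eq_0_iff)
    then show False using t that by auto
  qed
  then show ?thesis by blast
qed

end

locale lines_slope = lines +
  fixes t :: complex
  assumes t: "\<And>K. K \<in> A \<Longrightarrow> ca K + t * cb K \<noteq> 0"
begin

abbreviation "cls q \<equiv> {K \<in> A. slope t K = q}"

lemma slope_eq_iff:
  assumes "H \<in> A" "K \<in> A"
  shows "slope t H = slope t K \<longleftrightarrow> K \<in> par A H"
proof -
  have "slope t H = slope t K \<longleftrightarrow> cb H * (ca K + t * cb K) = cb K * (ca H + t * cb H)"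
    using t[OF assms(1)] t[OF assms(2)] by (simp add: slope_def field_simps)
  also have "\<dots> \<longleftrightarrow> ca K * cb H = ca H * cb K" by (auto simp: algebra_simps)
  also have "\<dots> \<longleftrightarrow> K \<in> par A H" using parallel_iff[OF line[OF assms(2)] line[OF assms(1)]] assms by (simp add: par_def)
  finally show ?thesis .
qed

lemma cls_slope: "H \<in> A \<Longrightarrow> cls (slope t H) = par A H"
proof -
  assume H: "H \<in> A"
  have "K \<in> cls (slope t H) \<longleftrightarrow> K \<in> par A H" for K
    using slope_eq_iff[OF H, of K] by (auto simp: par_def)
  then show ?thesis by blast
qed

lemma card_slopes: "card (slope t ` A) = card (par A ` A)"
proof -
  have eq: "par A ` A = (\<lambda>q. cls q) ` (slope t ` A)" using cls_slope by (auto simp: image_image intro!: image_cong)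
  have "inj_on (\<lambda>q. cls q) (slope t ` A)" by (rule inj_onI) blast
  then show ?thesis unfolding eq by (rule card_image[symmetric])
qed

lemma card_cls_pos: "q \<in> slope t ` A \<Longrightarrow> 1 \<le> card (cls q)"
  using fin by (auto simp: Suc_le_eq card_gt_0_iff)

lemma sum_cls: "(\<Sum>q\<in>slope t ` A. card (cls q)) = card A"
  using sum.image_gen[OF fin, of "\<lambda>_. 1::nat" "slope t"] by simp

lemma rho_al_top: "K \<in> A \<Longrightarrow> rho_inf t (al K) = smult (ca K + t * cb K) [:- slope t K, 1:]"
  using t by (simp add: rho_al slope_def mult.commute)

lemma rho_dval_top: "K \<in> A \<Longrightarrow> rho_inf t (dval K \<theta>) =
    smult (ca K + t * cb K) (topP t \<theta> - smult (slope t K) (topQ t \<theta>))"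
proof -
  assume "K \<in> A"
  then have s: "(ca K + t * cb K) * slope t K = - cb K" using t by (simp add: slope_def)
  have "smult (ca K + t * cb K) (topP t \<theta> - smult (slope t K) (topQ t \<theta>)) =
    smult (ca K + t * cb K) (topP t \<theta>) - smult ((ca K + t * cb K) * slope t K) (topQ t \<theta>)"
    by (simp add: smult_diff_right)
  also have "\<dots> = smult (ca K + t * cb K) (topP t \<theta>) + smult (cb K) (topQ t \<theta>)" unfolding s by simp
  also have "\<dots> = rho_inf t (dval K \<theta>)"
    unfolding dval_def rho_add rho_Const_mult topQ_def topP_def
    by (simp add: smult_add_left smult_diff_right mult.commute)
  finally show ?thesis by simp
qed

text \<open>Parallel lines have proportional linear parts and the derivation kills \<open>z\<close>,
  so the value on one of them is divisible by the forms of the whole class. At infinity these forms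
  coincide up to constants, and their product becomes a power: Ziegler's multiplicity.\<close>

lemma top_mder:
  assumes "\<theta> \<in> ldp k A"
  shows "(topP t \<theta>, topQ t \<theta>) \<in> mder (slope t ` A) (\<lambda>q. q) (\<lambda>q. card (cls q))"
  unfolding mder_def
proof (clarsimp)
  fix K assume K: "K \<in> A"
  let ?q = "slope t K"
  have "al H dvd dval K \<theta>" if H: "H \<in> cls ?q" for H
  proof -
    define s where "s = (ca K + t * cb K) / (ca H + t * cb H)"
    have nz: "ca H + t * cb H \<noteq> 0" "ca K + t * cb K \<noteq> 0" using t H K by auto
    have "cb H / (ca H + t * cb H) = cb K / (ca K + t * cb K)" using H by (simp add: slope_def)
    then have 1: "cb K = s * cb H" using nz by (simp add: s_def field_simps)
    have "ca K + t * cb K = s * (ca H + t * cb H)" using nz by (simp add: s_def)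
    then have 2: "ca K = s * ca H" using 1 by (simp add: algebra_simps)
    have "dval K \<theta> = Const s * dval H \<theta>"
      by (simp add: dval_def 1 2 Const_mult algebra_simps)
    moreover have "al H dvd dval H \<theta>" using H assms by (simp add: ldp_def)
    ultimately show ?thesis by simp
  qed
  then have "(\<Prod>H\<in>cls ?q. al H) dvd dval K \<theta>" using fin line by (intro prod_al_dvd) auto
  then have "(\<Prod>H\<in>cls ?q. rho_inf t (al H)) dvd rho_inf t (dval K \<theta>)"
    unfolding rho_prod[symmetric] by (rule rho_dvd)
  moreover have "(\<Prod>H\<in>cls ?q. [:- ?q, 1:]) dvd (\<Prod>H\<in>cls ?q. rho_inf t (al H))"
  proof (rule prod_dvd_prod)
    fix H assume "H \<in> cls ?q"
    then have "H \<in> A" "slope t H = ?q" by auto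
    then show "[:- ?q, 1:] dvd rho_inf t (al H)"
      using rho_al_top[of H] dvd_smult[OF dvd_refl] by metis
  qed
  ultimately have "(\<Prod>H\<in>cls ?q. [:- ?q, 1:]) dvd rho_inf t (dval K \<theta>)" by (rule dvd_trans[rotated])
  then have "(\<Prod>H\<in>cls ?q. [:- ?q, 1:]) dvd topP t \<theta> - smult ?q (topQ t \<theta>)"
    unfolding rho_dval_top[OF K] using t[OF K] dvd_smult_cancel by blast
  then show "[:- ?q, 1:] ^ card (cls ?q) dvd topP t \<theta> - smult ?q (topQ t \<theta>)" by simp
qed

end

section \<open>Freeness is read off the line at infinity\<close>

definition admissible :: "nat \<Rightarrow> nat \<Rightarrow> plane set set \<Rightarrow> bool" where
  "admissible n r A \<longleftrightarrow>
    (card (par A ` A) \<le> n \<or> card (par A ` A) = n + 1 \<or> card (par A ` A) = n + r + 1) \<and>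
    (\<forall>H\<in>A. card (par A H) \<le> n + r)"

lemma sum_truncated: "2 * (\<Sum>k\<le>K. k + 1 - m) = (K + 1 - m) * (K + 2 - (m::nat))"
proof (induction K)
  case 0
  then show ?case by (cases m) auto
next
  case (Suc K)
  show ?case
  proof (cases "Suc K + 1 \<le> m")
    case True
    have "(\<Sum>k\<le>Suc K. k + 1 - m) = 0" using True by simp
    then show ?thesis using True by simp
  next
    case False
    then obtain d where "Suc K + 1 = m + Suc d" by (metis less_iff_Suc_add not_le add_Suc_right)
    then have d: "K + 1 - m = d" "K + 2 - m = d + 1" "Suc K + 1 - m = d + 1" "Suc K + 2 - m = d + 2" by auto
    have "2 * (\<Sum>k\<le>Suc K. k + 1 - m) = 2 * (\<Sum>k\<le>K. k + 1 - m) + 2 * (Suc K + 1 - m)"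
      by (simp only: sum.atMost_Suc distrib_left)
    also have "\<dots> = d * (d + 1) + 2 * (d + 1)" unfolding Suc d ..
    finally show ?thesis unfolding d by simp
  qed
qed

text \<open>The increments telescope, and a single strict estimate at \<open>k0\<close> persists in
  all later degrees.\<close>

lemma step_sum_strict:
  fixes a b :: "nat \<Rightarrow> nat"
  assumes step: "\<And>k. a k \<le> (if k = 0 then 0 else a (k - 1)) + b k"
    and strict: "a k0 < (if k0 = 0 then 0 else a (k0 - 1)) + b k0" and "k0 \<le> K"
  shows "a K < (\<Sum>k\<le>K. b k)"
proof -
  have le: "a k \<le> (\<Sum>j\<le>k. b j)" for k
  proof (induction k)
    case 0
    then show ?case using step[of 0] by simp
  next
    case (Suc k)
    then show ?case using step[of "Suc k"] by simp
  qed
  show ?thesis using \<open>k0 \<le> K\<close>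
  proof (induction K rule: dec_induct)
    case base
    then show ?case using strict le[of "k0 - 1"] by (cases k0) auto
  next
    case (step k)
    then show ?case using assms(1)[of "Suc k"] by simp
  qed
qed

lemma hilb_roots:
  fixes n r K :: nat
  assumes "n + r \<le> K"
  shows "hilb (2 * n + r) (n * (n + r)) K =
     int ((K + 1 - n) * (K + 2 - n) + (K + 1 - (n + r)) * (K + 2 - (n + r)))"
proof -
  obtain d where d: "K = n + r + d" using assms le_Suc_ex by blast
  show ?thesis unfolding d by (simp add: hilb_def algebra_simps)
qed

section \<open>Saito's criterion for pairs\<close>

definition det2 :: "poly3 \<times> poly3 \<Rightarrow> poly3 \<times> poly3 \<Rightarrow> poly3" where
  "det2 \<theta> \<eta> = fst \<theta> * snd \<eta> - fst \<eta> * snd \<theta>"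

context lines
begin

definition logs :: "(poly3 \<times> poly3) set" where
  "logs = {\<theta>. \<forall>H\<in>A. al H dvd dval H \<theta>}"

lemma ldp_logs: "\<theta> \<in> ldp k A \<longleftrightarrow> \<theta> \<in> hpairs k k \<and> \<theta> \<in> logs"
  by (auto simp: ldp_def logs_def)

lemma prod_al_dvd_det2:
  assumes "\<theta> \<in> logs" "\<eta> \<in> logs"
  shows "(\<Prod>H\<in>A. al H) dvd det2 \<theta> \<eta>"
proof (rule prod_al_dvd[OF fin])
  fix H assume H: "H \<in> A"
  then have d: "al H dvd dval H \<theta>" "al H dvd dval H \<eta>" using assms by (auto simp: logs_def)
  \<comment> \<open>Eliminating one column expresses both coefficients of \<open>H\<close> times the
    determinant through values on \<open>al H\<close>; one of the two coefficients is
    nonzero.\<close>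
  have "Const (ca H) * det2 \<theta> \<eta> = dval H \<theta> * snd \<eta> - dval H \<eta> * snd \<theta>"
    "Const (cb H) * det2 \<theta> \<eta> = dval H \<eta> * fst \<theta> - dval H \<theta> * fst \<eta>"
    by (simp_all add: det2_def dval_def algebra_simps)
  then have "al H dvd Const (ca H) * det2 \<theta> \<eta>" "al H dvd Const (cb H) * det2 \<theta> \<eta>"
    using d by auto
  then show "al H dvd det2 \<theta> \<eta>"
    using dvd_Const_cancel affine_line_coeffs(1)[OF line[OF H]] by auto
qed (use line in auto)

lemma prod_al_nz: "(\<Prod>H\<in>A. al H) \<noteq> 0"
  using fin line al_nz by auto

lemma homogeneous_prod_al: "S \<subseteq> A \<Longrightarrow> homogeneous (card S) (\<Prod>H\<in>S. al H)"
  using homogeneous_prod[of S "\<lambda>_. 1" al] homogeneous_al finite_subset[OF _ fin] by auto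

text \<open>Cramer's rule has the determinants of \<theta> with the two elements as numerators; both
  are divisible by the product of the forms, which is the denominator up to a constant.\<close>

lemma cramer:
  assumes "\<theta>1 \<in> logs" "\<theta>2 \<in> logs" "det2 \<theta>1 \<theta>2 = Const c * (\<Prod>H\<in>A. al H)" "c \<noteq> 0" "\<theta> \<in> logs"
  shows "\<exists>a b. \<theta> = mulp a \<theta>1 + mulp b \<theta>2"
proof -
  let ?\<Delta> = "det2 \<theta>1 \<theta>2"
  have dvd: "?\<Delta> dvd det2 \<theta> \<theta>2" "?\<Delta> dvd det2 \<theta>1 \<theta>"
    unfolding assms(3) using prod_al_dvd_det2 assms Const_dvd_cancel by auto
  then obtain a b where ab: "det2 \<theta> \<theta>2 = ?\<Delta> * a" "det2 \<theta>1 \<theta> = ?\<Delta> * b" by (auto simp: dvd_def)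
  have nz: "?\<Delta> \<noteq> 0" using assms prod_al_nz by simp
  have "?\<Delta> * fst \<theta> = det2 \<theta> \<theta>2 * fst \<theta>1 + det2 \<theta>1 \<theta> * fst \<theta>2"
    "?\<Delta> * snd \<theta> = det2 \<theta> \<theta>2 * snd \<theta>1 + det2 \<theta>1 \<theta> * snd \<theta>2"
    by (simp_all add: det2_def algebra_simps)
  then have "?\<Delta> * fst \<theta> = ?\<Delta> * (a * fst \<theta>1 + b * fst \<theta>2)" "?\<Delta> * snd \<theta> = ?\<Delta> * (a * snd \<theta>1 + b * snd \<theta>2)"
    by (simp_all add: ab algebra_simps)
  then have "fst \<theta> = a * fst \<theta>1 + b * fst \<theta>2" "snd \<theta> = a * snd \<theta>1 + b * snd \<theta>2"
    using nz by (metis mult_left_cancel)+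
  then show ?thesis by (auto simp: mulp_def prod_eq_iff)
qed

end

lemma homogeneous_0_Const: "homogeneous 0 F \<Longrightarrow> \<exists>c. F = Const c"
proof -
  assume F: "homogeneous 0 F"
  have "F = Const (lookup F 0)"
  proof (rule poly_mapping_eqI)
    fix m
    have "m = 0" if "total_deg m = 0"
      using that by (intro poly_mapping_eqI) (simp add: total_deg_def)
    then show "lookup F m = lookup (Const (lookup F 0)) m"
      using F by (auto simp: homogeneous_iff Const_def lookup_single "when_def")
  qed
  then show ?thesis by blast
qed

context lines_slope
begin

lemma top_low:
  assumes adm: "admissible n r A" and N: "card A = 2 * n + r" and nr: "n \<le> r + 3"
    and \<theta>: "\<theta> \<in> ldp k A" "degree (topP t \<theta>) < n" "degree (topQ t \<theta>) < n"
  shows "topP t \<theta> = 0 \<and> topQ t \<theta> = 0"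
proof (rule mder_eq_0[OF _ _ _ _ _ top_mder[OF \<theta>(1)] \<theta>(2,3)])
  show "finite (slope t ` A)" using fin by simp
  show "inj_on (\<lambda>q. q) (slope t ` A)" by simp
  show "1 \<le> card (cls q) \<and> card (cls q) \<le> n + r" if q: "q \<in> slope t ` A" for q
  proof -
    obtain H where H: "H \<in> A" "q = slope t H" using q by auto
    then have "card (cls q) \<le> n + r" using adm cls_slope[OF H(1)] by (simp add: admissible_def)
    then show ?thesis using card_cls_pos[OF q] by simp
  qed
  show "(\<Sum>q\<in>slope t ` A. card (cls q)) = 2 * n + r" using sum_cls N by simp
  show "card (slope t ` A) \<le> n \<and> n \<le> r + 3 \<or> card (slope t ` A) = n + 1 \<or> card (slope t ` A) = n + r + 1"
    using adm nr by (simp add: card_slopes admissible_def)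
qed

lemma dim_step:
  assumes adm: "admissible n r A" and N: "card A = 2 * n + r" and nr: "n \<le> r + 3"
  shows "vs.dim (ldp k A) \<le> (if k = 0 then 0 else vs.dim (ldp (k - 1) A)) + ((k + 1 - n) + (k + 1 - (n + r)))"
proof -
  have "vs.dim (ldp k A) \<le> vs.dim (prev_ldp k A) + ((k + 1 - n) + (k + 1 - (n + r)))"
  proof (rule dim_le_mder[where P = "topP t" and Q = "topQ t", OF vs.vector_space_axioms finite_hbasis ldp_subset_span subspace_ldp])
    show "degree (topP t x) \<le> k \<and> degree (topQ t x) \<le> k" if "x \<in> ldp k A" for x
      using that degree_top by (auto simp: ldp_def)
    show "x \<in> prev_ldp k A" if "x \<in> ldp k A" "topP t x = 0" "topQ t x = 0" for x
      using top_kernel that by blast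
    show "(topP t x, topQ t x) \<in> mder (slope t ` A) (\<lambda>q. q) (\<lambda>q. card (cls q))" if "x \<in> ldp k A" for x
      using top_mder that .
    show "topP t x = 0 \<and> topQ t x = 0" if "x \<in> ldp k A" "degree (topP t x) < n" "degree (topQ t x) < n" for x
      using top_low[OF assms that] .
  qed (use fin sum_cls N in \<open>simp_all add: top_add top_sc prev_subset_span\<close>)
  then show ?thesis using dim_prev[of k] by linarith
qed

text \<open>The estimates of all increments add up to the value of the Hilbert function, so each is sharp.\<close>

lemma dim_step_sharp:
  assumes adm: "admissible n r A" and N: "card A = 2 * n + r" and nr: "n \<le> r + 3" and b: "b2 A = n * (n + r)"
  shows "\<not> vs.dim (ldp k A) < (if k = 0 then 0 else vs.dim (ldp (k - 1) A)) + ((k + 1 - n) + (k + 1 - (n + r)))"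
proof
  assume strict: "vs.dim (ldp k A) < (if k = 0 then 0 else vs.dim (ldp (k - 1) A)) + ((k + 1 - n) + (k + 1 - (n + r)))"
  \<comment> \<open>Large enough for \<open>k \<le> K\<close> and \<open>card A \<le> K\<close>, so
    that the dimension in degree \<open>K\<close> is known exactly.\<close>
  define K where "K = k + 2 * n + r"
  have "vs.dim (ldp K A) < (\<Sum>j\<le>K. (j + 1 - n) + (j + 1 - (n + r)))"
    by (rule step_sum_strict[OF dim_step[OF assms(1-3)] strict]) (simp add: K_def)
  then have "2 * vs.dim (ldp K A) < 2 * (\<Sum>j\<le>K. j + 1 - n) + 2 * (\<Sum>j\<le>K. j + 1 - (n + r))"
    by (simp add: sum.distrib)
  also have "\<dots> = (K + 1 - n) * (K + 2 - n) + (K + 1 - (n + r)) * (K + 2 - (n + r))"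
    by (simp only: sum_truncated)
  finally have less: "2 * vs.dim (ldp K A) < (K + 1 - n) * (K + 2 - n) + (K + 1 - (n + r)) * (K + 2 - (n + r))" .
  have roots: "hilb (2 * n + r) (n * (n + r)) K = int ((K + 1 - n) * (K + 2 - n) + (K + 1 - (n + r)) * (K + 2 - (n + r)))"
    by (rule hilb_roots) (simp add: K_def)
  have "int (2 * vs.dim (ldp K A)) < hilb (2 * n + r) (n * (n + r)) K"
    unfolding roots of_nat_less_iff by (rule less)
  then have "2 * int (vs.dim (ldp K A)) < hilb (2 * n + r) (n * (n + r)) K" by simp
  moreover have "2 * int (vs.dim (ldp K A)) = hilb (card A) (b2 A) K"
    by (rule dim_ldp_eq) (use fin line N in \<open>auto simp: K_def\<close>)
  ultimately show False by (simp add: N b)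
qed

text \<open>The sharp increment in degree \<open>n\<close> is positive and gives an element outside
  \<open>z D\<^sub>0\<close>. In degree \<open>n + r\<close> it is at least \<open>r + 2\<close>,
  whereas restrictions parallel to that of the first element would account for at most
  \<open>r + 1\<close>. So some determinant is nonzero at infinity; its degree
  \<open>2 n + r\<close> leaves only a constant beside the product of the forms.\<close>

lemma saito_pair:
  assumes adm: "admissible n r A" and N: "card A = 2 * n + r" and nr: "n \<le> r + 3" and b: "b2 A = n * (n + r)"
  shows "\<exists>\<theta>1\<in>ldp n A. \<exists>\<theta>2\<in>ldp (n + r) A. \<exists>c. c \<noteq> 0 \<and> det2 \<theta>1 \<theta>2 = Const c * (\<Prod>H\<in>A. al H)"
proof -
  have "\<exists>\<theta>\<in>ldp n A. topP t \<theta> \<noteq> 0 \<or> topQ t \<theta> \<noteq> 0"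
  proof (rule ccontr)
    assume "\<not> ?thesis"
    then have "ldp n A \<subseteq> prev_ldp n A" using top_kernel by blast
    then have "vs.dim (ldp n A) \<le> vs.dim (prev_ldp n A)"
      using vs.dim_mono_finite[OF finite_hbasis prev_subset_span] by blast
    then show False using dim_prev[of n] dim_step_sharp[OF assms, of n] by simp
  qed
  then obtain \<theta>1 where \<theta>1: "\<theta>1 \<in> ldp n A" "topP t \<theta>1 \<noteq> 0 \<or> topQ t \<theta>1 \<noteq> 0" by blast
  have "\<exists>\<theta>\<in>ldp (n + r) A. topP t \<theta> * topQ t \<theta>1 \<noteq> topP t \<theta>1 * topQ t \<theta>"
  proof (rule ccontr)
    let ?k = "n + r"
    assume "\<not> ?thesis"
    then have par1: "topP t \<theta> * topQ t \<theta>1 = topP t \<theta>1 * topQ t \<theta>" if "\<theta> \<in> ldp ?k A" for \<theta> using that by blast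
    have "vs.dim (ldp ?k A) \<le> vs.dim (prev_ldp ?k A) + (?k + 1 - n)"
    proof (rule dim_le_parallel[where P = "topP t" and Q = "topQ t", OF vs.vector_space_axioms finite_hbasis ldp_subset_span subspace_ldp])
      show "degree (topP t x) \<le> ?k \<and> degree (topQ t x) \<le> ?k" if "x \<in> ldp ?k A" for x
        using that degree_top by (auto simp: ldp_def)
      show "x \<in> prev_ldp ?k A" if "x \<in> ldp ?k A" "topP t x = 0" "topQ t x = 0" for x
        using top_kernel that by blast
      show "topP t x = 0 \<and> topQ t x = 0" if "x \<in> ldp ?k A" "degree (topP t x) < n" "degree (topQ t x) < n" for x
        using top_low[OF assms(1-3) that] .
      show "topP t x * topQ t y = topP t y * topQ t x" if "x \<in> ldp ?k A" "y \<in> ldp ?k A" for x y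
        using parallel_trans[OF par1[OF that(1)] par1[OF that(2)] \<theta>1(2)] .
    qed (simp_all add: top_add top_sc prev_subset_span)
    then show False using dim_prev[of ?k] dim_step_sharp[OF assms, of ?k] by simp
  qed
  then obtain \<theta>2 where \<theta>2: "\<theta>2 \<in> ldp (n + r) A" "topP t \<theta>2 * topQ t \<theta>1 \<noteq> topP t \<theta>1 * topQ t \<theta>2" by blast
  have "rho_inf t (det2 \<theta>1 \<theta>2) = topP t \<theta>1 * topQ t \<theta>2 - topP t \<theta>2 * topQ t \<theta>1"
    by (simp add: det2_def topP_def topQ_def rho_diff rho_mult algebra_simps)
  then have nz: "det2 \<theta>1 \<theta>2 \<noteq> 0" using \<theta>2(2) by auto
  obtain q where q: "det2 \<theta>1 \<theta>2 = (\<Prod>H\<in>A. al H) * q"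
    using prod_al_dvd_det2[of \<theta>1 \<theta>2] \<theta>1 \<theta>2 by (auto simp: ldp_logs dvd_def)
  have "homogeneous (n + (n + r)) (det2 \<theta>1 \<theta>2)"
    unfolding det2_def
  proof (rule homogeneous_diff)
    have h: "homogeneous n (fst \<theta>1)" "homogeneous n (snd \<theta>1)" "homogeneous (n + r) (fst \<theta>2)" "homogeneous (n + r) (snd \<theta>2)"
      using \<theta>1 \<theta>2 by (auto simp: ldp_def hpairs_def)
    show "homogeneous (n + (n + r)) (fst \<theta>1 * snd \<theta>2)" using homogeneous_mult h by blast
    show "homogeneous (n + (n + r)) (fst \<theta>2 * snd \<theta>1)" using homogeneous_mult[OF h(3,2)] by (simp add: add.commute)
  qed
  then have "homogeneous (card A) ((\<Prod>H\<in>A. al H) * q)" unfolding q by (simp add: N add.assoc mult_2)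
  then have "homogeneous 0 q"
    using homogeneous_factor[OF homogeneous_prod_al[OF subset_refl] prod_al_nz] by fastforce
  then obtain c where c: "q = Const c" using homogeneous_0_Const by blast
  then have "c \<noteq> 0" using nz q by auto
  moreover have "det2 \<theta>1 \<theta>2 = Const c * (\<Prod>H\<in>A. al H)" using q c by (simp add: mult.commute)
  ultimately show ?thesis using \<theta>1(1) \<theta>2(1) by blast
qed

end

subsection \<open>Degrees of a basis\<close>

lemma dim_eq_of_bij:
  assumes W: "finite W" "S \<subseteq> vs.span W" "finite W'" "f ` S \<subseteq> vs.span W'" and S: "vs.subspace S" and inj: "inj_on f S"
    and f: "\<And>x y. x \<in> S \<Longrightarrow> y \<in> S \<Longrightarrow> f (x + y) = f x + f y" "\<And>c x. x \<in> S \<Longrightarrow> f (sc c x) = sc c (f x)"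
  shows "vs.dim (f ` S) = vs.dim S"
proof (rule antisym)
  show "vs.dim (f ` S) \<le> vs.dim S" by (rule vs.dim_image_le_on[OF W(1,2) S f])
  let ?g = "inv_into S f"
  have gf: "?g (f x) = x" if "x \<in> S" for x using inj that by simp
  have sub: "vs.subspace (f ` S)"
    unfolding vs.subspace_def
  proof (intro conjI ballI allI)
    have "f 0 = 0" using f(2)[of 0 0] vs.subspace_0[OF S] by simp
    then show "0 \<in> f ` S" using vs.subspace_0[OF S] by force
  next
    fix x y assume "x \<in> f ` S" "y \<in> f ` S"
    then obtain x' y' where "x = f x'" "y = f y'" "x' \<in> S" "y' \<in> S" by auto
    then show "x + y \<in> f ` S" using f(1)[of x' y'] vs.subspace_add[OF S, of x' y'] by (metis image_eqI)
  next
    fix c x assume "x \<in> f ` S"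
    then obtain x' where "x = f x'" "x' \<in> S" by auto
    then show "sc c x \<in> f ` S" using f(2)[of x' c] vs.subspace_scale[OF S, of x' c] by (metis image_eqI)
  qed
  have "vs.dim (?g ` (f ` S)) \<le> vs.dim (f ` S)"
  proof (rule vs.dim_image_le_on[OF W(3,4) sub])
    fix x y assume "x \<in> f ` S" "y \<in> f ` S"
    then obtain x' y' where xy: "x = f x'" "y = f y'" "x' \<in> S" "y' \<in> S" by auto
    then have "x + y = f (x' + y')" "x' + y' \<in> S" using f(1) vs.subspace_add[OF S] by auto
    then show "?g (x + y) = ?g x + ?g y" using gf xy by simp
  next
    fix c x assume "x \<in> f ` S"
    then obtain x' where x: "x = f x'" "x' \<in> S" by auto
    then have "sc c x = f (sc c x')" "sc c x' \<in> S" using f(2) vs.subspace_scale[OF S] by auto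
    then show "?g (sc c x) = sc c (?g x)" using gf x by simp
  qed
  moreover have "?g ` (f ` S) = S" using gf by force
  ultimately show "vs.dim S \<le> vs.dim (f ` S)" by simp
qed

text \<open>Freeness expressed in \<open>D\<^sub>0\<close>, after the Euler derivation has been
  split off.\<close>

locale free_lines = lines +
  fixes d1 d2 :: nat and \<eta>1 \<eta>2 :: "poly3 \<times> poly3"
  assumes \<eta>1: "\<eta>1 \<in> ldp d1 A" and \<eta>2: "\<eta>2 \<in> ldp d2 A"
    and indep: "\<And>a b. mulp a \<eta>1 + mulp b \<eta>2 = 0 \<Longrightarrow> a = 0 \<and> b = 0"
    and gen: "\<And>\<theta>. \<theta> \<in> logs \<Longrightarrow> \<exists>a b. \<theta> = mulp a \<eta>1 + mulp b \<eta>2"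
begin

lemma mulp_logs: "\<theta> \<in> logs \<Longrightarrow> mulp a \<theta> \<in> logs"
  by (auto simp: logs_def dval_mulp)

lemma hom_basis: "homogeneous d1 (fst \<eta>1)" "homogeneous d1 (snd \<eta>1)" "homogeneous d2 (fst \<eta>2)" "homogeneous d2 (snd \<eta>2)"
  using \<eta>1 \<eta>2 by (auto simp: ldp_def hpairs_def)

text \<open>Comparing components of degree \<open>k\<close> allows the coefficients to be replaced
  by homogeneous ones; below the degree of a basis element its coefficient becomes 0.\<close>

lemma ldp_combination:
  assumes "\<theta> \<in> ldp k A"
  shows "\<exists>a b. \<theta> = mulp a \<eta>1 + mulp b \<eta>2 \<and> (if d1 \<le> k then homogeneous (k - d1) a else a = 0)
     \<and> (if d2 \<le> k then homogeneous (k - d2) b else b = 0)"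
proof -
  obtain a b where ab: "\<theta> = mulp a \<eta>1 + mulp b \<eta>2" using gen[of \<theta>] assms by (auto simp: ldp_logs)
  define a' where "a' = (if d1 \<le> k then hcomp (k - d1) a else 0)"
  define b' where "b' = (if d2 \<le> k then hcomp (k - d2) b else 0)"
  have hom: "homogeneous k (fst \<theta>)" "homogeneous k (snd \<theta>)" using assms by (auto simp: ldp_def hpairs_def)
  have f: "fst \<theta> = fst \<eta>1 * a + fst \<eta>2 * b" "snd \<theta> = snd \<eta>1 * a + snd \<eta>2 * b"
    by (simp_all add: ab mulp_def mult.commute)
  have "fst \<theta> = hcomp k (fst \<theta>)" "snd \<theta> = hcomp k (snd \<theta>)"
    using hcomp_homogeneous[OF hom(1), of k] hcomp_homogeneous[OF hom(2), of k] by simp_all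
  then have "fst \<theta> = fst \<eta>1 * a' + fst \<eta>2 * b'" "snd \<theta> = snd \<eta>1 * a' + snd \<eta>2 * b'"
    unfolding f hcomp_add hom_basis[THEN hcomp_mult_homogeneous] by (simp_all add: a'_def b'_def)
  then have "\<theta> = mulp a' \<eta>1 + mulp b' \<eta>2"
    by (simp add: prod_eq_iff mulp_def mult.commute)
  then show ?thesis using homogeneous_hcomp by (intro exI[of _ a'] exI[of _ b']) (auto simp: a'_def b'_def)
qed

lemma dim_ldp_free:
  assumes "d1 \<le> k" "d2 \<le> k"
  shows "2 * vs.dim (ldp k A) = (k - d1 + 1) * (k - d1 + 2) + (k - d2 + 1) * (k - d2 + 2)"
proof -
  define f where "f \<theta> = mulp (fst \<theta>) \<eta>1 + mulp (snd \<theta>) \<eta>2" for \<theta>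
  have lin: "f (x + y) = f x + f y" "f (sc c x) = sc c (f x)" for x y c
    by (simp_all add: f_def mulp_def prod_eq_iff algebra_simps)
  have inj: "inj_on f (hpairs (k - d1) (k - d2))"
  proof (rule inj_onI)
    fix x y assume "f x = f y"
    then have "mulp (fst x - fst y) \<eta>1 + mulp (snd x - snd y) \<eta>2 = 0"
      by (simp add: f_def mulp_def prod_eq_iff algebra_simps)
    from indep[OF this] show "x = y" by (simp add: prod_eq_iff)
  qed
  have img: "f ` hpairs (k - d1) (k - d2) = ldp k A"
  proof
    show "f ` hpairs (k - d1) (k - d2) \<subseteq> ldp k A"
    proof
      fix \<theta> assume "\<theta> \<in> f ` hpairs (k - d1) (k - d2)"
      then obtain a b where ab: "\<theta> = mulp a \<eta>1 + mulp b \<eta>2" "homogeneous (k - d1) a" "homogeneous (k - d2) b"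
        by (auto simp: f_def hpairs_def)
      have "\<theta> \<in> logs" using mulp_logs[of \<eta>1 a] mulp_logs[of \<eta>2 b] \<eta>1 \<eta>2
        by (auto simp: ldp_logs ab logs_def dval_add)
      moreover have "homogeneous k (a * fst \<eta>1)" "homogeneous k (a * snd \<eta>1)" "homogeneous k (b * fst \<eta>2)" "homogeneous k (b * snd \<eta>2)"
        using homogeneous_mult[OF ab(2) hom_basis(1)] homogeneous_mult[OF ab(2) hom_basis(2)]
          homogeneous_mult[OF ab(3) hom_basis(3)] homogeneous_mult[OF ab(3) hom_basis(4)] assms by simp_all
      ultimately show "\<theta> \<in> ldp k A" by (auto simp: ldp_logs hpairs_def ab(1) mulp_def intro: homogeneous_add)
    qed
    show "ldp k A \<subseteq> f ` hpairs (k - d1) (k - d2)"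
    proof
      fix \<theta> assume "\<theta> \<in> ldp k A"
      from ldp_combination[OF this] obtain a b where "\<theta> = mulp a \<eta>1 + mulp b \<eta>2" "homogeneous (k - d1) a" "homogeneous (k - d2) b"
        using assms by auto
      then show "\<theta> \<in> f ` hpairs (k - d1) (k - d2)" by (auto simp: f_def hpairs_def intro!: image_eqI[of _ _ "(a, b)"])
    qed
  qed
  have "vs.dim (f ` hpairs (k - d1) (k - d2)) = vs.dim (hpairs (k - d1) (k - d2))"
    by (rule dim_eq_of_bij[OF finite_hbasis hpairs_subset_span finite_hbasis[of k k] _ subspace_hpairs inj])
       (use img ldp_subset_span lin in auto)
  then show ?thesis using img dim_hpairs[of "k - d1" "k - d2"] card_mons[of "k - d1"] card_mons[of "k - d2"] by simp
qed

text \<open>For large \<open>k\<close> the dimension is known in two ways, from the basis and from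
  \<open>hilb\<close>. Equality determines sum and product of \<open>d1\<close> and
  \<open>d2\<close>, hence the unordered pair.\<close>

lemma exponents:
  assumes N: "card A = 2 * n + r" and b: "b2 A = n * (n + r)"
  shows "d1 = n \<and> d2 = n + r \<or> d1 = n + r \<and> d2 = n"
proof -
  define K where "K = card A + d1 + d2"
  define s where "s = int d1 + int d2"
  define e where "e = int d1 * int d2"
  have eq: "2 * int (k + 1) * int (k + 1) + 2 * int (k + 1) - 2 * int (k + 1) * s - s + s * s - 2 * e
     = hilb (card A) (b2 A) k" if "K \<le> k" for k
  proof -
    have "d1 \<le> k" "d2 \<le> k" "card A \<le> k" using that by (auto simp: K_def)
    then have "int (2 * vs.dim (ldp k A)) = int ((k - d1 + 1) * (k - d1 + 2) + (k - d2 + 1) * (k - d2 + 2))"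
      by (simp only: dim_ldp_free)
    also have "int (2 * vs.dim (ldp k A)) = hilb (card A) (b2 A) k"
      using dim_ldp_eq[OF fin line, of k] \<open>card A \<le> k\<close> by simp
    finally have "hilb (card A) (b2 A) k = int ((k - d1 + 1) * (k - d1 + 2) + (k - d2 + 1) * (k - d2 + 2))" .
    also have "\<dots> = (int k - int d1 + 1) * (int k - int d1 + 2) + (int k - int d2 + 1) * (int k - int d2 + 2)"
      by (simp only: of_nat_add of_nat_mult of_nat_diff[OF \<open>d1 \<le> k\<close>] of_nat_diff[OF \<open>d2 \<le> k\<close>]) simp
    also have "\<dots> = 2 * int (k + 1) * int (k + 1) + 2 * int (k + 1) - 2 * int (k + 1) * s - s + s * s - 2 * e"
      by (simp add: s_def e_def algebra_simps)
    finally show ?thesis by simp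
  qed
  \<comment> \<open>The difference of two consecutive values isolates the sum; one value then gives
    the product.\<close>
  have 1: "s = int (card A)"
    using eq[of K] eq[of "K + 1"] by (simp add: hilb_def algebra_simps)
  then have 2: "e = int (b2 A)"
    using eq[of K] by (simp add: hilb_def algebra_simps)
  have "(int d1 - int n) * (int d1 - int (n + r)) = int d1 * int d1 - (2 * int n + int r) * int d1 + int n * int (n + r)"
    by (simp add: algebra_simps)
  also have "2 * int n + int r = int d1 + int d2" using 1 N by (simp add: s_def)
  also have "int n * int (n + r) = int d1 * int d2" using 2 b by (simp add: e_def)
  finally have "(int d1 - int n) * (int d1 - int (n + r)) = 0" by (simp add: algebra_simps)
  then have "d1 = n \<or> d1 = n + r" by auto
  then show ?thesis using 1 N by (auto simp: s_def)
qed

end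

lemma free_lines_swap: "free_lines A d1 d2 \<eta>1 \<eta>2 \<Longrightarrow> free_lines A d2 d1 \<eta>2 \<eta>1"
  unfolding free_lines_def free_lines_axioms_def by (metis add.commute)

text \<open>Two obstructions: a parallel class that is too large yields a nonzero element of degree
  below \<open>n\<close>, and a forbidden number of classes makes all restrictions to infinity
  multiples of the Euler derivation.\<close>

lemma free_lines_admissible:
  assumes "free_lines A n (n + r) \<eta>1 \<eta>2" and N: "card A = 2 * n + r"
  shows "admissible n r A"
proof -
  interpret free_lines A n "n + r" \<eta>1 \<eta>2 by fact
  have low: "\<theta> = 0" if "\<theta> \<in> ldp k A" "k < n" for \<theta> k
    using ldp_combination[OF that(1)] that(2) by (auto simp: mulp_def prod_eq_iff)
  have \<eta>_nz: "\<eta>1 \<noteq> 0"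
    using indep[of 1 0] by (auto simp: mulp_def prod_eq_iff)
  have par: "card (par A H) \<le> n + r" if H: "H \<in> A" for H
  proof (rule ccontr)
    assume m: "\<not> card (par A H) \<le> n + r"
    let ?S = "A - par A H"
    define Q where "Q = (\<Prod>K\<in>?S. al K)"
    have "par A H \<subseteq> A" by (auto simp: par_def)
    then have "card ?S = card A - card (par A H)" using fin by (simp add: card_Diff_subset finite_subset)
    moreover have "card (par A H) \<le> card A" using fin by (intro card_mono) (auto simp: par_def)
    ultimately have S: "card ?S < n" using m N by linarith
    \<comment> \<open>The constant derivation along \<open>H\<close> is tangent to the whole
      parallel class; the factor \<open>Q\<close> takes care of the remaining lines, of which there
      are fewer than \<open>n\<close>.\<close>
    let ?\<theta> = "(Const (cb H) * Q, Const (- ca H) * Q)"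
    have "homogeneous (card ?S) Q" unfolding Q_def by (rule homogeneous_prod_al) auto
    moreover have "al K dvd dval K ?\<theta>" if K: "K \<in> A" for K
    proof (cases "K \<in> par A H")
      case True
      then have "ca K * cb H = ca H * cb K" using parallel_iff[OF line[OF K] line[OF H]] by (auto simp: par_def)
      moreover have "dval K ?\<theta> = Const (ca K * cb H - ca H * cb K) * Q"
        by (simp add: dval_def Const_mult Const_diff Const_minus algebra_simps)
      ultimately show ?thesis by simp
    next
      case False
      then have "al K dvd Q" unfolding Q_def using K fin by (intro dvd_prodI) auto
      then show ?thesis by (simp add: dval_def)
    qed
    ultimately have "?\<theta> \<in> ldp (card ?S) A" by (simp add: ldp_def hpairs_def homogeneous_Const_mult)
    then have "?\<theta> = 0" using low S by blast
    moreover have "Q \<noteq> 0" unfolding Q_def using fin line al_nz by auto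
    ultimately show False using affine_line_coeffs(1)[OF line[OF H]] by (auto simp: prod_eq_iff)
  qed
  obtain t where "\<forall>K\<in>A. ca K + t * cb K \<noteq> 0" using generic_slope by blast
  then interpret lines_slope A t by unfold_locales auto
  have "card (par A ` A) \<le> n \<or> card (par A ` A) = n + 1 \<or> card (par A ` A) = n + r + 1"
  proof (rule ccontr)
    assume "\<not> ?thesis"
    then have h: "n + 1 < card (slope t ` A)" "card (slope t ` A) \<noteq> n + r + 1" by (auto simp: card_slopes)
    have euler: "topP t \<theta> = [:0, 1:] * topQ t \<theta>" "topQ t \<theta> = 0 \<or> 2 * n + r + 1 \<le> k + card (slope t ` A)"
      if \<theta>: "\<theta> \<in> ldp k A" "k + 1 < card (slope t ` A)" for \<theta> k
    proof -
      have hp: "\<theta> \<in> hpairs k k" using \<theta> by (simp add: ldp_def)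
      have I: "finite (slope t ` A)" "inj_on (\<lambda>q. q) (slope t ` A)" using fin by auto
      note e = mder_euler[OF I card_cls_pos top_mder[OF \<theta>(1)] degree_top[OF hp] \<theta>(2)]
      show "topP t \<theta> = [:0, 1:] * topQ t \<theta>" using e(1) .
      show "topQ t \<theta> = 0 \<or> 2 * n + r + 1 \<le> k + card (slope t ` A)" using e(2) by (simp add: sum_cls N)
    qed
    \<comment> \<open>Otherwise \<eta>1 would be \<open>z\<close> times an element of degree
      \<open>n - 1\<close>, and there is none but 0.\<close>
    have "topQ t \<eta>1 \<noteq> 0"
    proof
      assume 0: "topQ t \<eta>1 = 0"
      then have "topP t \<eta>1 = 0" using euler(1)[OF \<eta>1 h(1)] by simp
      then have "\<eta>1 \<in> prev_ldp n A" using top_kernel[OF \<eta>1] 0 by blast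
      then show False using \<eta>_nz low by (auto simp: prev_ldp_def mulp_def zero_prod_def split: if_splits)
    qed
    \<comment> \<open>As a nonzero multiple of Euler of degree \<open>n\<close>, the restriction of
      \<eta>1 forces \<open>h \<ge> n + r + 1\<close>; equality is excluded by assumption. Now
      \<eta>2, of degree \<open>n + r\<close>, also falls under \<open>mder_euler\<close>.\<close>
    then have h2: "n + r + 1 < card (slope t ` A)" using euler(2)[OF \<eta>1 h(1)] h by linarith
    have top_mulp: "topP t (mulp a \<theta>) = rho_inf t a * topP t \<theta>"
      "topQ t (mulp a \<theta>) = rho_inf t a * topQ t \<theta>" for a \<theta>
      by (simp_all add: topP_def topQ_def mulp_def rho_mult right_diff_distrib)
    have all: "topP t \<theta> = [:0, 1:] * topQ t \<theta>" if \<theta>: "\<theta> \<in> logs" for \<theta>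
    proof -
      obtain a b where "\<theta> = mulp a \<eta>1 + mulp b \<eta>2" using gen[OF \<theta>] by blast
      moreover have "p * (x * q) + p' * (x * q') = x * (p * q + p' * q')" for p p' q q' x :: "complex poly"
        by (simp add: algebra_simps)
      ultimately show ?thesis
        unfolding euler(1)[OF \<eta>1 h(1)] euler(1)[OF \<eta>2 h2] by (simp only: top_add top_mulp euler(1)[OF \<eta>1 h(1)] euler(1)[OF \<eta>2 h2])
    qed
    define Q where "Q = (\<Prod>K\<in>A. al K)"
    \<comment> \<open>A logarithmic derivation whose restriction is nonzero but has first coordinate
      0, so it is no multiple of Euler.\<close>
    have "(0, Q) \<in> logs" using fin by (auto simp: logs_def dval_def Q_def intro!: dvd_mult dvd_prodI)
    then have "[:0, 1:] * rho_inf t Q = 0" using all by (fastforce simp: topP_def topQ_def)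
    moreover have "rho_inf t Q \<noteq> 0"
      unfolding Q_def rho_prod using fin t by (auto simp: rho_al_top)
    ultimately show False by simp
  qed
  then show ?thesis using par by (simp add: admissible_def)
qed

section \<open>Derivations\<close>

lemma partial_superset:
  assumes "finite M" "keys F \<subseteq> M"
  shows "partial i F = (\<Sum>m\<in>M. single (m - single i 1)
     (of_nat (lookup m i) * lookup F m))"
  unfolding partial_def using assms by (intro sum.mono_neutral_left) (auto simp: in_keys_iff)

lemma partial_single: "partial i (single m c) =
    single (m - single i 1) (of_nat (lookup m i) * c)"
  using partial_superset[of "{m}" "single m c" i] by simp

lemma partial_add: "partial i (F + G) = partial i F + partial i G"
proof -
  let ?M = "keys F \<union> keys G"
  have "keys (F + G) \<subseteq> ?M" by (rule keys_add)
  then show ?thesis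
    by (subst (1 2 3) partial_superset[of ?M]) (auto simp: lookup_add distrib_left single_add sum.distrib)
qed

text \<open>Exponents are subtracted with truncation. Where the hypothesis fails, the coefficient in
  the product rule is 0.\<close>

lemma single_minus_add:
  assumes "lookup m i \<noteq> 0"
  shows "m - single i 1 + k = m + k - single i (1::nat)"
  by (rule poly_mapping_eqI) (use assms in \<open>auto simp: lookup_add lookup_minus lookup_single "when_def"\<close>)

lemma partial_mult_single: "partial i (single m c * single k d) =
    single m c * partial i (single k d) + single k d * partial i (single m c)"
proof -
  let ?e = "single i (1::nat)"
  have 1: "single (m + (k - ?e)) (c * (of_nat (lookup k i) * d)) =
     single (m + k - ?e) (of_nat (lookup k i) * (c * d))"
    using single_minus_add[of k i m] by (cases "lookup k i = 0") (simp_all add: add.commute mult.left_commute)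
  have 2: "single (k + (m - ?e)) (d * (of_nat (lookup m i) * c)) =
     single (m + k - ?e) (of_nat (lookup m i) * (c * d))"
    using single_minus_add[of m i k] by (cases "lookup m i = 0") (simp_all add: ac_simps)
  show ?thesis
    by (simp only: mult_single partial_single 1 2) (simp add: lookup_add distrib_right add.commute flip: single_add)
qed

lemma partial_mult: "partial i (F * G) = F * partial i G + G * partial i F"
proof (induction F rule: poly3_single_induct)
  case (single m c)
  show ?case
  proof (induction G rule: poly3_single_induct)
    case (single k d)
    show ?case by (rule partial_mult_single)
  next
    case (add G H)
    then show ?case by (simp add: distrib_left distrib_right partial_add algebra_simps)
  qed
next
  case (add F H)
  then show ?case by (simp add: distrib_left distrib_right partial_add algebra_simps)
qed

lemma partial_Const [simp]: "partial i (Const c) = 0"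
  by (simp add: Const_def partial_single)

lemma partial_Var: "partial i (Var j) = (if i = j then 1 else 0)"
  by (simp add: Var_def partial_single lookup_single "when_def")

lemma DerD:
  assumes "\<theta> \<in> Der"
  shows "\<theta> (f + g) = \<theta> f + \<theta> g" "\<theta> (Const c * f) = Const c * \<theta> f" "\<theta> (f * g) = f * \<theta> g + g * \<theta> f"
    "\<theta> (Const c) = 0"
proof -
  show "\<theta> (f + g) = \<theta> f + \<theta> g" "\<theta> (Const c * f) = Const c * \<theta> f" and m: "\<theta> (f * g) = f * \<theta> g + g * \<theta> f" for f g c
    using assms by (auto simp: Der_def)
  from m[of 1 1] have "\<theta> 1 = 0" by simp
  then show "\<theta> (Const c) = 0" using \<open>\<And>f c. \<theta> (Const c * f) = Const c * \<theta> f\<close>[of c 1] by simp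
qed

lemma Der_eq_partial:
  assumes "\<theta> \<in> Der"
  shows "\<theta> f = (\<Sum>i\<in>UNIV. \<theta> (Var i) * partial i f)"
proof (induction f rule: poly3_induct)
  case (Const c)
  then show ?case using DerD(4)[OF assms] by simp
next
  case (Var j)
  have "(\<Sum>i\<in>UNIV. \<theta> (Var i) * partial i (Var j)) = (\<Sum>i\<in>UNIV. if i = j then \<theta> (Var i) else 0)"
    by (intro sum.cong) (auto simp: partial_Var)
  then show ?case by simp
next
  case (add F G)
  then show ?case by (simp add: DerD(1)[OF assms] partial_add distrib_left sum.distrib)
next
  case (mult F G)
  have "(\<Sum>i\<in>UNIV. \<theta> (Var i) * partial i (F * G)) =
     F * (\<Sum>i\<in>UNIV. \<theta> (Var i) * partial i G) + G * (\<Sum>i\<in>UNIV. \<theta> (Var i) * partial i F)"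
    by (simp add: partial_mult distrib_left sum.distrib sum_distrib_left mult.left_commute)
  then show ?case using mult by (simp add: DerD(3)[OF assms])
qed

lemma Der_eqI:
  assumes "\<theta> \<in> Der" "\<eta> \<in> Der" "\<theta> (Var 1) = \<eta> (Var 1)" "\<theta> (Var 2) = \<eta> (Var 2)" "\<theta> (Var 3) = \<eta> (Var 3)"
  shows "\<theta> = \<eta>"
proof
  fix f
  show "\<theta> f = \<eta> f"
    unfolding Der_eq_partial[OF assms(1), of f] Der_eq_partial[OF assms(2), of f] by (simp add: sum_3 assms(3-5))
qed

lemma Der_sum_partial: "(\<lambda>f. \<Sum>i\<in>UNIV. g i * partial i f) \<in> Der"
  unfolding Der_def
  by (auto simp: partial_add partial_mult distrib_left sum.distrib sum_distrib_left mult.left_commute)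

lemma sum_fun_apply: "(\<Sum>i\<in>S. f i) x = (\<Sum>i\<in>S. f i x)"
  by (induction S rule: infinite_finite_induct) simp_all

lemma euler_Der: "euler \<in> Der"
proof -
  have "euler = (\<lambda>f. \<Sum>i\<in>UNIV. Var i * partial i f)"
    by (simp add: euler_def der_scale_def fun_eq_iff sum_fun_apply)
  then show ?thesis using Der_sum_partial[of Var] by simp
qed

lemma euler_Var: "euler (Var j) = Var j"
proof -
  have "euler (Var j) = (\<Sum>i\<in>UNIV. Var i * partial i (Var j))"
    by (simp add: euler_def der_scale_def sum_fun_apply)
  also have "\<dots> = (\<Sum>i\<in>UNIV. if i = j then Var i else 0)" by (intro sum.cong) (auto simp: partial_Var)
  finally show ?thesis by simp
qed

definition pder :: "poly3 \<times> poly3 \<Rightarrow> poly3 \<Rightarrow> poly3" where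
  "pder \<theta> f = fst \<theta> * partial 1 f + snd \<theta> * partial 2 f"

lemma pder_Der: "pder \<theta> \<in> Der"
  unfolding Der_def pder_def by (auto simp: partial_add partial_mult algebra_simps)

lemma pder_Var [simp]: "pder \<theta> (Var 1) = fst \<theta>" "pder \<theta> (Var 2) = snd \<theta>" "pder \<theta> (Var 3) = 0"
  by (simp_all add: pder_def partial_Var)

lemma Der_lform:
  assumes "\<theta> \<in> Der"
  shows "\<theta> (lform a b c) = Const a * \<theta> (Var 1) + Const b * \<theta> (Var 2) + Const c * \<theta> (Var 3)"
  by (simp add: lform_def DerD(1,2)[OF assms])

lemma Der_comb:
  assumes "\<theta> \<in> Der" "\<eta> \<in> Der"
  shows "(\<lambda>f. a * \<theta> f + b * \<eta> f) \<in> Der"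
  using DerD[OF assms(1)] DerD[OF assms(2)] unfolding Der_def by (auto simp: algebra_simps)

subsection \<open>Logarithmic derivations\<close>

text \<open>\<open>cone_forms\<close> contains every equation of a line, \<open>al\<close> only a
  chosen one. Comparing both equations at \<open>p\<close> and at \<open>p\<close> plus the
  direction of \<open>H\<close> gives the factor.\<close>

lemma line_coeffs_proportional:
  assumes H: "affine_line H" and ab: "(a, b) \<noteq> (0, 0)" "line a b c = H"
  obtains s where "s \<noteq> 0" "a = s * ca H" "b = s * cb H" "c = s * cc H"
proof -
  obtain p where p: "p \<in> H" using affine_line_nonempty[OF H] by auto
  define q where "q = (vector [p $ 1 + cb H, p $ 2 - ca H] :: plane)"
  have "q \<in> H" unfolding affine_line_direction[OF H p] q_def by (intro exI[of _ 1]) simp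
  then have q: "a * (p $ 1 + cb H) + b * (p $ 2 - ca H) + c = 0"
    using ab(2) unfolding line_def q_def by auto
  have p0: "a * p $ 1 + b * p $ 2 + c = 0" using p ab(2) unfolding line_def by auto
  have pH: "ca H * p $ 1 + cb H * p $ 2 + cc H = 0" using p mem_affine_line[OF H] by auto
  have "a * cb H - b * ca H = (a * (p $ 1 + cb H) + b * (p $ 2 - ca H) + c) - (a * p $ 1 + b * p $ 2 + c)"
    by (simp add: algebra_simps)
  then have "a * cb H = b * ca H" using q p0 by simp
  then have "\<exists>s. a = s * ca H \<and> b = s * cb H"
    by (rule proportional_pair[OF affine_line_coeffs(1)[OF H]])
  then obtain s where s: "a = s * ca H" "b = s * cb H" by blast
  have "c - s * cc H = (a * p $ 1 + b * p $ 2 + c) - s * (ca H * p $ 1 + cb H * p $ 2 + cc H)"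
    by (simp add: s algebra_simps)
  then have "c = s * cc H" using p0 pH by simp
  moreover have "s \<noteq> 0" using s ab(1) by auto
  ultimately show ?thesis using that s by blast
qed

lemma al_empty [simp]: "al {} = Var 3"
  by (simp add: al_def lform_def)

context lines
begin

lemma log_derivations_iff:
  "\<theta> \<in> log_derivations A \<longleftrightarrow> \<theta> \<in> Der \<and> Var 3 dvd \<theta> (Var 3) \<and> (\<forall>H\<in>A. al H dvd \<theta> (al H))"
proof (cases "\<theta> \<in> Der")
  case True
  let ?C = "{Const a * Var 1 + Const b * Var 2 + Const c * Var 3 | a b c. (a, b) \<noteq> (0, 0) \<and> line a b c \<in> A}"
  have "(\<forall>\<alpha>\<in>?C. \<alpha> dvd \<theta> \<alpha>)
     \<longleftrightarrow> (\<forall>H\<in>A. al H dvd \<theta> (al H))"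
  proof (intro iffI ballI)
    fix H assume *: "\<forall>\<alpha>\<in>?C. \<alpha> dvd \<theta> \<alpha>" and H: "H \<in> A"
    have "al H \<in> ?C"
      unfolding al_def lform_def
      by (intro CollectI exI[of _ "ca H"] exI[of _ "cb H"] exI[of _ "cc H"])
         (use affine_line_coeffs[OF line[OF H]] H in auto)
    then show "al H dvd \<theta> (al H)" using * by blast
  next
    fix \<alpha> assume *: "\<forall>H\<in>A. al H dvd \<theta> (al H)" and "\<alpha> \<in> ?C"
    then obtain a b c where \<alpha>: "\<alpha> = Const a * Var 1 + Const b * Var 2 + Const c * Var 3"
      and ab: "(a, b) \<noteq> (0, 0)" and L: "line a b c \<in> A" by blast
    obtain s where s: "s \<noteq> 0" "a = s * ca (line a b c)" "b = s * cb (line a b c)" "c = s * cc (line a b c)"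
      using line_coeffs_proportional[OF line[OF L] ab refl] .
    have "Const s * al (line a b c) = lform a b c"
      unfolding al_def lform_scale by (simp only: s(2-4)[symmetric])
    then have eq: "\<alpha> = Const s * al (line a b c)" by (simp add: \<alpha> lform_def)
    have "al (line a b c) dvd \<theta> (al (line a b c))" using * L by blast
    then show "\<alpha> dvd \<theta> \<alpha>"
      unfolding eq DerD(2)[OF True] by (rule mult_dvd_mono[OF dvd_refl])
  qed
  then show ?thesis using True by (auto simp: log_derivations_def cone_forms_def)
qed (simp add: log_derivations_def)

lemma euler_al: "euler (al H) = al H"
  unfolding al_def by (simp add: Der_lform[OF euler_Der] euler_Var) (simp add: lform_def)

lemma pder_al: "pder \<theta> (al H) = dval H \<theta>"
  unfolding al_def by (simp add: Der_lform[OF pder_Der] dval_def)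

lemma pder_log: "pder \<theta> \<in> log_derivations A \<longleftrightarrow> \<theta> \<in> logs"
  by (simp add: log_derivations_iff pder_Der pder_al logs_def)

lemma euler_log: "euler \<in> log_derivations A"
  by (simp add: log_derivations_iff euler_Der euler_al euler_Var)

text \<open>Subtracting \<open>e\<close> times the Euler derivation kills \<open>z\<close>: the
  logarithmic module is the sum of the Euler multiples and \<open>D\<^sub>0\<close>.\<close>

lemma log_derivation_decomposition:
  assumes "\<theta> \<in> log_derivations A" "\<theta> (Var 3) = Var 3 * e"
  defines "\<eta> \<equiv> (\<theta> (Var 1) - e * Var 1, \<theta> (Var 2) - e * Var 2)"
  shows "\<eta> \<in> logs" "\<theta> f = pder \<eta> f + e * euler f"
proof -
  have D: "\<theta> \<in> Der" using assms by (simp add: log_derivations_iff)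
  have "\<theta> = (\<lambda>f. 1 * pder \<eta> f + e * euler f)"
    by (rule Der_eqI[OF D Der_comb[OF pder_Der euler_Der]]) (simp_all add: \<eta>_def euler_Var assms(2))
  then show eq: "\<theta> f = pder \<eta> f + e * euler f" for f by (metis mult_1)
  have "al H dvd pder \<eta> (al H)" if "H \<in> A" for H
  proof -
    have "al H dvd \<theta> (al H)" using assms(1) that by (simp add: log_derivations_iff)
    then have "al H dvd \<theta> (al H) - e * euler (al H)" unfolding euler_al by simp
    also have "\<theta> (al H) - e * euler (al H) = pder \<eta> (al H)" by (simp add: eq)
    finally show ?thesis .
  qed
  then show "\<eta> \<in> logs" by (simp add: logs_def pder_al)
qed

lemma mulp_1 [simp]: "mulp 1 \<theta> = \<theta>"
  by (simp add: mulp_def)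

lemma mult_pder: "a * pder \<theta> f = pder (mulp a \<theta>) f"
  by (simp add: pder_def mulp_def algebra_simps)

lemma pder_add: "pder \<theta> f + pder \<eta> f = pder (\<theta> + \<eta>) f"
  by (simp add: pder_def algebra_simps)

lemma span3:
  assumes "distinct [\<theta>0, \<theta>1, \<theta>2]"
  shows "der.span {\<theta>0, \<theta>1, \<theta>2} = {\<theta>. \<exists>e a b. \<forall>f. \<theta> f = e * \<theta>0 f + a * \<theta>1 f + b * \<theta>2 f}"
proof -
  have "der.span {\<theta>0, \<theta>1, \<theta>2} = range (\<lambda>u. \<Sum>v\<in>{\<theta>0, \<theta>1, \<theta>2}. der_scale (u v) v)"
    by (rule der.span_finite) simp
  also have "\<dots> = range (\<lambda>u. der_scale (u \<theta>0) \<theta>0 + der_scale (u \<theta>1) \<theta>1 + der_scale (u \<theta>2) \<theta>2)"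
    using assms by (simp add: add.assoc)
  also have "\<dots> = {\<theta>. \<exists>e a b. \<forall>f. \<theta> f = e * \<theta>0 f + a * \<theta>1 f + b * \<theta>2 f}"
  proof safe
    fix u
    show "\<exists>e a b. \<forall>f. (der_scale (u \<theta>0) \<theta>0 + der_scale (u \<theta>1) \<theta>1 + der_scale (u \<theta>2) \<theta>2) f = e * \<theta>0 f + a * \<theta>1 f + b * \<theta>2 f"
      by (intro exI[of _ "u \<theta>0"] exI[of _ "u \<theta>1"] exI[of _ "u \<theta>2"]) (simp add: der_scale_def)
  next
    fix \<theta> e a b assume eq: "\<forall>f. \<theta> f = e * \<theta>0 f + a * \<theta>1 f + b * \<theta>2 f"
    define u where "u v = (if v = \<theta>0 then e else if v = \<theta>1 then a else b)" for v
    have "\<theta> = der_scale (u \<theta>0) \<theta>0 + der_scale (u \<theta>1) \<theta>1 + der_scale (u \<theta>2) \<theta>2"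
      using assms eq by (auto simp: u_def der_scale_def fun_eq_iff)
    then show "\<theta> \<in> range (\<lambda>u. der_scale (u \<theta>0) \<theta>0 + der_scale (u \<theta>1) \<theta>1 + der_scale (u \<theta>2) \<theta>2)" by blast
  qed
  finally show ?thesis .
qed

lemma independent3:
  assumes "distinct [\<theta>0, \<theta>1, \<theta>2]"
  shows "der.independent {\<theta>0, \<theta>1, \<theta>2} \<longleftrightarrow>
    (\<forall>e a b. (\<forall>f. e * \<theta>0 f + a * \<theta>1 f + b * \<theta>2 f = 0) \<longrightarrow> e = 0 \<and> a = 0 \<and> b = 0)"
proof -
  have "der.dependent {\<theta>0, \<theta>1, \<theta>2} \<longleftrightarrow>
     (\<exists>u. (\<exists>v\<in>{\<theta>0, \<theta>1, \<theta>2}. u v \<noteq> 0) \<and> (\<Sum>v\<in>{\<theta>0, \<theta>1, \<theta>2}. der_scale (u v) v) = 0)"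
    by (rule der.dependent_finite) simp
  also have "\<dots> \<longleftrightarrow> (\<exists>u. (u \<theta>0 \<noteq> 0 \<or> u \<theta>1 \<noteq> 0 \<or> u \<theta>2 \<noteq> 0) \<and>
      (\<forall>f. u \<theta>0 * \<theta>0 f + u \<theta>1 * \<theta>1 f + u \<theta>2 * \<theta>2 f = 0))"
    using assms by (simp add: add.assoc der_scale_def fun_eq_iff)
  also have "\<dots> \<longleftrightarrow> (\<exists>e a b. (e \<noteq> 0 \<or> a \<noteq> 0 \<or> b \<noteq> 0) \<and> (\<forall>f. e * \<theta>0 f + a * \<theta>1 f + b * \<theta>2 f = 0))"
  proof
    assume "\<exists>e a b. (e \<noteq> 0 \<or> a \<noteq> 0 \<or> b \<noteq> 0) \<and> (\<forall>f. e * \<theta>0 f + a * \<theta>1 f + b * \<theta>2 f = 0)"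
    then obtain e a b where eab: "e \<noteq> 0 \<or> a \<noteq> 0 \<or> b \<noteq> 0" "\<forall>f. e * \<theta>0 f + a * \<theta>1 f + b * \<theta>2 f = 0" by blast
    define u where "u v = (if v = \<theta>0 then e else if v = \<theta>1 then a else b)" for v
    have "u \<theta>0 = e" "u \<theta>1 = a" "u \<theta>2 = b" using assms by (auto simp: u_def)
    then show "\<exists>u. (u \<theta>0 \<noteq> 0 \<or> u \<theta>1 \<noteq> 0 \<or> u \<theta>2 \<noteq> 0) \<and>
      (\<forall>f. u \<theta>0 * \<theta>0 f + u \<theta>1 * \<theta>1 f + u \<theta>2 * \<theta>2 f = 0)" using eab by blast
  qed blast
  finally show ?thesis by blast
qed

text \<open>The nonzero determinant gives independence, \<open>cramer\<close> gives generation, and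
  the Euler coefficient is read off at \<open>Var 3\<close>, where the elements of
  \<open>D\<^sub>0\<close> vanish.\<close>

lemma free_if_saito_pair:
  assumes "\<theta>1 \<in> ldp d1 A" "\<theta>2 \<in> ldp d2 A" "c \<noteq> 0" "det2 \<theta>1 \<theta>2 = Const c * (\<Prod>H\<in>A. al H)"
  shows "free_arrangement A"
proof -
  have logs: "\<theta>1 \<in> logs" "\<theta>2 \<in> logs" using assms by (auto simp: ldp_logs)
  have nz: "det2 \<theta>1 \<theta>2 \<noteq> 0" using assms(3,4) prod_al_nz by simp
  have hom: "homogeneous_derivation (pder \<theta>)" if \<theta>: "\<theta> \<in> ldp k A" for \<theta> k
    unfolding homogeneous_derivation_def
  proof (intro conjI exI[of _ k] allI pder_Der)
    fix i :: 3
    show "homogeneous k (pder \<theta> (Var i))"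
      using exhaust_3[of i] \<theta> by (auto simp: ldp_def hpairs_def)
  qed
  have "Var 3 \<noteq> 0" using al_nz[of "{}"] by simp
  then have ne: "euler \<noteq> pder \<theta>" for \<theta> using euler_Var[of 3] pder_Var(3)[of \<theta>] by metis
  have "pder \<theta>1 \<noteq> pder \<theta>2"
  proof
    assume "pder \<theta>1 = pder \<theta>2"
    then have "\<theta>1 = \<theta>2" by (metis pder_Var(1,2) prod_eq_iff)
    then show False using nz by (simp add: det2_def)
  qed
  then have dist: "distinct [euler, pder \<theta>1, pder \<theta>2]" using ne by simp
  have "der.independent {euler, pder \<theta>1, pder \<theta>2}"
    unfolding independent3[OF dist]
  proof (intro allI impI)
    fix e a b assume 0: "\<forall>f. e * euler f + a * pder \<theta>1 f + b * pder \<theta>2 f = 0"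
    have "e = 0" using 0[rule_format, of "Var 3"] \<open>Var 3 \<noteq> 0\<close> by (simp add: euler_Var)
    have 1: "a * fst \<theta>1 + b * fst \<theta>2 = 0" "a * snd \<theta>1 + b * snd \<theta>2 = 0"
      using 0[rule_format, of "Var 1"] 0[rule_format, of "Var 2"] \<open>e = 0\<close> by simp_all
    have "a * det2 \<theta>1 \<theta>2 = (a * fst \<theta>1 + b * fst \<theta>2) * snd \<theta>2 - (a * snd \<theta>1 + b * snd \<theta>2) * fst \<theta>2"
      "b * det2 \<theta>1 \<theta>2 = (a * snd \<theta>1 + b * snd \<theta>2) * fst \<theta>1 - (a * fst \<theta>1 + b * fst \<theta>2) * snd \<theta>1"
      by (simp_all add: det2_def algebra_simps)
    then have "a * det2 \<theta>1 \<theta>2 = 0" "b * det2 \<theta>1 \<theta>2 = 0" by (simp_all add: 1)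
    then show "e = 0 \<and> a = 0 \<and> b = 0" using nz \<open>e = 0\<close> by simp
  qed
  moreover have "der.span {euler, pder \<theta>1, pder \<theta>2} = log_derivations A"
    unfolding span3[OF dist]
  proof safe
    fix \<theta> e a b assume eq: "\<forall>f. \<theta> f = e * euler f + a * pder \<theta>1 f + b * pder \<theta>2 f"
    have "mulp a \<theta>1 + mulp b \<theta>2 \<in> logs" using logs by (auto simp: logs_def dval_add dval_mulp)
    then have log: "pder (mulp a \<theta>1 + mulp b \<theta>2) \<in> log_derivations A" by (simp add: pder_log)
    have "\<theta> = (\<lambda>f. e * euler f + 1 * pder (mulp a \<theta>1 + mulp b \<theta>2) f)"
      using eq by (simp add: fun_eq_iff mult_pder pder_add add.assoc)
    moreover have "(\<lambda>f. e * euler f + 1 * pder (mulp a \<theta>1 + mulp b \<theta>2) f) \<in> log_derivations A"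
      using euler_log log Der_comb[OF euler_Der pder_Der, of e 1 "mulp a \<theta>1 + mulp b \<theta>2"]
      by (simp add: log_derivations_iff euler_Var euler_al)
    ultimately show "\<theta> \<in> log_derivations A" by simp
  next
    fix \<theta> assume \<theta>: "\<theta> \<in> log_derivations A"
    then obtain e where e: "\<theta> (Var 3) = Var 3 * e" by (auto simp: log_derivations_iff dvd_def)
    note dec = log_derivation_decomposition[OF \<theta> e]
    obtain a b where "(\<theta> (Var 1) - e * Var 1, \<theta> (Var 2) - e * Var 2) = mulp a \<theta>1 + mulp b \<theta>2"
      using cramer[OF logs assms(4,3) dec(1)] by blast
    then have "\<theta> f = e * euler f + a * pder \<theta>1 f + b * pder \<theta>2 f" for f
      using dec(2)[of f] by (simp add: mult_pder pder_add add.assoc add.commute)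
    then show "\<exists>e a b. \<forall>f. \<theta> f = e * euler f + a * pder \<theta>1 f + b * pder \<theta>2 f" by blast
  qed
  ultimately show ?thesis
    unfolding free_arrangement_def using hom assms(1,2) dist by blast
qed

text \<open>The value \<open>z e\<close> at \<open>z\<close> has degree \<open>d\<close>, so
  \<open>e\<close> has degree \<open>d - 1\<close> or is 0; hence correcting a derivation by
  \<open>e\<close> times Euler keeps its coefficients homogeneous of degree
  \<open>d\<close>.\<close>

lemma homogeneous_Var_transfer:
  assumes "homogeneous d (Var 3 * e)"
  shows "homogeneous d (e * Var i)"
proof (cases "d = 0")
  case True
  then have "Var 3 * e = 0" using assms homogeneous_factor_less[OF homogeneous_Var, of 0 3 e] by simp
  then have "e = 0" using al_nz[of "{}"] by simp
  then show ?thesis by simp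
next
  case False
  then have "homogeneous (d - 1) e" using homogeneous_al_factor[of "{}" d e] assms by simp
  then have "homogeneous (d - 1 + 1) (e * Var i)" by (rule homogeneous_mult[OF _ homogeneous_Var])
  then show ?thesis using False by simp
qed

text \<open>Subtracting Euler multiples from the other two basis elements is an invertible change of
  basis that moves them into \<open>D\<^sub>0\<close> without changing their degrees.\<close>

lemma free_lines_if_free:
  assumes "free_arrangement A"
  shows "\<exists>d1 d2 \<eta>1 \<eta>2. free_lines A d1 d2 \<eta>1 \<eta>2"
proof -
  obtain \<theta>1 \<theta>2 where hom: "homogeneous_derivation \<theta>1" "homogeneous_derivation \<theta>2"
    and dist: "distinct [euler, \<theta>1, \<theta>2]" and ind: "der.independent {euler, \<theta>1, \<theta>2}"
    and span: "der.span {euler, \<theta>1, \<theta>2} = log_derivations A"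
    using assms unfolding free_arrangement_def by blast
  have log: "\<theta>1 \<in> log_derivations A" "\<theta>2 \<in> log_derivations A"
    using der.span_superset[of "{euler, \<theta>1, \<theta>2}"] span by auto
  obtain d1 d2 where d: "\<And>i. homogeneous d1 (\<theta>1 (Var i))" "\<And>i. homogeneous d2 (\<theta>2 (Var i))"
    using hom by (auto simp: homogeneous_derivation_def)
  obtain e1 e2 where e: "\<theta>1 (Var 3) = Var 3 * e1" "\<theta>2 (Var 3) = Var 3 * e2"
    using log by (auto simp: log_derivations_iff dvd_def)
  define \<eta>1 where "\<eta>1 = (\<theta>1 (Var 1) - e1 * Var 1, \<theta>1 (Var 2) - e1 * Var 2)"
  define \<eta>2 where "\<eta>2 = (\<theta>2 (Var 1) - e2 * Var 1, \<theta>2 (Var 2) - e2 * Var 2)"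
  note dec1 = log_derivation_decomposition[OF log(1) e(1), folded \<eta>1_def]
  note dec2 = log_derivation_decomposition[OF log(2) e(2), folded \<eta>2_def]
  have "\<eta>1 \<in> ldp d1 A" "\<eta>2 \<in> ldp d2 A"
    using dec1(1) dec2(1) d e homogeneous_Var_transfer[of d1 e1] homogeneous_Var_transfer[of d2 e2]
    by (auto simp: ldp_logs hpairs_def \<eta>1_def \<eta>2_def intro!: homogeneous_diff) (metis d)+
  moreover have "a = 0 \<and> b = 0" if "mulp a \<eta>1 + mulp b \<eta>2 = 0" for a b
  proof -
    have "- (a * e1 + b * e2) * euler f + a * \<theta>1 f + b * \<theta>2 f = pder (mulp a \<eta>1 + mulp b \<eta>2) f" for f
      by (simp add: dec1(2) dec2(2) algebra_simps flip: pder_add mult_pder)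
    then have "\<forall>f. - (a * e1 + b * e2) * euler f + a * \<theta>1 f + b * \<theta>2 f = 0"
      unfolding that by (simp add: pder_def)
    then show ?thesis using ind unfolding independent3[OF dist] by blast
  qed
  moreover have "\<exists>a b. \<theta> = mulp a \<eta>1 + mulp b \<eta>2" if "\<theta> \<in> logs" for \<theta>
  proof -
    have "pder \<theta> \<in> der.span {euler, \<theta>1, \<theta>2}" using that span by (simp add: pder_log)
    then obtain e a b where eq: "\<And>f. pder \<theta> f = e * euler f + a * \<theta>1 f + b * \<theta>2 f"
      unfolding span3[OF dist] by blast
    have *: "pder \<theta> f = (e + a * e1 + b * e2) * euler f + pder (mulp a \<eta>1 + mulp b \<eta>2) f" for f
      by (simp add: eq dec1(2) dec2(2) algebra_simps flip: pder_add mult_pder)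
    \<comment> \<open>At \<open>Var 3\<close> all terms but the Euler one vanish.\<close>
    have "e + a * e1 + b * e2 = 0" using *[of "Var 3"] al_nz[of "{}"] by (simp add: euler_Var)
    then have "pder \<theta> f = pder (mulp a \<eta>1 + mulp b \<eta>2) f" for f using *[of f] by simp
    then have "\<theta> = mulp a \<eta>1 + mulp b \<eta>2" by (metis pder_Var(1,2) prod_eq_iff)
    then show ?thesis by blast
  qed
  ultimately have "free_lines A d1 d2 \<eta>1 \<eta>2" by unfold_locales auto
  then show ?thesis by blast
qed

text \<open>Sufficiency uses a generic slope and the Saito pair. For necessity the exponents are
  known only up to order, hence the swap.\<close>

theorem free_iff_admissible:
  assumes N: "card A = 2 * n + r" and b: "b2 A = n * (n + r)" and nr: "n \<le> r + 3"
  shows "free_arrangement A \<longleftrightarrow> admissible n r A"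
proof
  assume "admissible n r A"
  obtain t where "\<forall>K\<in>A. ca K + t * cb K \<noteq> 0" using generic_slope by blast
  then interpret lines_slope A t by unfold_locales auto
  show "free_arrangement A"
    using saito_pair[OF \<open>admissible n r A\<close> N nr b] free_if_saito_pair by blast
next
  assume "free_arrangement A"
  then obtain d1 d2 \<eta>1 \<eta>2 where F: "free_lines A d1 d2 \<eta>1 \<eta>2" using free_lines_if_free by blast
  then interpret F: free_lines A d1 d2 \<eta>1 \<eta>2 .
  show "admissible n r A"
    using F.exponents[OF N b] F free_lines_swap[OF F] free_lines_admissible N by blast
qed

end

section \<open>The intersection poset\<close>

lemma affine_line_not_singleton: "affine_line H \<Longrightarrow> H \<noteq> {p}"
  using infinite_affine_line by blast

lemma affine_line_not_UNIV:
  assumes "affine_line H" shows "H \<noteq> UNIV"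
proof
  assume U: "H = UNIV"
  have *: "ca H * p $ 1 + cb H * p $ 2 + cc H = 0" for p :: plane
    using mem_affine_line[OF assms, of p] U by auto
  have "ca H = 0" "cb H = 0" using *[of "vector [1, 0]"] *[of "vector [0, 1]"] *[of "vector [0, 0]"] by auto
  then show False using affine_line_coeffs(1)[OF assms] by simp
qed

lemma UNIV_plane_not_singleton: "(UNIV :: plane set) \<noteq> {p}"
proof
  assume "(UNIV :: plane set) = {p}"
  then have "(vector [0, 0] :: plane) = vector [1, 0]" by (metis UNIV_I singletonD)
  then show False by (simp add: vec_eq_iff forall_2)
qed

context lines
begin

lemma meet_singleton:
  assumes "H \<in> A" "K \<in> A" "H \<noteq> K" "p \<in> H" "p \<in> K"
  shows "H \<inter> K = {p}"
  using affine_lines_meet[OF line[OF assms(1)] line[OF assms(2)] assms(4) _ assms(5)] assms by blast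

lemma mult_points_iff: "p \<in> mult_points A \<longleftrightarrow> (\<exists>H\<in>A. \<exists>K\<in>A. H \<noteq> K \<and> p \<in> H \<and> p \<in> K)"
proof
  assume "\<exists>H\<in>A. \<exists>K\<in>A. H \<noteq> K \<and> p \<in> H \<and> p \<in> K"
  then obtain H K where "H \<in> A" "K \<in> A" "H \<noteq> K" "p \<in> H" "p \<in> K" by blast
  then have "card {H, K} \<le> mult A p" unfolding mult_def using fin by (intro card_mono) auto
  moreover have "card {H, K} = 2" using \<open>H \<noteq> K\<close> by simp
  ultimately have "2 \<le> mult A p" by simp
  then show "p \<in> mult_points A" by (simp add: mult_points_def)
qed (blast elim: mult_pointsE)

text \<open>Two distinct lines share at most one point, so any intersection of at least two lines is
  empty or a multiple point.\<close>

lemma intersection_poset_eq: "intersection_poset A = insert UNIV (A \<union> (\<lambda>p. {p}) ` mult_points A)"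
proof (rule set_eqI, rule iffI)
  fix X assume "X \<in> intersection_poset A"
  then obtain B where B: "B \<subseteq> A" "X = \<Inter>B" "X \<noteq> {}" by (auto simp: intersection_poset_def)
  consider "B = {}" | H where "B = {H}" | H K where "H \<in> B" "K \<in> B" "H \<noteq> K" by blast
  then show "X \<in> insert UNIV (A \<union> (\<lambda>p. {p}) ` mult_points A)"
  proof cases
    case (3 H K)
    obtain p where p: "p \<in> X" using B by auto
    then have HK: "H \<in> A" "K \<in> A" "p \<in> H" "p \<in> K" "X \<subseteq> H \<inter> K" using 3 B by auto
    then have "X = {p}" using meet_singleton[OF HK(1,2) 3(3) HK(3,4)] p by blast
    moreover have "p \<in> mult_points A" unfolding mult_points_iff using HK 3(3) by blast
    ultimately show ?thesis by blast
  qed (use B in auto)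
next
  fix X assume "X \<in> insert UNIV (A \<union> (\<lambda>p. {p}) ` mult_points A)"
  then consider "X = UNIV" | "X \<in> A" | p where "p \<in> mult_points A" "X = {p}" by blast
  then show "X \<in> intersection_poset A"
  proof cases
    case 1
    then show ?thesis by (auto simp: intersection_poset_def intro!: exI[of _ "{}"])
  next
    case 2
    then show ?thesis using line affine_line_nonempty by (auto simp: intersection_poset_def intro!: exI[of _ "{X}"])
  next
    case (3 p)
    then obtain H K where HK: "H \<in> A" "K \<in> A" "H \<noteq> K" "p \<in> H" "p \<in> K" by (blast elim: mult_pointsE)
    then have "X = \<Inter>{H, K}" using meet_singleton[OF HK] 3 by simp
    moreover have "{H, K} \<subseteq> A" "X \<noteq> {}" using HK 3 by auto
    ultimately show ?thesis unfolding intersection_poset_def by blast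
  qed
qed

section \<open>Moebius values and the characteristic polynomial\<close>

lemma finite_poset: "finite (intersection_poset A)"
  using fin finite_mult_points[of A] line by (simp add: intersection_poset_eq)

lemma moebius_UNIV: "moebius (intersection_poset A) UNIV = 1"
  by (subst moebius.simps) (simp add: finite_poset)

lemma above_line: "H \<in> A \<Longrightarrow> {Y \<in> intersection_poset A. H \<subset> Y} = {UNIV}"
proof -
  assume H: "H \<in> A"
  have "K = H" if "K \<in> A" "H \<subseteq> K" for K
  proof -
    obtain p where p: "p \<in> H" using affine_line_nonempty[OF line[OF H]] by blast
    obtain q where "q \<in> H" "p \<noteq> q" using p affine_line_not_singleton[OF line[OF H], of p] by blast
    then show ?thesis using affine_lines_meet[OF line[OF H] line[OF that(1)], of p q] p that by auto
  qed
  then show ?thesis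
    using affine_line_not_UNIV[OF line[OF H]] affine_line_not_singleton[OF line[OF H]] affine_line_nonempty[OF line[OF H]]
    by (auto simp: intersection_poset_eq)
qed

lemma moebius_line: "H \<in> A \<Longrightarrow> moebius (intersection_poset A) H = - 1"
  using affine_line_not_UNIV[OF line, of H]
  by (subst moebius.simps) (simp add: finite_poset above_line moebius_UNIV)

lemma moebius_point:
  assumes p: "p \<in> mult_points A"
  shows "moebius (intersection_poset A) {p} = int (mult A p) - 1"
proof -
  have ab: "{Y \<in> intersection_poset A. {p} \<subset> Y} = insert UNIV {H \<in> A. p \<in> H}"
    using affine_line_not_singleton[OF line] UNIV_plane_not_singleton by (auto simp: intersection_poset_eq)
  have "UNIV \<notin> {H \<in> A. p \<in> H}" using affine_line_not_UNIV[OF line] by blast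
  then have "(\<Sum>Y\<in>insert UNIV {H \<in> A. p \<in> H}. moebius (intersection_poset A) Y) =
      1 + (\<Sum>Y\<in>{H \<in> A. p \<in> H}. - 1)"
    using fin by (simp add: moebius_UNIV moebius_line)
  then show ?thesis
    using UNIV_plane_not_singleton[of p]
    by (subst moebius.simps) (simp add: finite_poset ab mult_def)
qed

lemma affine_dim_UNIV: "affine_dim UNIV = 2"
proof -
  have "{p - q | p q. p \<in> UNIV \<and> q \<in> UNIV} = (UNIV :: plane set)"
  proof (rule set_eqI, rule iffI)
    fix x :: plane
    have "x = x - 0" by simp
    then show "x \<in> {p - q | p q. p \<in> UNIV \<and> q \<in> UNIV}" by blast
  qed simp
  then show ?thesis by (simp add: affine_dim_def vec.dim_UNIV card_cart_basis)
qed

lemma affine_dim_point: "affine_dim {p} = 0"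
proof -
  have "{a - b | a b. a \<in> {p} \<and> b \<in> {p}} = {0}" by auto
  then show ?thesis by (simp only: affine_dim_def vec.dim_singleton) simp
qed

lemma affine_dim_line:
  assumes "H \<in> A" shows "affine_dim H = 1"
proof -
  note H = line[OF assms]
  obtain p where p: "p \<in> H" using affine_line_nonempty[OF H] by auto
  define d :: plane where "d = vector [cb H, - ca H]"
  have d: "d \<noteq> 0" using affine_line_coeffs(1)[OF H] by (auto simp: d_def vec_eq_iff forall_2)
  have "{a - b | a b. a \<in> H \<and> b \<in> H} = vec.span {d}"
  proof (rule set_eqI, rule iffI)
    fix x assume "x \<in> {a - b | a b. a \<in> H \<and> b \<in> H}"
    then obtain a b where ab: "x = a - b" "a \<in> H" "b \<in> H" by blast
    then obtain s where "a $ 1 = b $ 1 + s * cb H" "a $ 2 = b $ 2 - s * ca H"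
      using affine_line_direction[OF H ab(3)] by auto
    then have "x = s *s d" by (simp add: ab(1) d_def vec_eq_iff forall_2)
    then show "x \<in> vec.span {d}" unfolding vec.span_singleton by blast
  next
    fix x assume "x \<in> vec.span {d}"
    then obtain s where x: "x = s *s d" by (auto simp: vec.span_singleton)
    have "p + s *s d \<in> H" unfolding affine_line_direction[OF H p]
      by (intro exI[of _ s]) (simp add: d_def)
    moreover have "x = (p + s *s d) - p" by (simp add: x)
    ultimately show "x \<in> {a - b | a b. a \<in> H \<and> b \<in> H}" using p by blast
  qed
  then show ?thesis using d by (simp add: affine_dim_def vec.dim_span vec.dim_singleton)
qed

lemma characteristic_poly_eq:
  "characteristic_poly A = monom 1 2 - monom (int (card A)) 1 + monom (int (b2 A)) 0"
proof -
  let ?L = "intersection_poset A"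
  let ?f = "\<lambda>X. monom (moebius ?L X) (affine_dim X)"
  have fin': "finite A" "finite ((\<lambda>p. {p}) ` mult_points A)" using fin finite_mult_points[of A] line by auto
  have "A \<inter> (\<lambda>p. {p}) ` mult_points A = {}" using affine_line_not_singleton[OF line] by auto
  moreover have "UNIV \<notin> A \<union> (\<lambda>p. {p}) ` mult_points A"
    using affine_line_not_UNIV[OF line] UNIV_plane_not_singleton by auto
  ultimately have "characteristic_poly A = ?f UNIV + (sum ?f A + sum ?f ((\<lambda>p. {p}) ` mult_points A))"
    unfolding characteristic_poly_def using fin'
    by (subst intersection_poset_eq) (simp add: sum.union_disjoint)
  also have "?f UNIV = monom 1 2" by (simp add: moebius_UNIV affine_dim_UNIV)
  also have "sum ?f A = (\<Sum>X\<in>A. monom (- 1) 1)"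
    by (intro sum.cong refl) (simp add: moebius_line affine_dim_line)
  also have "\<dots> = - monom (int (card A)) 1"
    by (rule poly_eqI) (simp only: coeff_sum coeff_minus coeff_monom, simp)
  also have "sum ?f ((\<lambda>p. {p}) ` mult_points A) = (\<Sum>p\<in>mult_points A. monom (int (mult A p - 1)) 0)"
  proof (subst sum.reindex)
    show "sum (?f \<circ> (\<lambda>p. {p})) (mult_points A) = (\<Sum>p\<in>mult_points A. monom (int (mult A p - 1)) 0)"
    proof (intro sum.cong refl)
      fix p assume "p \<in> mult_points A"
      then show "(?f \<circ> (\<lambda>p. {p})) p = monom (int (mult A p - 1)) 0"
        by (simp add: moebius_point affine_dim_point mult_points_def of_nat_diff)
    qed
  qed simp
  also have "\<dots> = monom (int (b2 A)) 0"
    by (rule poly_eqI) (simp add: coeff_sum b2_def)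
  finally show ?thesis by simp
qed

lemma card_b2_of_roots:
  assumes "characteristic_poly A = [:- int n, 1:] * [:- int n - int r, 1:]"
  shows "card A = 2 * n + r" "b2 A = n * (n + r)"
proof -
  have eq: "coeff (monom 1 2 - monom (int (card A)) 1 + monom (int (b2 A)) 0) i =
     coeff ([:- int n, 1:] * [:- int n - int r, 1:]) i" for i
    using assms characteristic_poly_eq by simp
  have "int (card A) = 2 * int n + int r" using eq[of 1] by simp
  then show "card A = 2 * n + r" by linarith
  have "int (b2 A) = int (n * (n + r))" using eq[of 0] by (simp add: algebra_simps)
  then show "b2 A = n * (n + r)" by (simp only: of_nat_eq_iff)
qed

text \<open>Characterizes lines by the order alone: a multiple point is never maximal below the
  plane, since a line lies in between.\<close>

lemma lines_eq_coatoms: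
  "A = {X \<in> intersection_poset A. X \<noteq> UNIV \<and> (\<forall>Y\<in>intersection_poset A. X \<subseteq> Y \<longrightarrow> Y = X \<or> Y = UNIV)}"
    (is "A = ?C")
proof
  show "A \<subseteq> ?C"
  proof
    fix H assume H: "H \<in> A"
    have "Y = H \<or> Y = UNIV" if "Y \<in> intersection_poset A" "H \<subseteq> Y" for Y
      using above_line[OF H] that by blast
    then show "H \<in> ?C" using H affine_line_not_UNIV[OF line[OF H]] by (auto simp: intersection_poset_eq)
  qed
  show "?C \<subseteq> A"
  proof
    fix X assume X: "X \<in> ?C"
    have False if p: "p \<in> mult_points A" "X = {p}" for p
    proof -
      obtain H where "H \<in> A" "p \<in> H" using p(1) by (blast elim: mult_pointsE)
      then show False using X p affine_line_not_singleton[OF line] affine_line_not_UNIV[OF line]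
        by (auto simp: intersection_poset_eq)
    qed
    then show "X \<in> A" using X by (auto simp: intersection_poset_eq)
  qed
qed

lemma points_eq: "(\<lambda>p. {p}) ` mult_points A = intersection_poset A - insert UNIV A"
  using affine_line_not_singleton[OF line] UNIV_plane_not_singleton by (auto simp: intersection_poset_eq)

lemma b2_poset: "b2 A = (\<Sum>X\<in>intersection_poset A - insert UNIV A. card {H \<in> A. X \<subseteq> H} - 1)"
  unfolding points_eq[symmetric] b2_def mult_def by (subst sum.reindex) auto

text \<open>The empty set is not in the poset, so two distinct lines are parallel when they have no
  common lower bound.\<close>

lemma par_poset:
  assumes "H \<in> A"
  shows "par A H = {K \<in> A. K = H \<or> \<not> (\<exists>X\<in>intersection_poset A. X \<subseteq> H \<and> X \<subseteq> K)}"
proof -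
  have "K \<inter> H = {} \<longleftrightarrow> \<not> (\<exists>X\<in>intersection_poset A. X \<subseteq> H \<and> X \<subseteq> K)" if K: "K \<in> A" "K \<noteq> H" for K
  proof
    assume *: "\<not> (\<exists>X\<in>intersection_poset A. X \<subseteq> H \<and> X \<subseteq> K)"
    show "K \<inter> H = {}"
    proof (rule equals0I)
      fix p assume p: "p \<in> K \<inter> H"
      then have "p \<in> mult_points A" unfolding mult_points_iff using K assms by blast
      then have "{p} \<in> intersection_poset A" by (simp add: intersection_poset_eq)
      then show False using * p by blast
    qed
  next
    assume e: "K \<inter> H = {}"
    show "\<not> (\<exists>X\<in>intersection_poset A. X \<subseteq> H \<and> X \<subseteq> K)"
    proof safe
      fix X assume "X \<in> intersection_poset A" "X \<subseteq> H" "X \<subseteq> K"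
      then show False using e by (auto simp: intersection_poset_def)
    qed
  qed
  then show ?thesis unfolding par_def by blast
qed

end

section \<open>Transport along a poset isomorphism\<close>

lemma admissible_poset_invariant:
  assumes "lines A" "lines B" "inclusion_isomorphic (intersection_poset A) (intersection_poset B)"
  shows "card A = card B" "b2 A = b2 B" "admissible n r A \<longleftrightarrow> admissible n r B"
proof -
  interpret A: lines A by fact
  interpret B: lines B by fact
  define P where "P = intersection_poset A"
  define Q where "Q = intersection_poset B"
  have "\<exists>f. bij_betw f P Q \<and> (\<forall>X\<in>P. \<forall>Y\<in>P. X \<subseteq> Y \<longleftrightarrow> f X \<subseteq> f Y)"
    using assms(3) unfolding inclusion_isomorphic_def P_def Q_def .
  then obtain f where bij: "bij_betw f P Q" and f: "\<forall>X\<in>P. \<forall>Y\<in>P. X \<subseteq> Y \<longleftrightarrow> f X \<subseteq> f Y"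
    by (elim exE conjE)
  have ord: "X \<subseteq> Y \<longleftrightarrow> f X \<subseteq> f Y" if "X \<in> P" "Y \<in> P" for X Y using bspec[OF bspec[OF f that(1)] that(2)] .
  have inj: "inj_on f P" and img: "f ` P = Q" using bij by (auto simp: bij_betw_def)
  have UP: "UNIV \<in> P" "UNIV \<in> Q" by (auto simp: P_def Q_def A.intersection_poset_eq B.intersection_poset_eq)
  have fU: "f UNIV = UNIV"
  proof -
    obtain X where "X \<in> P" "f X = UNIV" using UP(2) img by auto
    then show ?thesis using ord[of X UNIV] UP by auto
  qed
  have feq: "f X = f Y \<longleftrightarrow> X = Y" if "X \<in> P" "Y \<in> P" for X Y using inj that by (auto simp: inj_on_def)
  \<comment> \<open>Being a coatom is preserved by \<open>f\<close>, because \<open>f\<close>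
    respects the order in both directions and fixes the top element.\<close>
  have lineP: "X \<in> A \<longleftrightarrow> f X \<in> B" if X: "X \<in> P" for X
  proof -
    have "X \<in> A \<longleftrightarrow> X \<noteq> UNIV \<and> (\<forall>Y\<in>P. X \<subseteq> Y \<longrightarrow> Y = X \<or> Y = UNIV)"
      using X by (subst A.lines_eq_coatoms) (simp add: P_def)
    also have "\<dots> \<longleftrightarrow> f X \<noteq> UNIV \<and> (\<forall>Y\<in>P. f X \<subseteq> f Y \<longrightarrow> f Y = f X \<or> f Y = UNIV)"
    proof -
      have e1: "X = UNIV \<longleftrightarrow> f X = UNIV" using feq[OF X UP(1)] fU by simp
      have e2: "(X \<subseteq> Y \<longrightarrow> Y = X \<or> Y = UNIV) \<longleftrightarrow> (f X \<subseteq> f Y \<longrightarrow> f Y = f X \<or> f Y = UNIV)" if Y: "Y \<in> P" for Y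
        using feq[OF Y X] feq[OF Y UP(1)] ord[OF X Y] fU by simp
      have "(\<forall>Y\<in>P. X \<subseteq> Y \<longrightarrow> Y = X \<or> Y = UNIV) \<longleftrightarrow> (\<forall>Y\<in>P. f X \<subseteq> f Y \<longrightarrow> f Y = f X \<or> f Y = UNIV)"
        by (rule ball_cong[OF refl e2])
      then show ?thesis using e1 by simp
    qed
    also have "\<dots> \<longleftrightarrow> f X \<noteq> UNIV \<and> (\<forall>Y\<in>Q. f X \<subseteq> Y \<longrightarrow> Y = f X \<or> Y = UNIV)"
      unfolding img[symmetric] by blast
    also have "\<dots> \<longleftrightarrow> f X \<in> B"
    proof -
      have "f X \<in> Q" using X img by blast
      then show ?thesis by (subst B.lines_eq_coatoms) (simp add: Q_def)
    qed
    finally show ?thesis .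
  qed
  have AP: "A \<subseteq> P" "B \<subseteq> Q" by (auto simp: P_def Q_def A.intersection_poset_eq B.intersection_poset_eq)
  have fA: "f ` A = B" using lineP AP img by blast
  have injA: "inj_on f A" using inj AP(1) by (rule inj_on_subset)
  show "card A = card B" using card_image[OF injA] fA by simp
  have fpts: "f ` (P - insert UNIV A) = Q - insert UNIV B"
  proof -
    have "f ` (P - insert UNIV A) = f ` P - f ` insert UNIV A"
      by (rule inj_on_image_set_diff[OF inj]) (use AP UP in auto)
    then show ?thesis by (simp add: img fU fA)
  qed
  have above: "card {H \<in> A. X \<subseteq> H} = card {K \<in> B. f X \<subseteq> K}" if X: "X \<in> P" for X
  proof -
    have "{K \<in> B. f X \<subseteq> K} = f ` {H \<in> A. X \<subseteq> H}" using ord[OF X] AP unfolding fA[symmetric] by blast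
    then show ?thesis using card_image[of f "{H \<in> A. X \<subseteq> H}"] inj_on_subset[OF injA, of "{H \<in> A. X \<subseteq> H}"] by simp
  qed
  show "b2 A = b2 B"
    unfolding A.b2_poset B.b2_poset
    unfolding P_def[symmetric] Q_def[symmetric] fpts[symmetric]
    using inj_on_subset[OF inj, of "P - insert UNIV A"] above by (subst sum.reindex) auto
  have parf: "par B (f H) = f ` par A H" if H: "H \<in> A" for H
  proof -
    have HP: "H \<in> P" using H AP by blast
    have "f H \<in> B" using fA H by blast
    have eq: "f K = f H \<or> \<not> (\<exists>X\<in>Q. X \<subseteq> f H \<and> X \<subseteq> f K) \<longleftrightarrow> K = H \<or> \<not> (\<exists>X\<in>P. X \<subseteq> H \<and> X \<subseteq> K)" if K: "K \<in> A" for K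
    proof -
      have KP: "K \<in> P" using K AP by blast
      have "(\<exists>X\<in>Q. X \<subseteq> f H \<and> X \<subseteq> f K) \<longleftrightarrow> (\<exists>X\<in>P. X \<subseteq> H \<and> X \<subseteq> K)"
        unfolding img[symmetric] bex_simps(7) using ord[OF _ HP] ord[OF _ KP] by (intro bex_cong) auto
      then show ?thesis using feq[OF KP HP] by simp
    qed
    have "par B (f H) = {K \<in> f ` A. K = f H \<or> \<not> (\<exists>X\<in>Q. X \<subseteq> f H \<and> X \<subseteq> K)}"
      unfolding B.par_poset[OF \<open>f H \<in> B\<close>] Q_def fA ..
    also have "\<dots> = f ` {K \<in> A. f K = f H \<or> \<not> (\<exists>X\<in>Q. X \<subseteq> f H \<and> X \<subseteq> f K)}"
      by blast
    also have "{K \<in> A. f K = f H \<or> \<not> (\<exists>X\<in>Q. X \<subseteq> f H \<and> X \<subseteq> f K)} =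
        {K \<in> A. K = H \<or> \<not> (\<exists>X\<in>P. X \<subseteq> H \<and> X \<subseteq> K)}"
      by (rule Collect_cong, rule conj_cong[OF refl eq])
    finally show ?thesis unfolding A.par_poset[OF H] P_def .
  qed
  have cardpar: "card (par B (f H)) = card (par A H)" if H: "H \<in> A" for H
    unfolding parf[OF H] by (rule card_image[OF inj_on_subset[OF injA]]) (auto simp: par_def)
  have "par B ` B = par B ` (f ` A)" by (simp only: fA)
  also have "\<dots> = (\<lambda>S. f ` S) ` (par A ` A)"
    unfolding image_image by (rule image_cong[OF refl parf])
  finally have img_par: "par B ` B = (\<lambda>S. f ` S) ` (par A ` A)" .
  have "inj_on (\<lambda>S. f ` S) (par A ` A)"
  proof (rule inj_onI)
    fix S T assume ST: "S \<in> par A ` A" "T \<in> par A ` A" "f ` S = f ` T"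
    then have "S \<subseteq> A" "T \<subseteq> A" by (auto simp: par_def)
    then show "S = T" using inj_on_image_eq_iff[OF injA] ST(3) by simp
  qed
  then have "card (par B ` B) = card (par A ` A)" unfolding img_par by (rule card_image)
  moreover have "(\<forall>K\<in>B. card (par B K) \<le> n + r) \<longleftrightarrow> (\<forall>H\<in>A. card (par B (f H)) \<le> n + r)"
    using fA by blast
  moreover have "\<dots> \<longleftrightarrow> (\<forall>H\<in>A. card (par A H) \<le> n + r)" using cardpar by simp
  ultimately show "admissible n r A \<longleftrightarrow> admissible n r B" by (simp add: admissible_def)
qed

lemma lines_if_arrangement: "affine_line_arrangement A \<Longrightarrow> lines A"
  by unfold_locales (auto simp: affine_line_arrangement_def)

theorem corollary5p4:
  fixes \<A> :: "plane set set" and n r :: nat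
  assumes "affine_line_arrangement \<A>"
    and "characteristic_poly \<A> = [:- int n, 1:] * [:- int n - int r, 1:]"
    and "int r \<ge> int n - 3"
  shows "\<forall>\<A>\<^sub>1. affine_line_arrangement \<A>\<^sub>1 \<and>
           inclusion_isomorphic (intersection_poset \<A>\<^sub>1) (intersection_poset \<A>)
         \<longrightarrow> (free_arrangement \<A>\<^sub>1 \<longleftrightarrow> free_arrangement \<A>)"
proof (intro allI impI, elim conjE)
  fix \<A>\<^sub>1 assume \<A>\<^sub>1: "affine_line_arrangement \<A>\<^sub>1"
    and iso: "inclusion_isomorphic (intersection_poset \<A>\<^sub>1) (intersection_poset \<A>)"
  have l: "lines \<A>\<^sub>1" "lines \<A>" using \<A>\<^sub>1 assms(1) lines_if_arrangement by auto
  have N: "card \<A> = 2 * n + r" "b2 \<A> = n * (n + r)"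
    using lines.card_b2_of_roots[OF l(2) assms(2)] by auto
  have nr: "n \<le> r + 3" using assms(3) by linarith
  note inv = admissible_poset_invariant[OF l iso]
  have "free_arrangement \<A>\<^sub>1 \<longleftrightarrow> admissible n r \<A>\<^sub>1"
    using lines.free_iff_admissible[OF l(1) _ _ nr] inv(1,2) N by simp
  moreover have "free_arrangement \<A> \<longleftrightarrow> admissible n r \<A>"
    using lines.free_iff_admissible[OF l(2) N nr] .
  ultimately show "free_arrangement \<A>\<^sub>1 \<longleftrightarrow> free_arrangement \<A>" using inv(3) by simp
qed

end
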